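(* Let $N\ge 1$, $\alpha\in(0,2)$, $\beta\ge 0$, $p>1$, let $h:(0,\infty)\to(0,\infty)$ with $h\in L^1_{loc}(0,\infty)$, and let $u_0\in L^\infty(\mathbb{R}^N)$. Then there is $T=T(u_0)>0$ such that the problem $$\partial_t u+t^{\beta}\mathcal{L}u=-h(t)u^p\quad (x\in\mathbb{R}^N,\ t>0),\qquad u(x,0)=u_0(x)\quad (x\in\mathbb{R}^N)$$ possesses a unique $L^\infty(\mathbb{R}^N)$ solution $u$ on the interval $[0,T]$. Moreover, there exists a maximal time $T_m\in(T,\infty]$ with the following properties: 1. The solution $u$ can be continued in a unique way to an $L^\infty(\mathbb{R}^N)$ solution on the interval $[0,T_m)$. 2. If $T_m=\infty$, then $u$ is a global solution. 3. If $T_m<\infty$, then $\lim_{t\to T_m}\|u(t)\|_{L^\infty(\mathbb{R}^N)}=\infty$. 4. If $u_0(x)\ge 0$, then $u(x,t)\ge 0$. 5. If $u_0\in L^\infty(\mathbb{R}^N)\cap L^r(\mathbb{R}^N)$, where $1\le r\le\infty$, then $u\in C([0,T_m),L^\infty(\mathbb{R}^N)\cap L^r(\mathbb{R}^N))$.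
   Context: $\mathcal{L}=-\Delta+(-\Delta)^{\alpha/2}$, where $(-\Delta)^{\alpha/2}$ is the Fourier multiplier with symbol $|\xi|^\alpha$. For $t>0$, $E_\alpha(t)=P_2(t)\ast P_\alpha(t)$ is the heat kernel of $-\mathcal{L}$, where $P_2(t)(x)=(4\pi t)^{-N/2}e^{-|x|^2/(4t)}$ and $P_\alpha(t)(x)=(2\pi)^{-N}\int_{\mathbb{R}^N}e^{ix\cdot\xi-t|\xi|^\alpha}\,d\xi$; convolution with $E_\alpha(0)$ means the identity operator. The nonlinearity $u^p$ is understood as $|u|^{p-1}u$. An $L^\infty(\mathbb{R}^N)$ solution on $[0,T]$ is a function $u\in L^\infty([0,T],L^\infty(\mathbb{R}^N))$ satisfying, for $t\in[0,T]$, the integral equation $$u(t)=E_\alpha\!\left(\tfrac{t^{\beta+1}}{\beta+1}\right)\ast u_0-\int_0^t h(s)\,E_\alpha\!\left(\tfrac{t^{\beta+1}}{\beta+1}-\tfrac{s^{\beta+1}}{\beta+1}\right)\ast\big(|u(s)|^{p-1}u(s)\big)\,ds .$$ A solution on $[0,T_m)$ is a function on $[0,T_m)$ which is a solution on $[0,T']$ for every $T'<T_m$; a global solution is a solution on $[0,\infty)$. The maximal time $T_m$ is the supremum of all $T'>0$ for which a solution exists on $[0,T']$.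
   Formalization: h is taken integrable on every (0,b) (h=1/s, u_0=1 fails); in item 5, L^∞-norm continuity at t=0 is claimed only if u_0 has a uniformly continuous representative (it fails otherwise), with L^r continuity for r<∞ and weak-* continuity at t=0 kept in general. *)

theory Defs
  imports "HOL-Analysis.Analysis" "HOL-Probability.Essential_Supremum"
begin

section \<open>Lebesgue spaces\<close>

text \<open>The exponent ranges over the extended nonnegative reals; \<open>r = \<infinity>\<close> is the
  space of essentially bounded functions. Elements of the spaces are represented by functions,
  so that equality of elements is equality almost everywhere.\<close>

definition Lp_norm :: "ennreal \<Rightarrow> ('a::euclidean_space \<Rightarrow> real) \<Rightarrow> ennreal" where
  "Lp_norm r f =
    (if r = \<infinity> then esssup lebesgue (\<lambda>x. ennreal \<bar>f x\<bar>)
     else let I = (\<integral>\<^sup>+ x. ennreal (\<bar>f x\<bar> powr enn2real r) \<partial>lebesgue)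
          in if I = \<infinity> then \<infinity> else ennreal (enn2real I powr (1 / enn2real r)))"

definition in_Lp :: "ennreal \<Rightarrow> ('a::euclidean_space \<Rightarrow> real) \<Rightarrow> bool" where
  "in_Lp r f \<longleftrightarrow> f \<in> borel_measurable lebesgue \<and> Lp_norm r f < \<infinity>"

definition agree_on :: "real set \<Rightarrow> (real \<Rightarrow> 'a::euclidean_space \<Rightarrow> real) \<Rightarrow> (real \<Rightarrow> 'a \<Rightarrow> real) \<Rightarrow> bool" where
  "agree_on I u v \<longleftrightarrow> (\<forall>t\<in>I. AE x in lebesgue. u t x = v t x)"

definition Lp_continuous_on :: "real set \<Rightarrow> ennreal \<Rightarrow> (real \<Rightarrow> 'a::euclidean_space \<Rightarrow> real) \<Rightarrow> bool" where
  "Lp_continuous_on I r u \<longleftrightarrow>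
     (\<forall>t\<in>I. in_Lp r (u t)) \<and>
     (\<forall>t\<in>I. ((\<lambda>s. Lp_norm r (\<lambda>x. u s x - u t x)) \<longlongrightarrow> 0) (at t within I))"

definition Linf_weak_star_continuous_on :: "real set \<Rightarrow> (real \<Rightarrow> 'a::euclidean_space \<Rightarrow> real) \<Rightarrow> bool" where
  "Linf_weak_star_continuous_on I u \<longleftrightarrow>
     (\<forall>t\<in>I. in_Lp \<infinity> (u t)) \<and>
     (\<forall>g. in_Lp 1 g \<longrightarrow> continuous_on I (\<lambda>t. LINT x|lebesgue. u t x * g x))"

text \<open>The Bochner space \<open>L\<^sup>\<infinity>([0,T], L\<^sup>\<infinity>)\<close>. The library notions of measurability and of
  the Bochner integral need a second countable range, which \<open>L\<^sup>\<infinity>\<close> is not. Strong measurability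
  is therefore spelled out: almost everywhere in time, the function is the norm limit of simple
  functions with values in \<open>L\<^sup>\<infinity>\<close>.\<close>

definition Linf_simple :: "(real \<Rightarrow> 'a::euclidean_space \<Rightarrow> real) \<Rightarrow> bool" where
  "Linf_simple \<phi> \<longleftrightarrow>
     (\<exists>(m::nat) (A :: nat \<Rightarrow> real set) (g :: nat \<Rightarrow> 'a \<Rightarrow> real).
        (\<forall>i<m. A i \<in> sets lebesgue \<and> in_Lp \<infinity> (g i)) \<and>
        \<phi> = (\<lambda>t x. \<Sum>i<m. indicator (A i) t * g i x))"

definition Linf_strongly_measurable_on :: "real set \<Rightarrow> (real \<Rightarrow> 'a::euclidean_space \<Rightarrow> real) \<Rightarrow> bool" where
  "Linf_strongly_measurable_on I u \<longleftrightarrow>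
     (\<exists>\<phi> :: nat \<Rightarrow> real \<Rightarrow> 'a \<Rightarrow> real.
        (\<forall>k. Linf_simple (\<phi> k)) \<and>
        (AE t in lebesgue. t \<in> I \<longrightarrow>
           (\<lambda>k. Lp_norm \<infinity> (\<lambda>x. \<phi> k t x - u t x)) \<longlonglongrightarrow> 0))"

definition Linf_Linf :: "real \<Rightarrow> (real \<Rightarrow> 'a::euclidean_space \<Rightarrow> real) \<Rightarrow> bool" where
  "Linf_Linf T u \<longleftrightarrow>
     (\<forall>t\<in>{0..T}. in_Lp \<infinity> (u t)) \<and>
     Linf_strongly_measurable_on {0..T} u \<and>
     (\<exists>M::real. AE t in lebesgue. t \<in> {0..T} \<longrightarrow> Lp_norm \<infinity> (u t) \<le> ennreal M)"

section \<open>The heat kernel of the mixed local-nonlocal operator\<close>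

definition gauss_kernel :: "real \<Rightarrow> 'a::euclidean_space \<Rightarrow> real" where
  "gauss_kernel t x =
     (4 * pi * t) powr (- real DIM('a) / 2) * exp (- (norm x)\<^sup>2 / (4 * t))"

text \<open>The integral below is real because its phase is odd; \<open>Re\<close> only changes the type.\<close>

definition fractional_kernel :: "real \<Rightarrow> real \<Rightarrow> 'a::euclidean_space \<Rightarrow> real" where
  "fractional_kernel \<alpha> t x =
     (2 * pi) powr (- real DIM('a)) *
     Re (LINT \<xi>::'a|lborel.
           exp (\<i> * complex_of_real (x \<bullet> \<xi>) - complex_of_real (t * norm \<xi> powr \<alpha>)))"

definition convolution :: "('a::euclidean_space \<Rightarrow> real) \<Rightarrow> ('a \<Rightarrow> real) \<Rightarrow> 'a \<Rightarrow> real" where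
  "convolution k f x = (LINT y|lebesgue. k (x - y) * f y)"

definition mixed_kernel :: "real \<Rightarrow> real \<Rightarrow> 'a::euclidean_space \<Rightarrow> real" where
  "mixed_kernel \<alpha> t = convolution (gauss_kernel t) (fractional_kernel \<alpha> t)"

definition mixed_heat :: "real \<Rightarrow> real \<Rightarrow> ('a::euclidean_space \<Rightarrow> real) \<Rightarrow> 'a \<Rightarrow> real" where
  "mixed_heat \<alpha> \<tau> f = (if \<tau> = 0 then f else convolution (mixed_kernel \<alpha> \<tau>) f)"

section \<open>Solutions\<close>

definition clock :: "real \<Rightarrow> real \<Rightarrow> real" where
  "clock \<beta> t = t powr (\<beta> + 1) / (\<beta> + 1)"

definition signed_power :: "real \<Rightarrow> real \<Rightarrow> real" where
  "signed_power p v = \<bar>v\<bar> powr (p - 1) * v"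

text \<open>For \<open>s < t\<close> the function \<open>mixed_heat \<alpha> (clock \<beta> t - clock \<beta> s) f\<close> is bounded and
  continuous and depends only on the class of \<open>f\<close>, so the pointwise time integral below
  represents the Bochner integral in \<open>L\<^sup>\<infinity>\<close>.\<close>

definition Linf_solution_on ::
  "real \<Rightarrow> real \<Rightarrow> real \<Rightarrow> (real \<Rightarrow> real) \<Rightarrow> ('a::euclidean_space \<Rightarrow> real) \<Rightarrow> real \<Rightarrow>
   (real \<Rightarrow> 'a \<Rightarrow> real) \<Rightarrow> bool" where
  "Linf_solution_on \<alpha> \<beta> p h u0 T u \<longleftrightarrow>
     Linf_Linf T u \<and>
     (\<forall>t\<in>{0..T}. AE x in lebesgue.
        u t x = mixed_heat \<alpha> (clock \<beta> t) u0 x -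
          (LINT s:{0<..<t}|lebesgue.
             h s * mixed_heat \<alpha> (clock \<beta> t - clock \<beta> s) (\<lambda>y. signed_power p (u s y)) x))"

definition Linf_solution_until ::
  "real \<Rightarrow> real \<Rightarrow> real \<Rightarrow> (real \<Rightarrow> real) \<Rightarrow> ('a::euclidean_space \<Rightarrow> real) \<Rightarrow> ereal \<Rightarrow>
   (real \<Rightarrow> 'a \<Rightarrow> real) \<Rightarrow> bool" where
  "Linf_solution_until \<alpha> \<beta> p h u0 Tm u \<longleftrightarrow>
     (\<forall>T'>0. ereal T' < Tm \<longrightarrow> Linf_solution_on \<alpha> \<beta> p h u0 T' u)"

definition global_Linf_solution ::
  "real \<Rightarrow> real \<Rightarrow> real \<Rightarrow> (real \<Rightarrow> real) \<Rightarrow> ('a::euclidean_space \<Rightarrow> real) \<Rightarrow>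
   (real \<Rightarrow> 'a \<Rightarrow> real) \<Rightarrow> bool" where
  "global_Linf_solution \<alpha> \<beta> p h u0 u \<longleftrightarrow>
     (\<forall>T'>0. Linf_solution_on \<alpha> \<beta> p h u0 T' u)"

definition maximal_time ::
  "real \<Rightarrow> real \<Rightarrow> real \<Rightarrow> (real \<Rightarrow> real) \<Rightarrow> ('a::euclidean_space \<Rightarrow> real) \<Rightarrow> ereal" where
  "maximal_time \<alpha> \<beta> p h u0 =
     Sup {ereal T' | T'. 0 < T' \<and> (\<exists>v. Linf_solution_on \<alpha> \<beta> p h u0 T' v)}"

definition times_before :: "ereal \<Rightarrow> real set" where
  "times_before Tm = {t. 0 \<le> t \<and> ereal t < Tm}"

text \<open>Local integrability up to the origin: the time integral in the notion of solution runs
  from \<open>0\<close>, and for \<open>h s = 1 / s\<close> with constant nonzero data it would diverge.\<close>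

definition locally_integrable_halfline :: "(real \<Rightarrow> real) \<Rightarrow> bool" where
  "locally_integrable_halfline h \<longleftrightarrow> (\<forall>b>0. set_integrable lebesgue {0<..<b} h)"

text \<open>Continuity on \<open>[0, Tm)\<close> with values in \<open>L\<^sup>\<infinity> \<inter> L\<^sup>r\<close>. For positive times this is
  continuity in both norms. At time \<open>0\<close> it is continuity in the \<open>L\<^sup>r\<close> norm for finite \<open>r\<close>, and
  weak-star continuity in \<open>L\<^sup>\<infinity>\<close>; continuity in the \<open>L\<^sup>\<infinity>\<close> norm is required at time \<open>0\<close> when
  the initial value is uniformly continuous. It fails for other initial values, since the heat
  orbit is uniformly continuous in space at positive times: for the indicator function of a ball
  its \<open>L\<^sup>\<infinity>\<close> distance to the initial value is at least \<open>1/2\<close>.\<close>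

definition Linf_Lr_continuous_before ::
  "ereal \<Rightarrow> ennreal \<Rightarrow> ('a::euclidean_space \<Rightarrow> real) \<Rightarrow> (real \<Rightarrow> 'a \<Rightarrow> real) \<Rightarrow> bool" where
  "Linf_Lr_continuous_before Tm r u0 u \<longleftrightarrow>
     Lp_continuous_on (times_before Tm - {0}) \<infinity> u \<and>
     Lp_continuous_on (times_before Tm - {0}) r u \<and>
     (r \<noteq> \<infinity> \<longrightarrow> Lp_continuous_on (times_before Tm) r u) \<and>
     Linf_weak_star_continuous_on (times_before Tm) u \<and>
     ((\<exists>w. uniformly_continuous_on UNIV w \<and> (AE x in lebesgue. u0 x = w x)) \<longrightarrow>
        Lp_continuous_on (times_before Tm) \<infinity> u \<and> Lp_continuous_on (times_before Tm) r u)"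

end

theory Submission
  imports Defs "HOL-Probability.Probability" "HOL-Real_Asymp.Real_Asymp"
begin

text \<open>
  Because the reaction is absorbing, solutions never blow up, so the maximal time is infinite.
  Fix a bound \<open>R\<close> of \<open>|u\<^sub>0|\<close> and put \<open>\<kappa> = p R\<^sup>p\<^sup>-\<^sup>1\<close> and \<open>H t = \<integral>\<^sub>0\<^sup>t h\<close>. Adding \<open>\<kappa> h u\<close> to both sides
  of the equation gives the mild form
  \<open>u(t) = e\<^sup>-\<^sup>\<kappa>\<^sup>H\<^sup>t E(t,0) u\<^sub>0 + \<integral>\<^sub>0\<^sup>t e\<^sup>-\<^sup>\<kappa>\<^sup>(\<^sup>H\<^sup>t\<^sup>-\<^sup>H\<^sup>s\<^sup>) h(s) E(t,s) (\<kappa> u - |u|\<^sup>p\<^sup>-\<^sup>1 u)(s) ds\<close>,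
  whose right-hand side is monotone in \<open>u\<close> for \<open>|u| \<le> R\<close> and maps the order interval between
  \<open>-E(t,0) u\<^sub>0\<^sup>-\<close> and \<open>E(t,0) u\<^sub>0\<^sup>+\<close> into itself. Monotone iteration from the lower end yields a
  global solution; its position in the order interval gives positivity and the \<open>L\<^sup>r\<close> bounds.
  Uniqueness is a Gronwall argument with the weight \<open>e\<^sup>2\<^sup>L\<^sup>H\<^sup>t\<close>, where \<open>L\<close> is a Lipschitz constant
  of the reaction. Continuity rests on the \<open>L\<^sup>1\<close> continuity of the heat kernel in time.

  Positivity of the kernel: with \<open>z = exp (-\<delta>|\<xi>|\<^sup>2)\<close>, the function
  \<open>exp (-t ((1 - z)/\<delta>)\<^sup>\<alpha>\<^sup>/\<^sup>2)\<close> is a power series in \<open>z\<close> with nonnegative coefficients, hence a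
  limit of positive combinations of Gaussians, and it tends to \<open>exp (-t|\<xi>|\<^sup>\<alpha>)\<close> as \<open>\<delta> \<rightarrow> 0\<close>.
\<close>

section \<open>Fourier transform of Gaussians\<close>

text \<open>\<open>E(t,s)\<close> is the heat operator run for the time
  \<open>clock \<beta> t - clock \<beta> s\<close>. For data that are merely bounded the heat orbit
  is in general not norm continuous in L-infinity at time 0, so a solution cannot be sought among
  norm-continuous curves on a closed interval. All functions are instead jointly Borel in (t, x),
  bounded at every point and compared pointwise; monotone limits then exist at every point and for
  all times at once.

  The ends of the order interval are free evolutions of constant sign: a reaction that points
  towards 0 makes them a sub- and a supersolution.

  Two obstacles shape the details. Since \<open>h\<close> is only integrable, \<open>H\<close> need
  not be differentiable everywhere, and the chain rule is replaced by integral identities. And a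
  competing solution is only a curve of classes: it is first replaced, for almost every time, by a
  bounded Borel function, and the given \<open>h\<close> and \<open>u0\<close> are replaced by Borel
  representatives in the same way.\<close>

lemma lborel_prod_Basis:
  fixes f :: "'a::euclidean_space \<Rightarrow> real \<Rightarrow> 'b::{real_normed_field,banach,second_countable_topology}"
  assumes int: "\<And>b. b \<in> Basis \<Longrightarrow> integrable lborel (f b)"
  shows integrable_lborel_prod_Basis: "integrable lborel (\<lambda>x::'a. \<Prod>b\<in>Basis. f b (x \<bullet> b))"
    and integral_lborel_prod_Basis:
      "(\<integral>x. (\<Prod>b\<in>Basis. f b (x \<bullet> b)) \<partial>(lborel::'a measure)) = (\<Prod>b\<in>Basis. \<integral>t. f b t \<partial>lborel)"
proof -
  interpret product_sigma_finite "\<lambda>_::'a. lborel :: real measure"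
    by standard
  let ?P = "Pi\<^sub>M (Basis::'a set) (\<lambda>_. lborel :: real measure)"
  let ?T = "\<lambda>g. \<Sum>b\<in>Basis. g b *\<^sub>R b :: 'a"
  have T: "?T \<in> measurable ?P borel" by measurable
  have [measurable]: "f b \<in> borel_measurable borel" if "b \<in> Basis" for b
    using borel_measurable_integrable[OF int[OF that]] by simp
  have meas: "(\<lambda>x::'a. \<Prod>b\<in>Basis. f b (x \<bullet> b)) \<in> borel_measurable borel"
    by measurable
  have eq: "(\<Prod>b\<in>Basis. f b (?T g \<bullet> b)) = (\<Prod>b\<in>Basis. f b (g b))" for g
    by (intro prod.cong) (auto simp: inner_sum_left_Basis)
  have "integrable ?P (\<lambda>g. \<Prod>b\<in>Basis. f b (g b))"
    by (rule product_integrable_prod) (auto intro: int)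
  then show "integrable lborel (\<lambda>x::'a. \<Prod>b\<in>Basis. f b (x \<bullet> b))"
    by (subst lborel_eq, subst integrable_distr_eq[OF T meas]) (simp add: eq)
  show "(\<integral>x. (\<Prod>b\<in>Basis. f b (x \<bullet> b)) \<partial>(lborel::'a measure)) = (\<Prod>b\<in>Basis. \<integral>t. f b t \<partial>lborel)"
    by (subst lborel_eq, subst integral_distr[OF T meas])
      (simp add: eq product_integral_prod int)
qed

text \<open>This is the characteristic function of the standard normal law after the substitution x
  -> c x with c^2 = 2 s, which turns exp(-x^2/2) into exp(-s x^2).\<close>

lemma gaussian_fourier_real:
  fixes s t :: real
  assumes s: "0 < s"
  shows "integrable lborel (\<lambda>x. iexp (t * x) * exp (- s * x\<^sup>2))"
    and "(\<integral>x. iexp (t * x) * exp (- s * x\<^sup>2) \<partial>lborel) = complex_of_real (sqrt (pi / s) * exp (- t\<^sup>2 / (4 * s)))"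
proof -
  define c where "c = sqrt (2 * s)"
  have c: "c > 0" "c\<^sup>2 = 2 * s" using s by (auto simp: c_def)
  have "integrable lborel (\<lambda>y. std_normal_density y *\<^sub>R iexp (t / c * y))"
    by (rule Bochner_Integration.integrable_bound[OF integrable_normal_density[of 1 0]])
      (auto simp: norm_mult)
  moreover have "(\<integral>y. std_normal_density y *\<^sub>R iexp (t / c * y) \<partial>lborel) = exp (- (t / c)\<^sup>2 / 2)"
    using fun_cong[OF char_std_normal_distribution, of "t / c"]
    unfolding char_def by (subst (asm) integral_density) (auto simp: )
  ultimately have "has_bochner_integral lborel (\<lambda>y. std_normal_density y *\<^sub>R iexp (t / c * y)) (exp (- (t / c)\<^sup>2 / 2))"
    by (simp add: has_bochner_integral_iff)
  then have "has_bochner_integral lborel (\<lambda>y. std_normal_density (0 + c * y) *\<^sub>R iexp (t / c * (0 + c * y))) (complex_of_real (exp (- (t / c)\<^sup>2 / 2)) /\<^sub>R \<bar>c\<bar>)"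
    by (subst (asm) lborel_has_bochner_integral_real_affine_iff[of c _ _ 0]) (use c in auto)
  then have "has_bochner_integral lborel (\<lambda>y. sqrt (2 * pi) *\<^sub>R (std_normal_density (0 + c * y) *\<^sub>R iexp (t / c * (0 + c * y)))) (sqrt (2 * pi) *\<^sub>R (complex_of_real (exp (- (t / c)\<^sup>2 / 2)) /\<^sub>R \<bar>c\<bar>))"
    by (rule has_bochner_integral_scaleR_right)
  moreover have "(\<lambda>y. sqrt (2 * pi) *\<^sub>R (std_normal_density (0 + c * y) *\<^sub>R iexp (t / c * (0 + c * y)))) = (\<lambda>x. iexp (t * x) * exp (- s * x\<^sup>2))"
    using c by (auto simp: std_normal_density_def scaleR_conv_of_real power_mult_distrib fun_eq_iff real_sqrt_mult simp flip: exp_of_real of_real_mult)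
  moreover have "sqrt (2 * pi) *\<^sub>R (complex_of_real (exp (- (t / c)\<^sup>2 / 2)) /\<^sub>R \<bar>c\<bar>) = complex_of_real (sqrt (pi / s) * exp (- t\<^sup>2 / (4 * s)))"
  proof -
    have "sqrt (2 * pi) / c = sqrt (pi / s)"
      unfolding c_def by (simp add: real_sqrt_divide real_sqrt_mult)
    then have "sqrt (2 * pi) * (exp (- (t / c)\<^sup>2 / 2) / c) = sqrt (pi / s) * exp (- t\<^sup>2 / (4 * s))"
      using c by (simp add: power_divide field_simps)
    then show ?thesis using c
      by (simp add: scaleR_conv_of_real field_simps flip: of_real_mult of_real_divide)
  qed
  ultimately have *: "has_bochner_integral lborel (\<lambda>x. iexp (t * x) * exp (- s * x\<^sup>2)) (complex_of_real (sqrt (pi / s) * exp (- t\<^sup>2 / (4 * s))))"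
    by simp
  then show "integrable lborel (\<lambda>x. iexp (t * x) * exp (- s * x\<^sup>2))"
    and "(\<integral>x. iexp (t * x) * exp (- s * x\<^sup>2) \<partial>lborel) = complex_of_real (sqrt (pi / s) * exp (- t\<^sup>2 / (4 * s)))"
    by (auto simp: has_bochner_integral_iff)
qed

text \<open>Phase and Gaussian both factor over the coordinates, so the integral is a product of
  one-dimensional ones.\<close>

lemma gaussian_fourier:
  fixes \<xi> :: "'a::euclidean_space"
  assumes s: "0 < s"
  shows "has_bochner_integral lborel (\<lambda>x. iexp (x \<bullet> \<xi>) * complex_of_real (exp (- s * (norm x)\<^sup>2)))
    (complex_of_real ((pi / s) powr (DIM('a) / 2) * exp (- (norm \<xi>)\<^sup>2 / (4 * s))))"
proof -
  let ?f = "\<lambda>b t. iexp ((\<xi> \<bullet> b) * t) * complex_of_real (exp (- s * t\<^sup>2))"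
  have int: "integrable lborel (?f b)" for b
    using gaussian_fourier_real(1)[OF s] by simp
  have prod: "(\<Prod>b\<in>Basis. ?f b (x \<bullet> b)) = iexp (x \<bullet> \<xi>) * complex_of_real (exp (- s * (norm x)\<^sup>2))" for x
  proof -
    have "iexp (x \<bullet> \<xi>) = (\<Prod>b\<in>Basis. iexp ((\<xi> \<bullet> b) * (x \<bullet> b)))"
      by (subst euclidean_inner, simp add: sum_distrib_left exp_sum mult_ac)
    moreover have "exp (- s * (norm x)\<^sup>2) = (\<Prod>b\<in>Basis. exp (- s * (x \<bullet> b)\<^sup>2))"
      unfolding power2_norm_eq_inner
      by (subst euclidean_inner) (simp add: sum_distrib_left exp_sum power2_eq_square)
    ultimately show ?thesis by (simp add: prod.distrib)
  qed
  have rhs: "(\<Prod>b\<in>Basis. \<integral>t. ?f b t \<partial>lborel) =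
      complex_of_real ((pi / s) powr (DIM('a) / 2) * exp (- (norm \<xi>)\<^sup>2 / (4 * s)))"
  proof -
    have "(\<Prod>b\<in>(Basis::'a set). \<integral>t. ?f b t \<partial>lborel) =
        (\<Prod>b\<in>(Basis::'a set). complex_of_real (sqrt (pi / s) * exp (- (\<xi> \<bullet> b)\<^sup>2 / (4 * s))))"
      using gaussian_fourier_real(2)[OF s] by (intro prod.cong) simp_all
    also have "\<dots> = complex_of_real (sqrt (pi / s) ^ DIM('a) * (\<Prod>b\<in>(Basis::'a set). exp (- (\<xi> \<bullet> b)\<^sup>2 / (4 * s))))"
      by (simp add: prod.distrib)
    also have "(\<Prod>b\<in>(Basis::'a set). exp (- (\<xi> \<bullet> b)\<^sup>2 / (4 * s))) = exp (- (norm \<xi>)\<^sup>2 / (4 * s))"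
      unfolding power2_norm_eq_inner
      by (subst euclidean_inner) (simp add: sum_divide_distrib sum_negf[symmetric] exp_sum power2_eq_square flip: exp_sum)
    also have "sqrt (pi / s) ^ DIM('a) = (pi / s) powr (DIM('a) / 2)"
      using s by (simp add: powr_half_sqrt[symmetric] powr_powr flip: powr_realpow)
    finally show ?thesis .
  qed
  show ?thesis
    using lborel_prod_Basis[where f = "?f", OF int] unfolding prod rhs has_bochner_integral_iff by blast
qed

lemma gaussian_cos:
  fixes \<xi> :: "'a::euclidean_space"
  assumes s: "0 < s"
  shows "has_bochner_integral lborel (\<lambda>x. cos (x \<bullet> \<xi>) * exp (- s * (norm x)\<^sup>2))
    ((pi / s) powr (DIM('a) / 2) * exp (- (norm \<xi>)\<^sup>2 / (4 * s)))"
  using has_bochner_integral_bounded_linear[OF bounded_linear_Re gaussian_fourier[OF s, of \<xi>]]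
  by (simp add: Re_exp)

lemma gaussian_sin:
  fixes \<xi> :: "'a::euclidean_space"
  assumes s: "0 < s"
  shows "has_bochner_integral lborel (\<lambda>x. sin (x \<bullet> \<xi>) * exp (- s * (norm x)\<^sup>2)) 0"
  using has_bochner_integral_bounded_linear[OF bounded_linear_Im gaussian_fourier[OF s, of \<xi>]]
  by (simp add: Im_exp)

lemma integrable_gaussian:
  assumes s: "0 < s"
  shows "integrable lborel (\<lambda>x::'a::euclidean_space. exp (- s * (norm x)\<^sup>2))"
  using gaussian_cos[OF s, of "0::'a"] by (simp add: has_bochner_integral_iff)

section \<open>Lebesgue measure under reflections and translations\<close>

lemma lborel_distr_reflect:
  "distr lborel borel (\<lambda>x. t - x) = (lborel :: 'a::euclidean_space measure)"
  using lborel_affine[of "-1" t] by (simp add: density_1)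

lemma lborel_distr_shift:
  "distr lborel borel (\<lambda>x. x - t) = (lborel :: 'a::euclidean_space measure)"
  using lborel_affine[of 1 "- t"] by (simp add: density_1)

lemma integrable_reflect:
  fixes f :: "'a::euclidean_space \<Rightarrow> 'b::{banach, second_countable_topology}"
  assumes "f \<in> borel_measurable borel"
  shows "integrable lborel (\<lambda>x. f (t - x)) \<longleftrightarrow> integrable lborel f"
  using integrable_distr_eq[of "\<lambda>x. t - x" lborel borel f] assms by (simp add: lborel_distr_reflect)

lemma integral_reflect:
  fixes f :: "'a::euclidean_space \<Rightarrow> 'b::{banach, second_countable_topology}"
  assumes "f \<in> borel_measurable borel"
  shows "(\<integral>x. f (t - x) \<partial>lborel) = (\<integral>x. f x \<partial>lborel)"
  using integral_distr[of "\<lambda>x. t - x" lborel borel f] assms by (simp add: lborel_distr_reflect)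

lemma integrable_shift:
  fixes f :: "'a::euclidean_space \<Rightarrow> 'b::{banach, second_countable_topology}"
  assumes "f \<in> borel_measurable borel"
  shows "integrable lborel (\<lambda>x. f (x - t)) \<longleftrightarrow> integrable lborel f"
  using integrable_distr_eq[of "\<lambda>x. x - t" lborel borel f] assms by (simp add: lborel_distr_shift)

lemma integral_shift:
  fixes f :: "'a::euclidean_space \<Rightarrow> 'b::{banach, second_countable_topology}"
  assumes "f \<in> borel_measurable borel"
  shows "(\<integral>x. f (x - t) \<partial>lborel) = (\<integral>x. f x \<partial>lborel)"
  using integral_distr[of "\<lambda>x. x - t" lborel borel f] assms by (simp add: lborel_distr_shift)

text \<open>The addition theorem splits cos((x - z) \<bullet> \<xi>) into a cosine and a sine term
  in z; the sine term integrates to 0 against an even Gaussian.\<close>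

lemma gaussian_cos_reflect:
  fixes \<xi> x :: "'a::euclidean_space"
  assumes s: "0 < s"
  shows "has_bochner_integral lborel (\<lambda>y. exp (- s * (norm (x - y))\<^sup>2) * cos (y \<bullet> \<xi>))
    (cos (x \<bullet> \<xi>) * ((pi / s) powr (DIM('a) / 2) * exp (- (norm \<xi>)\<^sup>2 / (4 * s))))"
proof -
  have "has_bochner_integral lborel (\<lambda>z. cos (x \<bullet> \<xi>) * (cos (z \<bullet> \<xi>) * exp (- s * (norm z)\<^sup>2))
      + sin (x \<bullet> \<xi>) * (sin (z \<bullet> \<xi>) * exp (- s * (norm z)\<^sup>2)))
    (cos (x \<bullet> \<xi>) * ((pi / s) powr (DIM('a) / 2) * exp (- (norm \<xi>)\<^sup>2 / (4 * s))) + sin (x \<bullet> \<xi>) * 0)"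
    by (intro has_bochner_integral_add has_bochner_integral_mult_right gaussian_cos gaussian_sin s)
  also have "(\<lambda>z. cos (x \<bullet> \<xi>) * (cos (z \<bullet> \<xi>) * exp (- s * (norm z)\<^sup>2))
      + sin (x \<bullet> \<xi>) * (sin (z \<bullet> \<xi>) * exp (- s * (norm z)\<^sup>2))) =
     (\<lambda>z. exp (- s * (norm (x - (x - z)))\<^sup>2) * cos ((x - z) \<bullet> \<xi>))"
    by (auto simp: fun_eq_iff inner_diff_left cos_diff algebra_simps)
  finally show ?thesis
    using integrable_reflect[of "\<lambda>y. exp (- s * (norm (x - y))\<^sup>2) * cos (y \<bullet> \<xi>)" x]
      integral_reflect[of "\<lambda>y. exp (- s * (norm (x - y))\<^sup>2) * cos (y \<bullet> \<xi>)" x]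
    by (simp add: has_bochner_integral_iff)
qed

section \<open>Integrability of exp(-t |\<xi>|^\<alpha>)\<close>

lemma exp_neg_powr_bound:
  fixes c \<alpha> :: real
  assumes c: "0 < c" and \<alpha>: "0 < \<alpha>"
  shows "\<exists>C. \<forall>x. exp (- c * \<bar>x\<bar> powr \<alpha>) \<le> C * inverse (1 + x\<^sup>2)"
proof -
  have "((\<lambda>x. (1 + x\<^sup>2) * exp (- c * x powr \<alpha>)) \<longlongrightarrow> 0) at_top"
    using assms by real_asymp
  then have "eventually (\<lambda>x. (1 + x\<^sup>2) * exp (- c * x powr \<alpha>) < 1) at_top"
    by (rule order_tendstoD) simp
  then obtain B where B: "\<And>x. x \<ge> B \<Longrightarrow> (1 + x\<^sup>2) * exp (- c * x powr \<alpha>) < 1"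
    by (auto simp: eventually_at_top_linorder)
  have "(1 + x\<^sup>2) * exp (- c * \<bar>x\<bar> powr \<alpha>) \<le> 1 + B\<^sup>2 + 1" for x
  proof (cases "\<bar>x\<bar> \<ge> B")
    case True
    then have "(1 + x\<^sup>2) * exp (- c * \<bar>x\<bar> powr \<alpha>) < 1" using B[of "\<bar>x\<bar>"] by simp
    then show ?thesis using zero_le_power2[of B] by linarith
  next
    case False
    then have "x\<^sup>2 \<le> B\<^sup>2" by (intro abs_le_square_iff[THEN iffD1]) auto
    moreover have "(1 + x\<^sup>2) * exp (- c * \<bar>x\<bar> powr \<alpha>) \<le> (1 + x\<^sup>2) * 1"
      using c by (intro mult_left_mono) auto
    ultimately show ?thesis by simp
  qed
  moreover have "0 < 1 + x\<^sup>2" for x :: real by (simp add: add_pos_nonneg)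
  ultimately show ?thesis
    by (intro exI[of _ "1 + B\<^sup>2 + 1"]) (simp add: field_simps)
qed

lemma integrable_exp_powr_real:
  fixes c \<alpha> :: real
  assumes c: "0 < c" and \<alpha>: "0 < \<alpha>"
  shows "integrable lborel (\<lambda>x. exp (- c * \<bar>x\<bar> powr \<alpha>))"
proof -
  obtain C where C: "\<And>x. exp (- c * \<bar>x\<bar> powr \<alpha>) \<le> C * inverse (1 + x\<^sup>2)"
    using exp_neg_powr_bound[OF assms] by blast
  have "integrable lborel (\<lambda>x::real. inverse (1 + x\<^sup>2))"
    using integrable_inverse_1_plus_square by (simp add: set_integrable_def)
  then have "integrable lborel (\<lambda>x::real. C * inverse (1 + x\<^sup>2))" by simp
  then show ?thesis
    by (rule Bochner_Integration.integrable_bound) (use C in \<open>auto intro!: AE_I2 intro: order_trans[OF _ abs_ge_self]\<close>)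
qed

text \<open>Since |\<xi> \<bullet> b| \<le> |\<xi>| for each of the N basis vectors, giving each
  coordinate the share t / N yields a majorant that is a product of one-dimensional integrable
  functions.\<close>

lemma integrable_exp_powr:
  fixes t \<alpha> :: real
  assumes t: "0 < t" and \<alpha>: "0 < \<alpha>"
  shows "integrable lborel (\<lambda>\<xi>::'a::euclidean_space. exp (- (t * norm \<xi> powr \<alpha>)))"
proof -
  let ?c = "t / DIM('a)"
  have "integrable lborel (\<lambda>\<xi>::'a. \<Prod>b\<in>Basis. exp (- ?c * \<bar>\<xi> \<bullet> b\<bar> powr \<alpha>))"
    using t \<alpha> by (intro integrable_lborel_prod_Basis integrable_exp_powr_real) simp_all
  moreover have "exp (- (t * norm \<xi> powr \<alpha>)) \<le> (\<Prod>b\<in>Basis. exp (- ?c * \<bar>\<xi> \<bullet> b\<bar> powr \<alpha>))" for \<xi> :: 'a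
  proof -
    have "(\<Sum>b\<in>(Basis::'a set). ?c * \<bar>\<xi> \<bullet> b\<bar> powr \<alpha>) \<le> (\<Sum>b\<in>(Basis::'a set). ?c * norm \<xi> powr \<alpha>)"
      using t \<alpha> by (intro sum_mono mult_left_mono powr_mono2) (auto simp: Basis_le_norm)
    also have "\<dots> = t * norm \<xi> powr \<alpha>" by simp
    finally show ?thesis by (simp add: exp_sum[symmetric] sum_negf)
  qed
  ultimately show ?thesis
    by (intro Bochner_Integration.integrable_bound[where g = "\<lambda>\<xi>. exp (- (t * norm \<xi> powr \<alpha>))"])
      (auto intro!: AE_I2 simp: abs_prod)
qed

section \<open>The heat kernel\<close>

text \<open>The form of Fubini used for every Fourier pairing, with c the cosine of an inner
  product, and once more for the iterated time integrals of the mild formulation, with c the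
  indicator of a triangle.\<close>

lemma Fubini_bounded_kernel:
  fixes A :: "'a::euclidean_space \<Rightarrow> real" and B :: "'b::euclidean_space \<Rightarrow> real"
  assumes A: "integrable lborel A" and B: "integrable lborel B"
    and c[measurable]: "(\<lambda>(x, y). c x y) \<in> borel_measurable (borel \<Otimes>\<^sub>M borel)"
    and c_le: "\<And>x y. \<bar>c x y\<bar> \<le> (1::real)"
  shows "(\<integral>x. A x * (\<integral>y. c x y * B y \<partial>lborel) \<partial>lborel) = (\<integral>y. (\<integral>x. A x * c x y \<partial>lborel) * B y \<partial>lborel)"
    and "integrable lborel (\<lambda>x. A x * (\<integral>y. c x y * B y \<partial>lborel))"
    and "integrable lborel (\<lambda>y. (\<integral>x. A x * c x y \<partial>lborel) * B y)"
proof -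
  have [measurable]: "A \<in> borel_measurable borel" "B \<in> borel_measurable borel"
    using A B by auto
  have AB: "integrable (lborel \<Otimes>\<^sub>M lborel) (\<lambda>(x, y). A x * B y)"
  proof (rule lborel_pair.Fubini_integrable)
    show "integrable lborel (\<lambda>x. LBINT y. norm (case (x, y) of (x, y) \<Rightarrow> A x * B y))"
      using A by (simp add: abs_mult)
    show "AE x in lborel. integrable lborel (\<lambda>y. case (x, y) of (x, y) \<Rightarrow> A x * B y)"
      using B by simp
  qed simp
  have int: "integrable (lborel \<Otimes>\<^sub>M lborel) (\<lambda>(x, y). A x * c x y * B y)"
  proof (rule Bochner_Integration.integrable_bound[OF AB])
    show "AE z in lborel \<Otimes>\<^sub>M lborel. norm (case z of (x, y) \<Rightarrow> A x * c x y * B y)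
      \<le> norm (case z of (x, y) \<Rightarrow> A x * B y)"
      using c_le by (auto simp: abs_mult mult_right_le_one_le intro!: AE_I2 mult_right_mono)
  qed measurable
  have 1: "(\<integral>y. A x * c x y * B y \<partial>lborel) = A x * (\<integral>y. c x y * B y \<partial>lborel)" for x
    by (simp add: mult.assoc)
  have 2: "(\<integral>x. A x * c x y * B y \<partial>lborel) = (\<integral>x. A x * c x y \<partial>lborel) * B y" for y
    by simp
  show "(\<integral>x. A x * (\<integral>y. c x y * B y \<partial>lborel) \<partial>lborel) = (\<integral>y. (\<integral>x. A x * c x y \<partial>lborel) * B y \<partial>lborel)"
    using lborel_pair.Fubini_integral[OF int] by (simp only: 1 2)
  show "integrable lborel (\<lambda>x. A x * (\<integral>y. c x y * B y \<partial>lborel))"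
    using lborel_pair.integrable_fst[OF int] by (simp only: 1)
  show "integrable lborel (\<lambda>y. (\<integral>x. A x * c x y \<partial>lborel) * B y)"
    using lborel_pair.integrable_snd[OF int] by (simp only: 2)
qed

lemma cos_inner_measurable:
  "(\<lambda>(x, y). cos (x \<bullet> y)) \<in> borel_measurable (borel \<Otimes>\<^sub>M (borel :: 'a::euclidean_space measure))"
  by measurable

lemma lborel_has_integral_affine:
  fixes f :: "'a::euclidean_space \<Rightarrow> real"
  assumes [measurable]: "f \<in> borel_measurable borel" and c: "c \<noteq> 0"
  shows "(\<integral>x. f x \<partial>lborel) = \<bar>c\<bar> ^ DIM('a) * (\<integral>x. f (t + c *\<^sub>R x) \<partial>lborel)"
  by (subst lborel_affine[OF c, of t]) (simp add: integral_density integral_distr)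

definition heat_symbol :: "real \<Rightarrow> real \<Rightarrow> 'a::euclidean_space \<Rightarrow> real" where
  "heat_symbol \<alpha> \<tau> \<xi> = exp (- (\<tau> * ((norm \<xi>)\<^sup>2 + norm \<xi> powr \<alpha>)))"

text \<open>The inverse Fourier transform of the product of the two symbols. The value 0 at
  nonpositive times lets time integrals over (0, t) be extended beyond t without changing
  them.\<close>

definition heat_kernel :: "real \<Rightarrow> real \<Rightarrow> 'a::euclidean_space \<Rightarrow> real" where
  "heat_kernel \<alpha> \<tau> x = (if \<tau> \<le> 0 then 0 else
     (2 * pi) powr (- real DIM('a)) * (\<integral>\<xi>. cos (x \<bullet> \<xi>) * heat_symbol \<alpha> \<tau> \<xi> \<partial>lborel))"

lemma heat_symbol_measurable[measurable]:
  "(\<lambda>(\<tau>, \<xi>). heat_symbol \<alpha> \<tau> \<xi>) \<in> borel_measurable (borel \<Otimes>\<^sub>M borel)"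
  unfolding heat_symbol_def by measurable

lemma heat_symbol_measurable'[measurable]: "heat_symbol \<alpha> \<tau> \<in> borel_measurable borel"
  unfolding heat_symbol_def by measurable

lemma heat_kernel_measurable:
  "(\<lambda>(\<tau>, x). heat_kernel \<alpha> \<tau> x) \<in> borel_measurable (borel \<Otimes>\<^sub>M borel)"
  unfolding heat_kernel_def heat_symbol_def by measurable

lemma heat_symbol_pos: "0 < heat_symbol \<alpha> \<tau> \<xi>"
  by (simp add: heat_symbol_def)

lemma heat_symbol_le_gaussian: "0 \<le> \<tau> \<Longrightarrow> heat_symbol \<alpha> \<tau> \<xi> \<le> exp (- \<tau> * (norm \<xi>)\<^sup>2)"
  by (auto simp: heat_symbol_def algebra_simps)

lemma heat_symbol_le_1: "0 \<le> \<tau> \<Longrightarrow> heat_symbol \<alpha> \<tau> \<xi> \<le> 1"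
  by (auto simp: heat_symbol_def)

lemma heat_symbol_minus [simp]: "heat_symbol \<alpha> \<tau> (- \<xi>) = heat_symbol \<alpha> \<tau> \<xi>"
  by (auto simp: heat_symbol_def)

lemma heat_symbol_mult: "heat_symbol \<alpha> \<tau> \<xi> * heat_symbol \<alpha> \<sigma> \<xi> = heat_symbol \<alpha> (\<tau> + \<sigma>) \<xi>"
  by (simp add: heat_symbol_def algebra_simps flip: exp_add)

lemma integrable_heat_symbol:
  "0 < \<tau> \<Longrightarrow> integrable lborel (heat_symbol \<alpha> \<tau> :: 'a::euclidean_space \<Rightarrow> real)"
  by (rule Bochner_Integration.integrable_bound[OF integrable_gaussian[of \<tau>]])
    (use heat_symbol_le_gaussian[of \<tau> \<alpha>] in \<open>auto intro!: AE_I2 simp: abs_of_pos heat_symbol_pos\<close>)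

lemma fractional_kernel_cos:
  fixes y :: "'a::euclidean_space"
  assumes t: "0 < t" and \<alpha>: "0 < \<alpha>"
  shows "fractional_kernel \<alpha> t y =
    (2 * pi) powr (- real DIM('a)) * (\<integral>\<xi>. cos (y \<bullet> \<xi>) * exp (- (t * norm \<xi> powr \<alpha>)) \<partial>lborel)"
proof -
  have "integrable lborel (\<lambda>\<xi>. exp (\<i> * complex_of_real (y \<bullet> \<xi>) - complex_of_real (t * norm \<xi> powr \<alpha>)))"
    by (rule Bochner_Integration.integrable_bound[OF integrable_exp_powr[OF t \<alpha>]])
      (auto intro!: AE_I2 simp: norm_exp_eq_Re)
  then show ?thesis
    unfolding fractional_kernel_def by (subst integral_Re[symmetric]) (simp_all add: Re_exp mult.commute del: of_real_mult)
qed

text \<open>A convolution theorem that needs no inversion formula: the fractional kernel is already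
  an integral over \<xi>, and after exchanging the integrals the inner one is the explicit transform
  of a Gaussian.\<close>

lemma mixed_kernel_eq_heat_kernel:
  assumes t: "0 < t" and \<alpha>: "0 < \<alpha>"
  shows "mixed_kernel \<alpha> t = (heat_kernel \<alpha> t :: 'a::euclidean_space \<Rightarrow> real)"
proof
  fix x :: 'a
  define s where "s = 1 / (4 * t)"
  have s: "0 < s" using t by (simp add: s_def)
  let ?N = "real DIM('a)"
  let ?m = "\<lambda>\<xi>::'a. exp (- (t * norm \<xi> powr \<alpha>))"
  have g: "gauss_kernel t z = (4 * pi * t) powr (- ?N / 2) * exp (- s * (norm z)\<^sup>2)" for z :: 'a
    by (simp add: gauss_kernel_def s_def)
  have int1: "integrable lborel (\<lambda>y. exp (- s * (norm (x - y))\<^sup>2))"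
    using integrable_gaussian[OF s] by (subst integrable_reflect) auto
  have meas: "(\<lambda>y. gauss_kernel t (x - y) * fractional_kernel \<alpha> t y) \<in> borel_measurable borel"
    unfolding g fractional_kernel_cos[OF t \<alpha>] by measurable
  have "mixed_kernel \<alpha> t x = (\<integral>y. gauss_kernel t (x - y) * fractional_kernel \<alpha> t y \<partial>lborel)"
    unfolding mixed_kernel_def Defs.convolution_def using meas by (subst integral_completion) auto
  also have "\<dots> = (4 * pi * t) powr (- ?N / 2) * ((2 * pi) powr (- ?N) *
      (\<integral>y. exp (- s * (norm (x - y))\<^sup>2) * (\<integral>\<xi>. cos (y \<bullet> \<xi>) * ?m \<xi> \<partial>lborel) \<partial>lborel))"
    unfolding g fractional_kernel_cos[OF t \<alpha>] by (simp add: mult_ac flip: integral_mult_right_zero)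
  also have "(\<integral>y. exp (- s * (norm (x - y))\<^sup>2) * (\<integral>\<xi>. cos (y \<bullet> \<xi>) * ?m \<xi> \<partial>lborel) \<partial>lborel)
      = (\<integral>\<xi>. (\<integral>y. exp (- s * (norm (x - y))\<^sup>2) * cos (y \<bullet> \<xi>) \<partial>lborel) * ?m \<xi> \<partial>lborel)"
    by (rule Fubini_bounded_kernel(1)[OF int1 integrable_exp_powr[OF t \<alpha>] cos_inner_measurable]) simp
  also have "\<dots> = (\<integral>\<xi>. (4 * pi * t) powr (?N / 2) * (cos (x \<bullet> \<xi>) * heat_symbol \<alpha> t \<xi>) \<partial>lborel)"
  proof (intro Bochner_Integration.integral_cong refl)
    fix \<xi> :: 'a
    have "pi / s = 4 * pi * t" "(norm \<xi>)\<^sup>2 / (4 * s) = t * (norm \<xi>)\<^sup>2"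
      using t by (auto simp: s_def)
    moreover have "heat_symbol \<alpha> t \<xi> = exp (- (t * (norm \<xi>)\<^sup>2)) * ?m \<xi>"
      by (simp add: heat_symbol_def ring_distribs flip: exp_add)
    ultimately show "(\<integral>y. exp (- s * (norm (x - y))\<^sup>2) * cos (y \<bullet> \<xi>) \<partial>lborel) * ?m \<xi> =
        (4 * pi * t) powr (?N / 2) * (cos (x \<bullet> \<xi>) * heat_symbol \<alpha> t \<xi>)"
      using gaussian_cos_reflect[OF s, of x \<xi>]
      by (simp add: has_bochner_integral_iff)
  qed
  also have "(4 * pi * t) powr (- ?N / 2) * ((2 * pi) powr (- ?N) * \<dots>) = heat_kernel \<alpha> t x"
    using t by (simp add: heat_kernel_def powr_minus)
  finally show "mixed_kernel \<alpha> t x = heat_kernel \<alpha> t x" .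
qed

text \<open>Integrability of the heat kernel is not yet known at this stage; the factor exp(-e
  |x|^2) makes Fubini applicable. The price is that the symbol is averaged around \<xi> at scale 2
  sqrt e; the factor with power -N/2 of pi normalises exp(-|w|^2) to a probability density.\<close>

lemma heat_kernel_gaussian_fourier:
  fixes \<xi> :: "'a::euclidean_space"
  assumes t: "0 < t" and e: "0 < e"
  shows "has_bochner_integral lborel (\<lambda>x. heat_kernel \<alpha> t x * (cos (x \<bullet> \<xi>) * exp (- e * (norm x)\<^sup>2)))
    (pi powr (- real DIM('a) / 2) * (\<integral>w. exp (- (norm w)\<^sup>2) * heat_symbol \<alpha> t (\<xi> + (2 * sqrt e) *\<^sub>R w) \<partial>lborel))"
proof -
  let ?N = "real DIM('a)"
  let ?A = "\<lambda>x::'a. cos (x \<bullet> \<xi>) * exp (- e * (norm x)\<^sup>2)"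
  let ?m = "heat_symbol \<alpha> t :: 'a \<Rightarrow> real"
  define C where "C = (pi / e) powr (?N / 2)"
  define g where "g z = C * exp (- (norm z)\<^sup>2 / (4 * e))" for z :: 'a
  have [measurable]: "g \<in> borel_measurable borel" unfolding g_def by measurable
  have A: "integrable lborel ?A" using gaussian_cos[OF e, of \<xi>] by (simp add: has_bochner_integral_iff)
  note m = integrable_heat_symbol[OF t, of \<alpha>, where 'a='a]
  have c: "(\<lambda>(x, y). cos (x \<bullet> y)) \<in> borel_measurable (borel \<Otimes>\<^sub>M (borel :: 'a measure))"
    by measurable
  note F = Fubini_bounded_kernel[OF A m c abs_cos_le_one]
  have hk: "heat_kernel \<alpha> t x = (2 * pi) powr (- ?N) * (\<integral>\<xi>. cos (x \<bullet> \<xi>) * ?m \<xi> \<partial>lborel)" for x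
    using t by (simp add: heat_kernel_def)
  have gint: "(\<integral>x. ?A x * cos (x \<bullet> \<eta>) \<partial>lborel) = (g (\<eta> - \<xi>) + g (\<eta> + \<xi>)) / 2" (is "_ = ?G \<eta>") for \<eta> :: 'a
  proof -
    have "has_bochner_integral lborel (\<lambda>x. (cos (x \<bullet> (\<eta> - \<xi>)) * exp (- e * (norm x)\<^sup>2) + cos (x \<bullet> (\<eta> + \<xi>)) * exp (- e * (norm x)\<^sup>2)) / 2)
      ((g (\<eta> - \<xi>) + g (\<eta> + \<xi>)) / 2)"
      unfolding g_def C_def by (intro has_bochner_integral_divide has_bochner_integral_add gaussian_cos e)
    moreover have "(\<lambda>x. (cos (x \<bullet> (\<eta> - \<xi>)) * exp (- e * (norm x)\<^sup>2) + cos (x \<bullet> (\<eta> + \<xi>)) * exp (- e * (norm x)\<^sup>2)) / 2) = (\<lambda>x. ?A x * cos (x \<bullet> \<eta>))"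
      by (auto simp: fun_eq_iff inner_diff_right inner_add_right cos_diff cos_add algebra_simps)
    ultimately have "has_bochner_integral lborel (\<lambda>x. ?A x * cos (x \<bullet> \<eta>)) (?G \<eta>)" by simp
    then show ?thesis by (rule has_bochner_integral_integral_eq)
  qed
  have gm: "integrable lborel (\<lambda>\<eta>. g (\<eta> + \<zeta>) * ?m \<eta>)" for \<zeta>
    by (rule Bochner_Integration.integrable_bound[OF integrable_mult_right[OF m, of C]])
      (use e in \<open>auto intro!: AE_I2 mult_right_mono mult_right_le_one_le simp: g_def abs_mult C_def heat_symbol_pos abs_of_pos less_imp_le\<close>)
  \<comment> \<open>The product of two cosines produces Gaussian bumps at \<xi> and at -\<xi>; they
    contribute equally because the symbol is even.\<close>
  have sym: "(\<integral>\<eta>. g (\<eta> + \<xi>) * ?m \<eta> \<partial>lborel) = (\<integral>\<eta>. g (\<eta> - \<xi>) * ?m \<eta> \<partial>lborel)"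
  proof -
    have "g (- \<eta> + \<xi>) = g (\<eta> - \<xi>)" for \<eta>
      unfolding g_def by (simp add: norm_minus_commute)
    then show ?thesis
      using integral_reflect[of "\<lambda>\<eta>. g (\<eta> + \<xi>) * ?m \<eta>" 0] by simp
  qed
  have "(\<integral>x. ?A x * (\<integral>\<eta>. cos (x \<bullet> \<eta>) * ?m \<eta> \<partial>lborel) \<partial>lborel) = (\<integral>\<eta>. (g (\<eta> - \<xi>) * ?m \<eta> + g (\<eta> + \<xi>) * ?m \<eta>) / 2 \<partial>lborel)"
    unfolding F(1) gint by (intro Bochner_Integration.integral_cong refl) (simp add: field_simps)
  also have "\<dots> = (\<integral>\<eta>. g (\<eta> - \<xi>) * ?m \<eta> \<partial>lborel)"
    using gm[of \<xi>] gm[of "- \<xi>"] sym by simp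
  \<comment> \<open>The substitution \<eta> = \<xi> + 2 sqrt e w turns the bump into exp(-|w|^2),
    independently of e.\<close>
  also have "\<dots> = (2 * sqrt e) ^ DIM('a) * (\<integral>w. g ((2 * sqrt e) *\<^sub>R w) * ?m (\<xi> + (2 * sqrt e) *\<^sub>R w) \<partial>lborel)"
    using e by (subst lborel_has_integral_affine[where c = "2 * sqrt e" and t = \<xi>]) auto
  also have "(\<lambda>w. g ((2 * sqrt e) *\<^sub>R w) * ?m (\<xi> + (2 * sqrt e) *\<^sub>R w)) = (\<lambda>w. C * (exp (- (norm w)\<^sup>2) * ?m (\<xi> + (2 * sqrt e) *\<^sub>R w)))"
    using e by (simp add: g_def power_mult_distrib mult.assoc fun_eq_iff)
  also have "(2 * sqrt e) ^ DIM('a) * (\<integral>w. C * (exp (- (norm w)\<^sup>2) * ?m (\<xi> + (2 * sqrt e) *\<^sub>R w)) \<partial>lborel)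
    = (2 * sqrt e) ^ DIM('a) * C * (\<integral>w. exp (- (norm w)\<^sup>2) * ?m (\<xi> + (2 * sqrt e) *\<^sub>R w) \<partial>lborel)"
    by simp
  finally have eq: "(\<integral>x. ?A x * (\<integral>\<eta>. cos (x \<bullet> \<eta>) * ?m \<eta> \<partial>lborel) \<partial>lborel) =
    (2 * sqrt e) ^ DIM('a) * C * (\<integral>w. exp (- (norm w)\<^sup>2) * ?m (\<xi> + (2 * sqrt e) *\<^sub>R w) \<partial>lborel)" .
  have "(2 * sqrt e) ^ DIM('a) * C * (2 * pi) powr (- ?N) = pi powr (- ?N / 2)"
  proof -
    have "(2 * sqrt e) ^ DIM('a) = 2 powr ?N * e powr (?N / 2)"
      using e by (simp add: powr_half_sqrt[symmetric] powr_powr powr_mult flip: powr_realpow)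
    moreover have "C = pi powr (?N / 2) * e powr (- ?N / 2)"
      using e by (simp add: C_def powr_divide powr_minus_divide)
    moreover have "(2 * pi) powr (- ?N) = 2 powr (- ?N) * (pi powr (- ?N / 2) * pi powr (- ?N / 2))"
      by (simp add: powr_mult flip: powr_add)
    ultimately show ?thesis using e by (simp add: powr_minus field_simps)
  qed
  then have val: "(2 * pi) powr (- ?N) * (\<integral>x. ?A x * (\<integral>\<eta>. cos (x \<bullet> \<eta>) * ?m \<eta> \<partial>lborel) \<partial>lborel) =
     pi powr (- ?N / 2) * (\<integral>w. exp (- (norm w)\<^sup>2) * ?m (\<xi> + (2 * sqrt e) *\<^sub>R w) \<partial>lborel)"
    unfolding eq by (simp only: mult.assoc[symmetric]) (simp only: mult_ac)
  have "has_bochner_integral lborel (\<lambda>x. (2 * pi) powr (- ?N) * (?A x * (\<integral>\<eta>. cos (x \<bullet> \<eta>) * ?m \<eta> \<partial>lborel)))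
    (pi powr (- ?N / 2) * (\<integral>w. exp (- (norm w)\<^sup>2) * ?m (\<xi> + (2 * sqrt e) *\<^sub>R w) \<partial>lborel))"
    using F(2) val by (simp add: has_bochner_integral_iff)
  then show ?thesis unfolding hk by (simp only: mult_ac)
qed

section \<open>Positivity of the heat kernel\<close>

lemma coeff_mult_nonneg:
  fixes p q :: "real poly"
  assumes "\<And>n. 0 \<le> coeff p n" "\<And>n. 0 \<le> coeff q n"
  shows "0 \<le> coeff (p * q) n"
  using assms by (auto simp: coeff_mult intro!: sum_nonneg)

lemma coeff_power_nonneg:
  fixes p :: "real poly"
  assumes "\<And>n. 0 \<le> coeff p n"
  shows "0 \<le> coeff (p ^ k) n"
proof (induction k arbitrary: n)
  case 0 then show ?case by (cases n) auto
next
  case (Suc k) then show ?case by (simp add: coeff_mult_nonneg assms)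
qed

text \<open>These are, up to sign, the Taylor coefficients of 1 - (1 - z)^a. They start from -a, and
  each step multiplies by (n - a)/(n + 1), which is nonnegative for n \<ge> 1 because a < 1.\<close>

lemma gbinomial_alternating_nonpos:
  fixes a :: real
  assumes a: "0 < a" "a < 1" and n: "1 \<le> n"
  shows "(a gchoose n) * (- 1) ^ n \<le> 0"
  using n
proof (induction n rule: dec_induct)
  case base
  then show ?case using a by simp
next
  case (step n)
  have "real (Suc n) * (a gchoose Suc n) = (a - n) * (a gchoose n)"
    using gbinomial_mult_1[of a n] by (simp add: algebra_simps)
  then have *: "a gchoose Suc n = (a - n) * (a gchoose n) / real (Suc n)"
    by (simp add: field_simps del: of_nat_Suc)
  have "(a gchoose Suc n) * (- 1) ^ Suc n = ((a gchoose n) * (- 1) ^ n) * ((real n - a) / real (Suc n))"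
    unfolding * power_Suc by (simp add: algebra_simps diff_divide_distrib)
  moreover have "0 \<le> (real n - a) / real (Suc n)" using step a by (intro divide_nonneg_pos) auto
  ultimately show ?case using step by (simp only: mult_nonpos_nonneg)
qed

text \<open>The Gaussian factor is an integrable majorant, so nonnegativity survives bounded
  pointwise limits. The point \<xi> = 0 is left out because there exp(-d |\<xi>|^2) = 1 lies on the
  boundary of the disc of convergence of the binomial series.\<close>

lemma gaussian_cos_integral_limit_nonneg:
  fixes x :: "'a::euclidean_space" and \<phi> :: "nat \<Rightarrow> 'a \<Rightarrow> real"
  assumes \<tau>: "0 < \<tau>" and [measurable]: "\<And>n. \<phi> n \<in> borel_measurable borel" "\<psi> \<in> borel_measurable borel"
    and bd: "\<And>n \<xi>. \<bar>\<phi> n \<xi>\<bar> \<le> C" and lim: "\<And>\<xi>. \<xi> \<noteq> 0 \<Longrightarrow> (\<lambda>n. \<phi> n \<xi>) \<longlonglongrightarrow> \<psi> \<xi>"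
    and nonneg: "\<And>n. 0 \<le> (\<integral>\<xi>. cos (x \<bullet> \<xi>) * exp (- \<tau> * (norm \<xi>)\<^sup>2) * \<phi> n \<xi> \<partial>lborel)"
  shows "0 \<le> (\<integral>\<xi>. cos (x \<bullet> \<xi>) * exp (- \<tau> * (norm \<xi>)\<^sup>2) * \<psi> \<xi> \<partial>lborel)"
proof (rule LIMSEQ_le_const)
  show "(\<lambda>n. \<integral>\<xi>. cos (x \<bullet> \<xi>) * exp (- \<tau> * (norm \<xi>)\<^sup>2) * \<phi> n \<xi> \<partial>lborel)
    \<longlonglongrightarrow> (\<integral>\<xi>. cos (x \<bullet> \<xi>) * exp (- \<tau> * (norm \<xi>)\<^sup>2) * \<psi> \<xi> \<partial>lborel)"
  proof (rule integral_dominated_convergence[where w = "\<lambda>\<xi>. exp (- \<tau> * (norm \<xi>)\<^sup>2) * C"])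
    show "integrable lborel (\<lambda>\<xi>::'a. exp (- \<tau> * (norm \<xi>)\<^sup>2) * C)"
      using integrable_gaussian[OF \<tau>, where 'a='a] by simp
    have "AE \<xi> in lborel. \<xi> \<noteq> (0::'a)" by (rule AE_lborel_singleton)
    then show "AE \<xi> in lborel. (\<lambda>n. cos (x \<bullet> \<xi>) * exp (- \<tau> * (norm \<xi>)\<^sup>2) * \<phi> n \<xi>)
      \<longlonglongrightarrow> cos (x \<bullet> \<xi>) * exp (- \<tau> * (norm \<xi>)\<^sup>2) * \<psi> \<xi>"
      by eventually_elim (intro tendsto_intros lim)
    have "\<bar>cos (x \<bullet> \<xi>)\<bar> * exp (- \<tau> * (norm \<xi>)\<^sup>2) * \<bar>\<phi> n \<xi>\<bar> \<le> 1 * exp (- \<tau> * (norm \<xi>)\<^sup>2) * C" for n \<xi>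
      by (intro mult_mono bd) auto
    then show "AE \<xi> in lborel. norm (cos (x \<bullet> \<xi>) * exp (- \<tau> * (norm \<xi>)\<^sup>2) * \<phi> n \<xi>)
      \<le> exp (- \<tau> * (norm \<xi>)\<^sup>2) * C" for n
      by (auto simp: abs_mult)
  qed measurable
qed (use nonneg in auto)

text \<open>Each power of exp(-d |\<xi>|^2) times the Gaussian is again a Gaussian, and its cosine
  transform is positive.\<close>

lemma gaussian_cos_integral_poly_nonneg:
  fixes x :: "'a::euclidean_space" and p :: "real poly"
  assumes \<tau>: "0 < \<tau>" and d: "0 \<le> d" and p: "\<And>n. 0 \<le> coeff p n"
  shows "0 \<le> (\<integral>\<xi>. cos (x \<bullet> \<xi>) * exp (- \<tau> * (norm \<xi>)\<^sup>2) * poly p (exp (- d * (norm \<xi>)\<^sup>2)) \<partial>lborel)"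
proof -
  have *: "cos (x \<bullet> \<xi>) * exp (- \<tau> * (norm \<xi>)\<^sup>2) * poly p (exp (- d * (norm \<xi>)\<^sup>2)) =
    (\<Sum>i\<le>degree p. coeff p i * (cos (\<xi> \<bullet> x) * exp (- (\<tau> + i * d) * (norm \<xi>)\<^sup>2)))" for \<xi>
    by (simp add: poly_altdef sum_distrib_left inner_commute exp_of_nat_mult[symmetric] ring_distribs exp_add mult_ac flip: exp_diff)
      (auto intro!: sum.cong simp: exp_diff exp_minus field_simps)
  have pos: "0 < \<tau> + real i * d" for i using \<tau> d by (simp add: add_pos_nonneg)
  have "has_bochner_integral lborel (\<lambda>\<xi>. \<Sum>i\<le>degree p. coeff p i * (cos (\<xi> \<bullet> x) * exp (- (\<tau> + i * d) * (norm \<xi>)\<^sup>2)))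
    (\<Sum>i\<le>degree p. coeff p i * ((pi / (\<tau> + i * d)) powr (DIM('a) / 2) * exp (- (norm x)\<^sup>2 / (4 * (\<tau> + i * d)))))"
    by (intro has_bochner_integral_sum has_bochner_integral_mult_right gaussian_cos pos)
  then show ?thesis
    unfolding * by (subst has_bochner_integral_integral_eq) (auto intro!: sum_nonneg mult_nonneg_nonneg p)
qed

text \<open>Three successive limits: in the exponential series, in the binomial series, and in d.
  The bound exp A of the first two is useful only for fixed d, since A = t / d^a is unbounded as d
  tends to 0; the last limit has the bound 1.\<close>

lemma exp_neg_powr_gaussian_cos_integral_nonneg:
  fixes x :: "'a::euclidean_space"
  assumes \<tau>: "0 < \<tau>" and t: "0 \<le> t" and a: "0 < a" "a < 1"
  shows "0 \<le> (\<integral>\<xi>. cos (x \<bullet> \<xi>) * exp (- \<tau> * (norm \<xi>)\<^sup>2) * exp (- t * ((norm \<xi>)\<^sup>2) powr a) \<partial>lborel)"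
proof -
  define b where "b n = - ((a gchoose n) * (- 1) ^ n)" for n
  have b: "0 \<le> b (Suc n)" for n
    using gbinomial_alternating_nonpos[OF a, of "Suc n"] by (simp add: b_def)
  have sums_b: "(\<lambda>n. b (Suc n) * z ^ Suc n) sums (1 - (1 - z) powr a)" if z: "0 \<le> z" "z < 1" for z
  proof -
    have "(\<lambda>n. (a gchoose n) * (- z) ^ n) sums (1 + - z) powr a"
      by (rule gen_binomial_real) (use z in auto)
    then have "(\<lambda>n. b n * z ^ n) sums (- ((1 - z) powr a))"
      by (drule_tac sums_minus) (simp add: b_def power_minus[of z] mult_ac)
    \<comment> \<open>The term of index 0 is -1; splitting it off leaves a series whose coefficients
      are all nonnegative.\<close>
    from sums_split_initial_segment[OF this, of 1] show ?thesis by (simp add: b_def[of 0])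
  qed
  define q where "q K = (\<Sum>n<K. monom (b (Suc n)) (Suc n))" for K
  have q: "0 \<le> coeff (q K) n" for K n
    unfolding q_def coeff_sum by (intro sum_nonneg) (auto simp: b)
  have poly_q: "poly (q K) z = (\<Sum>n<K. b (Suc n) * z ^ Suc n)" for K z
    by (simp add: q_def poly_sum poly_monom)
  have q_nonneg: "0 \<le> poly (q K) z" if "0 \<le> z" for K z
    unfolding poly_q using b that by (auto intro!: sum_nonneg mult_nonneg_nonneg simp del: power_Suc)
  have q_le: "poly (q K) z \<le> 1" if z: "0 \<le> z" "z < 1" for K z
  proof -
    have "poly (q K) z \<le> 1 - (1 - z) powr a"
      unfolding poly_q sums_unique[OF sums_b[OF z]]
      by (intro sum_le_suminf sums_summable[OF sums_b[OF z]]) (use z b in \<open>auto simp del: power_Suc\<close>)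
    then show ?thesis by (smt (verit) powr_ge_zero)
  qed
  \<comment> \<open>The value z = 1, attained at \<xi> = 0, is reached by continuity of the
    polynomial from the left.\<close>
  have q_le': "poly (q K) z \<le> 1" if z: "0 \<le> z" "z \<le> 1" for K z
  proof (cases "z = 0")
    case True
    then show ?thesis by (simp add: poly_q)
  next
    case False
    show ?thesis
    proof (rule tendsto_upperbound[of _ _ "at_left z"])
      show "((\<lambda>y. poly (q K) y) \<longlongrightarrow> poly (q K) z) (at_left z)" by (intro tendsto_intros)
      have "eventually (\<lambda>y. y \<in> {0<..<z}) (at_left z)" using z False by (intro eventually_at_left_real) auto
      then show "eventually (\<lambda>y. poly (q K) y \<le> 1) (at_left z)" by eventually_elim (use q_le z in auto)
    qed simp
  qed
  \<comment> \<open>Both series are truncated here, so the integrands are polynomials in exp(-d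
    |\<xi>|^2) with nonnegative coefficients.\<close>
  have 1: "0 \<le> (\<integral>\<xi>. cos (x \<bullet> \<xi>) * exp (- \<tau> * (norm \<xi>)\<^sup>2) * exp (A * poly (q K) (exp (- d * (norm \<xi>)\<^sup>2))) \<partial>lborel)"
    if A: "0 \<le> A" and d: "0 < d" for A K d
  proof (rule gaussian_cos_integral_limit_nonneg[OF \<tau>])
    define p where "p M = (\<Sum>n<M. smult (A ^ n / fact n) (q K ^ n))" for M
    have poly_p: "poly (p M) z = (\<Sum>n<M. (A * poly (q K) z) ^ n / fact n)" for M z
      by (simp add: p_def poly_sum power_mult_distrib)
    show "(\<lambda>M. poly (p M) (exp (- d * (norm \<xi>)\<^sup>2))) \<longlonglongrightarrow> exp (A * poly (q K) (exp (- d * (norm \<xi>)\<^sup>2)))" for \<xi> :: 'a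
      using exp_converges[of "A * poly (q K) (exp (- d * (norm \<xi>)\<^sup>2))"]
      unfolding poly_p sums_def by (simp add: divide_inverse mult.commute)
    show "\<bar>poly (p M) (exp (- d * (norm \<xi>)\<^sup>2))\<bar> \<le> exp A" for M and \<xi> :: 'a
    proof -
      let ?y = "A * poly (q K) (exp (- d * (norm \<xi>)\<^sup>2))"
      have y: "0 \<le> ?y" "?y \<le> A" using A d q_nonneg q_le'[of "exp (- d * (norm \<xi>)\<^sup>2)" K] by (auto intro: mult_left_le)
      have "(\<Sum>n<M. ?y ^ n / fact n) \<le> exp ?y"
        unfolding sums_unique[OF exp_converges[of ?y]] using exp_converges[of ?y] y(1)
        by (subst suminf_cong[of _ "\<lambda>n. ?y ^ n / fact n"], simp add: divide_inverse mult.commute)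
          (rule sum_le_suminf, auto simp: sums_iff divide_inverse mult.commute simp del: power_mult_distrib)
      moreover have "0 \<le> (\<Sum>n<M. ?y ^ n / fact n)" using y by (intro sum_nonneg) auto
      ultimately show ?thesis unfolding poly_p using y by (smt (verit) exp_le_cancel_iff)
    qed
    show "0 \<le> (\<integral>\<xi>. cos (x \<bullet> \<xi>) * exp (- \<tau> * (norm \<xi>)\<^sup>2) * poly (p M) (exp (- d * (norm \<xi>)\<^sup>2)) \<partial>lborel)" for M
      by (rule gaussian_cos_integral_poly_nonneg[OF \<tau>])
        (use d A in \<open>auto simp: p_def coeff_sum intro!: sum_nonneg mult_nonneg_nonneg divide_nonneg_pos coeff_power_nonneg q\<close>)
  qed (unfold poly_altdef, measurable)
  have 2: "0 \<le> (\<integral>\<xi>. cos (x \<bullet> \<xi>) * exp (- \<tau> * (norm \<xi>)\<^sup>2) * exp (A * (1 - (1 - exp (- d * (norm \<xi>)\<^sup>2)) powr a)) \<partial>lborel)"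
    if A: "0 \<le> A" and d: "0 < d" for A d
  proof (rule gaussian_cos_integral_limit_nonneg[OF \<tau> _ _ _ _ 1[OF A d]])
    show "\<bar>exp (A * poly (q K) (exp (- d * (norm \<xi>)\<^sup>2)))\<bar> \<le> exp A" for K and \<xi> :: 'a
      using A d q_le'[of "exp (- d * (norm \<xi>)\<^sup>2)" K] by (auto intro: mult_left_le)
    show "(\<lambda>K. exp (A * poly (q K) (exp (- d * (norm \<xi>)\<^sup>2)))) \<longlonglongrightarrow> exp (A * (1 - (1 - exp (- d * (norm \<xi>)\<^sup>2)) powr a))"
      if "\<xi> \<noteq> 0" for \<xi> :: 'a
      using sums_b[of "exp (- d * (norm \<xi>)\<^sup>2)"] d that
      by (intro tendsto_intros) (auto simp: poly_q sums_def)
  qed (unfold poly_altdef, measurable)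
  \<comment> \<open>Pulling out the positive constant exp(-t / d^a) leaves the previous step with A
    = t / d^a.\<close>
  have 3: "0 \<le> (\<integral>\<xi>. cos (x \<bullet> \<xi>) * exp (- \<tau> * (norm \<xi>)\<^sup>2) * exp (- t * ((1 - exp (- d * (norm \<xi>)\<^sup>2)) / d) powr a) \<partial>lborel)"
    if d: "0 < d" for d
  proof -
    have "exp (- t * ((1 - exp (- d * (norm \<xi>)\<^sup>2)) / d) powr a) =
      exp (- t / d powr a) * exp (t / d powr a * (1 - (1 - exp (- d * (norm \<xi>)\<^sup>2)) powr a))" for \<xi> :: 'a
      using d by (simp add: powr_divide right_diff_distrib flip: exp_add)
    then have "(\<integral>\<xi>. cos (x \<bullet> \<xi>) * exp (- \<tau> * (norm \<xi>)\<^sup>2) * exp (- t * ((1 - exp (- d * (norm \<xi>)\<^sup>2)) / d) powr a) \<partial>lborel)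
      = exp (- t / d powr a) * (\<integral>\<xi>. cos (x \<bullet> \<xi>) * exp (- \<tau> * (norm \<xi>)\<^sup>2) * exp (t / d powr a * (1 - (1 - exp (- d * (norm \<xi>)\<^sup>2)) powr a)) \<partial>lborel)"
      by (simp add: mult.left_commute[of _ "exp (- t / d powr a)"] mult.left_commute[of _ "exp (- (t / d powr a))"])
    then show ?thesis using 2[of "t / d powr a" d] t d by simp
  qed
  show ?thesis
  proof (rule gaussian_cos_integral_limit_nonneg[OF \<tau> _ _ _ _ 3])
    show "0 < inverse (real (Suc n))" for n by simp
    show "\<bar>exp (- t * ((1 - exp (- inverse (real (Suc n)) * (norm \<xi>)\<^sup>2)) / inverse (real (Suc n))) powr a)\<bar> \<le> 1" for n and \<xi> :: 'a
      using t by auto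
    show "(\<lambda>n. exp (- t * ((1 - exp (- inverse (real (Suc n)) * (norm \<xi>)\<^sup>2)) / inverse (real (Suc n))) powr a))
      \<longlonglongrightarrow> exp (- t * ((norm \<xi>)\<^sup>2) powr a)" if \<xi>: "\<xi> \<noteq> 0" for \<xi> :: 'a
    proof -
      define l where "l = (norm \<xi>)\<^sup>2"
      have l: "0 < l" using \<xi> by (simp add: l_def)
      have "((\<lambda>d. (1 - exp (- d * l)) / d) \<longlongrightarrow> l) (at_right 0)"
        using l by real_asymp
      then have "(\<lambda>n. (1 - exp (- inverse (real (Suc n)) * l)) / inverse (real (Suc n))) \<longlonglongrightarrow> l"
        by (rule filterlim_compose) real_asymp
      then show ?thesis unfolding l_def[symmetric] using l by (intro tendsto_intros) auto
    qed
  qed measurable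
qed

text \<open>Here \<alpha> < 2 enters: |\<xi>|^\<alpha> is the power \<alpha>/2 of |\<xi>|^2, with
  \<alpha>/2 in (0, 1).\<close>

lemma heat_kernel_nonneg:
  fixes x :: "'a::euclidean_space"
  assumes \<alpha>: "0 < \<alpha>" "\<alpha> < 2"
  shows "0 \<le> heat_kernel \<alpha> \<tau> x"
proof (cases "\<tau> \<le> 0")
  case False
  have "heat_symbol \<alpha> \<tau> \<xi> = exp (- \<tau> * (norm \<xi>)\<^sup>2) * exp (- \<tau> * ((norm \<xi>)\<^sup>2) powr (\<alpha> / 2))" for \<xi> :: 'a
  proof -
    have "((norm \<xi>)\<^sup>2) powr (\<alpha> / 2) = norm \<xi> powr \<alpha>"
      by (cases "\<xi> = 0") (simp_all add: powr_powr flip: powr_numeral)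
    then show ?thesis by (simp add: heat_symbol_def ring_distribs flip: exp_add)
  qed
  then show ?thesis
    using False exp_neg_powr_gaussian_cos_integral_nonneg[of \<tau> \<tau> "\<alpha> / 2" x] \<alpha>
    by (simp add: heat_kernel_def mult.assoc)
qed (simp add: heat_kernel_def)

section \<open>Mass, Fourier transform, semigroup law and time regularity of the kernel\<close>

lemma heat_kernel_minus: "heat_kernel \<alpha> \<tau> (- x) = heat_kernel \<alpha> \<tau> x"
  by (simp add: heat_kernel_def)

lemma heat_kernel_borel [measurable]: "heat_kernel \<alpha> \<tau> \<in> borel_measurable borel"
  using measurable_compose[OF measurable_Pair1', OF _ heat_kernel_measurable, of \<tau>] by simp

lemma gaussian_integral: "(\<integral>w. exp (- (norm w)\<^sup>2) \<partial>(lborel :: 'a::euclidean_space measure)) = pi powr (real DIM('a) / 2)"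
  and integrable_std_gaussian: "integrable lborel (\<lambda>w::'a::euclidean_space. exp (- (norm w)\<^sup>2))"
  using gaussian_cos[of 1 "0::'a"] by (simp_all add: has_bochner_integral_iff)

text \<open>Covers both limits in \<open>heat_kernel_gaussian_fourier\<close>: a shrinking
  regularisation at fixed time, and a vanishing time at fixed regularisation.\<close>

lemma gaussian_heat_symbol_limit:
  fixes \<xi> :: "nat \<Rightarrow> 'a::euclidean_space \<Rightarrow> 'a"
  assumes t: "\<And>n. 0 \<le> t n" and [measurable]: "\<And>n. \<xi> n \<in> borel_measurable borel"
    and lim: "\<And>w. (\<lambda>n. heat_symbol \<alpha> (t n) (\<xi> n w)) \<longlonglongrightarrow> l"
  shows "(\<lambda>n. pi powr (- real DIM('a) / 2) * (\<integral>w. exp (- (norm w)\<^sup>2) * heat_symbol \<alpha> (t n) (\<xi> n w) \<partial>lborel)) \<longlonglongrightarrow> l"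
proof -
  have "(\<lambda>n. \<integral>w. exp (- (norm w)\<^sup>2) * heat_symbol \<alpha> (t n) (\<xi> n w) \<partial>lborel) \<longlonglongrightarrow>
      (\<integral>w. exp (- (norm (w::'a))\<^sup>2) * l \<partial>lborel)"
  proof (rule integral_dominated_convergence[where w = "\<lambda>w. exp (- (norm w)\<^sup>2)"])
    show "integrable lborel (\<lambda>w::'a. exp (- (norm w)\<^sup>2))" by (rule integrable_std_gaussian)
    show "AE w in lborel. norm (exp (- (norm w)\<^sup>2) * heat_symbol \<alpha> (t n) (\<xi> n w)) \<le> exp (- (norm w)\<^sup>2)" for n
      using heat_symbol_le_1[OF t] by (auto simp: abs_mult heat_symbol_pos abs_of_pos)
    show "AE w in lborel. (\<lambda>n. exp (- (norm w)\<^sup>2) * heat_symbol \<alpha> (t n) (\<xi> n w)) \<longlonglongrightarrow> exp (- (norm w)\<^sup>2) * l"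
      by (intro AE_I2 tendsto_intros lim)
  qed measurable
  then have "(\<lambda>n. pi powr (- real DIM('a) / 2) * (\<integral>w. exp (- (norm w)\<^sup>2) * heat_symbol \<alpha> (t n) (\<xi> n w) \<partial>lborel)) \<longlonglongrightarrow>
    pi powr (- real DIM('a) / 2) * (\<integral>w. exp (- (norm (w::'a))\<^sup>2) * l \<partial>lborel)"
    by (intro tendsto_intros)
  also have "pi powr (- real DIM('a) / 2) * (\<integral>w. exp (- (norm (w::'a))\<^sup>2) * l \<partial>lborel) = l"
    by (simp add: gaussian_integral powr_minus)
  finally show ?thesis .
qed

lemma heat_kernel_fourier_limit:
  fixes \<xi> :: "'a::euclidean_space"
  assumes t: "0 < t" and \<alpha>: "0 < \<alpha>"
  shows "(\<lambda>n. \<integral>x. heat_kernel \<alpha> t x * (cos (x \<bullet> \<xi>) * exp (- inverse (real (Suc n)) * (norm x)\<^sup>2)) \<partial>lborel) \<longlonglongrightarrow> heat_symbol \<alpha> t \<xi>"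
proof -
  have lim: "(\<lambda>n. heat_symbol \<alpha> t (\<xi> + (2 * sqrt (inverse (real (Suc n)))) *\<^sub>R w)) \<longlonglongrightarrow> heat_symbol \<alpha> t \<xi>" for w
  proof -
    have "(\<lambda>n. sqrt (inverse (real (Suc n)))) \<longlonglongrightarrow> 0" by real_asymp
    then have "(\<lambda>n. \<xi> + (2 * sqrt (inverse (real (Suc n)))) *\<^sub>R w) \<longlonglongrightarrow> \<xi> + (2 * 0) *\<^sub>R w"
      by (intro tendsto_intros)
    moreover have "isCont (heat_symbol \<alpha> t) \<xi>"
    proof -
      have pw: "((\<lambda>\<xi>. norm \<xi> powr \<alpha>) \<longlongrightarrow> norm \<xi> powr \<alpha>) (at \<xi>)"
        by (rule tendsto_powr'[OF tendsto_norm[OF tendsto_ident_at] tendsto_const]) (use \<alpha> in \<open>auto intro: always_eventually\<close>)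
      show ?thesis unfolding continuous_at heat_symbol_def
        by (intro pw tendsto_exp tendsto_minus tendsto_mult tendsto_add tendsto_power tendsto_norm tendsto_const tendsto_ident_at)
    qed
    ultimately have "(\<lambda>n. heat_symbol \<alpha> t (\<xi> + (2 * sqrt (inverse (real (Suc n)))) *\<^sub>R w)) \<longlonglongrightarrow> heat_symbol \<alpha> t (\<xi> + (2 * 0) *\<^sub>R w)"
      by (intro isCont_tendsto_compose[where g = "heat_symbol \<alpha> t"]) simp_all
    then show ?thesis by simp
  qed
  have *: "has_bochner_integral lborel (\<lambda>x. heat_kernel \<alpha> t x * (cos (x \<bullet> \<xi>) * exp (- inverse (real (Suc n)) * (norm x)\<^sup>2)))
    (pi powr (- real DIM('a) / 2) * (\<integral>w. exp (- (norm w)\<^sup>2) * heat_symbol \<alpha> t (\<xi> + (2 * sqrt (inverse (real (Suc n)))) *\<^sub>R w) \<partial>lborel))" for n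
    by (rule heat_kernel_gaussian_fourier[OF t]) simp
  show ?thesis unfolding has_bochner_integral_integral_eq[OF *]
    by (rule gaussian_heat_symbol_limit[OF _ _ lim]) (use t in auto)
qed

text \<open>Positivity makes the Gaussian cut-offs increase with n, so monotone convergence delivers
  integrability and the mass, which is the symbol at \<xi> = 0, together.\<close>

lemma heat_kernel_integral:
  assumes t: "0 < t" and \<alpha>: "0 < \<alpha>" "\<alpha> < 2"
  shows "has_bochner_integral lborel (heat_kernel \<alpha> t :: 'a::euclidean_space \<Rightarrow> real) 1"
proof (rule has_bochner_integral_monotone_convergence)
  let ?f = "\<lambda>n (x::'a). heat_kernel \<alpha> t x * exp (- inverse (real (Suc n)) * (norm x)\<^sup>2)"
  show "integrable lborel (?f n)" for n
    using heat_kernel_gaussian_fourier[OF t, of "inverse (real (Suc n))" \<alpha> "0::'a"]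
    by (simp add: has_bochner_integral_iff)
  show "AE x in lborel. mono (\<lambda>n. ?f n x)"
    by (intro AE_I2 monoI mult_left_mono heat_kernel_nonneg \<alpha>) (auto simp: divide_simps mult_left_mono)
  have "(\<lambda>n. exp (- inverse (real (Suc n)) * (norm x)\<^sup>2)) \<longlonglongrightarrow> 1" for x :: 'a
    by real_asymp
  then have "(\<lambda>n. ?f n x) \<longlonglongrightarrow> heat_kernel \<alpha> t x * 1" for x
    by (intro tendsto_intros)
  then show "AE x in lborel. (\<lambda>n. ?f n x) \<longlonglongrightarrow> heat_kernel \<alpha> t x" by simp
  show "(\<lambda>n. integral\<^sup>L lborel (?f n)) \<longlonglongrightarrow> 1"
    using heat_kernel_fourier_limit[OF t \<alpha>(1), of "0::'a"] by (simp add: heat_symbol_def)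
qed simp

lemma integrable_heat_kernel:
  assumes \<alpha>: "0 < \<alpha>" "\<alpha> < 2"
  shows "integrable lborel (heat_kernel \<alpha> t :: 'a::euclidean_space \<Rightarrow> real)"
proof (cases "0 < t")
  case True
  then show ?thesis using heat_kernel_integral[OF _ \<alpha>] by (auto simp: has_bochner_integral_iff)
next
  case False
  then have "heat_kernel \<alpha> t = (\<lambda>x::'a. 0)" by (auto simp: heat_kernel_def)
  then show ?thesis by simp
qed

lemma heat_kernel_fourier:
  fixes \<xi> :: "'a::euclidean_space"
  assumes t: "0 < t" and \<alpha>: "0 < \<alpha>" "\<alpha> < 2"
  shows "(\<integral>x. heat_kernel \<alpha> t x * cos (x \<bullet> \<xi>) \<partial>lborel) = heat_symbol \<alpha> t \<xi>"
proof (rule LIMSEQ_unique[OF _ heat_kernel_fourier_limit[OF t \<alpha>(1)]])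
  show "(\<lambda>n. \<integral>x. heat_kernel \<alpha> t x * (cos (x \<bullet> \<xi>) * exp (- inverse (real (Suc n)) * (norm x)\<^sup>2)) \<partial>lborel)
    \<longlonglongrightarrow> (\<integral>x. heat_kernel \<alpha> t x * cos (x \<bullet> \<xi>) \<partial>lborel)"
  proof (rule integral_dominated_convergence[where w = "heat_kernel \<alpha> t"])
    show "AE x in lborel. norm (heat_kernel \<alpha> t x * (cos (x \<bullet> \<xi>) * exp (- inverse (real (Suc n)) * (norm x)\<^sup>2))) \<le> heat_kernel \<alpha> t x" for n
    proof (rule AE_I2)
      fix x :: 'a
      have "\<bar>cos (x \<bullet> \<xi>)\<bar> * exp (- inverse (real (Suc n)) * (norm x)\<^sup>2) \<le> 1 * 1" by (intro mult_mono) auto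
      then have "heat_kernel \<alpha> t x * (\<bar>cos (x \<bullet> \<xi>)\<bar> * exp (- inverse (real (Suc n)) * (norm x)\<^sup>2)) \<le> heat_kernel \<alpha> t x * 1"
        by (intro mult_left_mono heat_kernel_nonneg \<alpha>) auto
      then show "norm (heat_kernel \<alpha> t x * (cos (x \<bullet> \<xi>) * exp (- inverse (real (Suc n)) * (norm x)\<^sup>2))) \<le> heat_kernel \<alpha> t x"
        using heat_kernel_nonneg[OF \<alpha>, of t x] by (simp add: abs_mult)
    qed
    have "(\<lambda>n. exp (- inverse (real (Suc n)) * (norm x)\<^sup>2)) \<longlonglongrightarrow> 1" for x :: 'a
      by real_asymp
    then have "(\<lambda>n. heat_kernel \<alpha> t x * (cos (x \<bullet> \<xi>) * exp (- inverse (real (Suc n)) * (norm x)\<^sup>2))) \<longlonglongrightarrow> heat_kernel \<alpha> t x * (cos (x \<bullet> \<xi>) * 1)" for x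
      by (intro tendsto_intros)
    then show "AE x in lborel. (\<lambda>n. heat_kernel \<alpha> t x * (cos (x \<bullet> \<xi>) * exp (- inverse (real (Suc n)) * (norm x)\<^sup>2))) \<longlonglongrightarrow> heat_kernel \<alpha> t x * cos (x \<bullet> \<xi>)"
      by simp
  qed (use integrable_heat_kernel[OF \<alpha>] in auto)
qed

lemma integrable_heat_kernel_trig:
  fixes \<xi> :: "'a::euclidean_space"
  assumes \<alpha>: "0 < \<alpha>" "\<alpha> < 2"
  shows "integrable lborel (\<lambda>x. heat_kernel \<alpha> t x * cos (x \<bullet> \<xi>))"
    and "integrable lborel (\<lambda>x. heat_kernel \<alpha> t x * sin (x \<bullet> \<xi>))"
  by (rule Bochner_Integration.integrable_bound[OF integrable_heat_kernel[OF \<alpha>, of t]],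
      auto simp: abs_mult intro!: mult_right_le_one_le)+

text \<open>The sine part vanishes because the kernel is even.\<close>

lemma heat_kernel_fourier_shift:
  fixes x \<xi> :: "'a::euclidean_space"
  assumes t: "0 < t" and \<alpha>: "0 < \<alpha>" "\<alpha> < 2"
  shows "(\<integral>y. heat_kernel \<alpha> t y * cos ((x - y) \<bullet> \<xi>) \<partial>lborel) = cos (x \<bullet> \<xi>) * heat_symbol \<alpha> t \<xi>"
proof -
  have "(\<integral>y. heat_kernel \<alpha> t y * sin (y \<bullet> \<xi>) \<partial>lborel) = - (\<integral>y. heat_kernel \<alpha> t y * sin (y \<bullet> \<xi>) \<partial>lborel)"
    using integral_reflect[of "\<lambda>y. heat_kernel \<alpha> t y * sin (y \<bullet> \<xi>)" 0] by (simp add: heat_kernel_minus)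
  then have sin0: "(\<integral>y. heat_kernel \<alpha> t y * sin (y \<bullet> \<xi>) \<partial>lborel) = 0" by simp
  have "(\<integral>y. heat_kernel \<alpha> t y * cos ((x - y) \<bullet> \<xi>) \<partial>lborel) =
     (\<integral>y. cos (x \<bullet> \<xi>) * (heat_kernel \<alpha> t y * cos (y \<bullet> \<xi>)) + sin (x \<bullet> \<xi>) * (heat_kernel \<alpha> t y * sin (y \<bullet> \<xi>)) \<partial>lborel)"
    by (intro Bochner_Integration.integral_cong refl) (simp add: inner_diff_left cos_diff algebra_simps)
  also have "\<dots> = cos (x \<bullet> \<xi>) * heat_symbol \<alpha> t \<xi>"
    using integrable_heat_kernel_trig[OF \<alpha>, of t \<xi>] by (simp add: sin0 heat_kernel_fourier[OF t \<alpha>])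
  finally show ?thesis .
qed

text \<open>Only one of the two kernels is expanded as a Fourier integral; after Fubini the other
  one is Fourier transformed, and the symbols multiply.\<close>

lemma heat_kernel_semigroup:
  fixes x :: "'a::euclidean_space"
  assumes t: "0 < \<tau>" "0 < \<sigma>" and \<alpha>: "0 < \<alpha>" "\<alpha> < 2"
  shows "(\<integral>y. heat_kernel \<alpha> \<tau> (x - y) * heat_kernel \<alpha> \<sigma> y \<partial>lborel) = heat_kernel \<alpha> (\<tau> + \<sigma>) x"
proof -
  let ?c = "(2 * pi) powr (- real DIM('a))"
  have c: "(\<lambda>(y, \<xi>). cos ((x - y) \<bullet> \<xi>)) \<in> borel_measurable (borel \<Otimes>\<^sub>M (borel :: 'a measure))"
    by measurable
  have "(\<integral>y. heat_kernel \<alpha> \<tau> (x - y) * heat_kernel \<alpha> \<sigma> y \<partial>lborel) =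
    (\<integral>y. ?c * (heat_kernel \<alpha> \<sigma> y * (\<integral>\<xi>. cos ((x - y) \<bullet> \<xi>) * heat_symbol \<alpha> \<tau> \<xi> \<partial>lborel)) \<partial>lborel)"
    using t by (simp add: heat_kernel_def[of \<alpha> \<tau>] mult_ac)
  also have "\<dots> = ?c * (\<integral>\<xi>. (\<integral>y. heat_kernel \<alpha> \<sigma> y * cos ((x - y) \<bullet> \<xi>) \<partial>lborel) * heat_symbol \<alpha> \<tau> \<xi> \<partial>lborel)"
    by (simp add: Fubini_bounded_kernel(1)[OF integrable_heat_kernel[OF \<alpha>] integrable_heat_symbol[OF t(1)] c])
  also have "\<dots> = ?c * (\<integral>\<xi>. cos (x \<bullet> \<xi>) * heat_symbol \<alpha> (\<tau> + \<sigma>) \<xi> \<partial>lborel)"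
    by (simp add: heat_kernel_fourier_shift[OF t(2) \<alpha>] mult.assoc heat_symbol_mult add.commute[of \<sigma>])
  finally show ?thesis using t by (simp add: heat_kernel_def)
qed

text \<open>A Markov inequality: outside the ball of radius d the function 1 - exp(-|x|^2) is at
  least 1 - exp(-d^2), while its integral against the kernel tends to 0 with the time, as the
  explicit Gaussian pairing shows.\<close>

lemma heat_kernel_concentrates:
  assumes \<alpha>: "0 < \<alpha>" "\<alpha> < 2" and d: "0 < d"
  shows "((\<lambda>t. \<integral>x. indicator {x. d \<le> norm x} x * heat_kernel \<alpha> t (x::'a::euclidean_space) \<partial>lborel) \<longlongrightarrow> 0) (at_right 0)"
proof (rule tendsto_at_right_sequentially[of _ 1])
  fix T :: "nat \<Rightarrow> real"
  assume T: "\<And>n. 0 < T n" and T0: "T \<longlonglongrightarrow> 0"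
  define J where "J n = (\<integral>x. heat_kernel \<alpha> (T n) (x::'a) * exp (- (norm x)\<^sup>2) \<partial>lborel)" for n
  have J: "has_bochner_integral lborel (\<lambda>x::'a. heat_kernel \<alpha> (T n) x * exp (- (norm x)\<^sup>2))
      (pi powr (- real DIM('a) / 2) * (\<integral>w. exp (- (norm (w::'a))\<^sup>2) * heat_symbol \<alpha> (T n) (2 *\<^sub>R w) \<partial>lborel))" for n
    using heat_kernel_gaussian_fourier[OF T, of 1 \<alpha> n "0::'a"] by simp
  have "(\<lambda>n. heat_symbol \<alpha> (T n) (2 *\<^sub>R w)) \<longlonglongrightarrow> exp (- (0 * ((norm (2 *\<^sub>R w))\<^sup>2 + norm (2 *\<^sub>R w) powr \<alpha>)))" for w :: 'a
    unfolding heat_symbol_def by (intro tendsto_intros T0)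
  then have "J \<longlonglongrightarrow> 1"
    unfolding J_def has_bochner_integral_integral_eq[OF J] using T
    by (intro gaussian_heat_symbol_limit) (auto simp: less_imp_le)
  then have lim: "(\<lambda>n. (1 - J n) / (1 - exp (- d\<^sup>2))) \<longlonglongrightarrow> 0"
    using d by (auto intro!: tendsto_eq_intros)
  have le: "(\<integral>x. indicator {x. d \<le> norm x} x * heat_kernel \<alpha> (T n) (x::'a) \<partial>lborel) \<le> (1 - J n) / (1 - exp (- d\<^sup>2))" for n
  proof -
    have I: "integrable lborel (\<lambda>x::'a. heat_kernel \<alpha> (T n) x - heat_kernel \<alpha> (T n) x * exp (- (norm x)\<^sup>2))"
      using J integrable_heat_kernel[OF \<alpha>, where 'a='a] by (auto simp: has_bochner_integral_iff)
    have "(\<integral>x. indicator {x. d \<le> norm x} x * heat_kernel \<alpha> (T n) (x::'a) \<partial>lborel) \<le>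
      (\<integral>x. (heat_kernel \<alpha> (T n) (x::'a) - heat_kernel \<alpha> (T n) x * exp (- (norm x)\<^sup>2)) / (1 - exp (- d\<^sup>2)) \<partial>lborel)"
    proof (rule integral_mono)
      show "integrable lborel (\<lambda>x::'a. indicator {x. d \<le> norm x} x * heat_kernel \<alpha> (T n) x)"
        by (rule Bochner_Integration.integrable_bound[OF integrable_heat_kernel[OF \<alpha>, of "T n"]])
          (auto simp: indicator_def)
      fix x :: 'a
      note nn = heat_kernel_nonneg[OF \<alpha>, of "T n" x]
      have d1: "exp (- d\<^sup>2) < 1" using d by simp
      show "indicator {x. d \<le> norm x} x * heat_kernel \<alpha> (T n) x \<le> (heat_kernel \<alpha> (T n) x - heat_kernel \<alpha> (T n) x * exp (- (norm x)\<^sup>2)) / (1 - exp (- d\<^sup>2))"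
      proof (cases "d \<le> norm x")
        case True
        then have "exp (- (norm x)\<^sup>2) \<le> exp (- d\<^sup>2)" using d by (simp add: power_mono)
        then have "heat_kernel \<alpha> (T n) x * (1 - exp (- d\<^sup>2)) \<le> heat_kernel \<alpha> (T n) x * (1 - exp (- (norm x)\<^sup>2))"
          by (intro mult_left_mono nn) auto
        then show ?thesis using True d1 by (simp add: field_simps)
      next
        case False
        have "0 \<le> heat_kernel \<alpha> (T n) x * (1 - exp (- (norm x)\<^sup>2))" using nn by simp
        then show ?thesis using False d1 by (simp add: right_diff_distrib)
      qed
    qed (use I in simp)
    also have "\<dots> = (1 - J n) / (1 - exp (- d\<^sup>2))"
      using J[of n] heat_kernel_integral[OF T \<alpha>, of n, where 'a='a]
      by (simp add: has_bochner_integral_iff J_def)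
    finally show ?thesis .
  qed
  show "(\<lambda>n. \<integral>x. indicator {x. d \<le> norm x} x * heat_kernel \<alpha> (T n) (x::'a) \<partial>lborel) \<longlonglongrightarrow> 0"
    by (rule tendsto_sandwich[OF _ _ tendsto_const lim])
      (auto intro!: always_eventually le Bochner_Integration.integral_nonneg mult_nonneg_nonneg heat_kernel_nonneg \<alpha>)
qed simp

text \<open>The lower bound \<sigma>/2 on the times makes the symbol at \<sigma>/2 a common
  integrable majorant.\<close>

lemma heat_kernel_tendsto:
  fixes x :: "'a::euclidean_space"
  assumes s: "0 < \<sigma>" and T: "\<And>n. \<sigma> / 2 \<le> T n" "T \<longlonglongrightarrow> \<sigma>"
  shows "(\<lambda>n. heat_kernel \<alpha> (T n) x) \<longlonglongrightarrow> heat_kernel \<alpha> \<sigma> x"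
proof -
  have "(\<lambda>n. \<integral>\<xi>. cos (x \<bullet> \<xi>) * heat_symbol \<alpha> (T n) \<xi> \<partial>lborel) \<longlonglongrightarrow> (\<integral>\<xi>. cos (x \<bullet> \<xi>) * heat_symbol \<alpha> \<sigma> \<xi> \<partial>lborel)"
  proof (rule integral_dominated_convergence[where w = "heat_symbol \<alpha> (\<sigma> / 2)"])
    show "integrable lborel (heat_symbol \<alpha> (\<sigma> / 2) :: 'a \<Rightarrow> real)" using s by (intro integrable_heat_symbol) simp
    show "AE \<xi> in lborel. (\<lambda>n. cos (x \<bullet> \<xi>) * heat_symbol \<alpha> (T n) \<xi>) \<longlonglongrightarrow> cos (x \<bullet> \<xi>) * heat_symbol \<alpha> \<sigma> \<xi>"
      unfolding heat_symbol_def by (intro AE_I2 tendsto_intros T)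
    have "\<bar>cos (x \<bullet> \<xi>)\<bar> * heat_symbol \<alpha> (T n) \<xi> \<le> 1 * heat_symbol \<alpha> (\<sigma> / 2) \<xi>" for n \<xi>
    proof -
      have "\<sigma> / 2 * ((norm \<xi>)\<^sup>2 + norm \<xi> powr \<alpha>) \<le> T n * ((norm \<xi>)\<^sup>2 + norm \<xi> powr \<alpha>)"
        by (intro mult_right_mono T) auto
      then show ?thesis by (intro mult_mono) (auto simp: heat_symbol_def)
    qed
    then show "AE \<xi> in lborel. norm (cos (x \<bullet> \<xi>) * heat_symbol \<alpha> (T n) \<xi>) \<le> heat_symbol \<alpha> (\<sigma> / 2) \<xi>" for n
      by (simp add: abs_mult abs_of_pos heat_symbol_pos)
  qed auto
  moreover have "0 < T n" for n using s T(1)[of n] by linarith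
  ultimately show ?thesis using s
    by (simp add: heat_kernel_def not_le[symmetric] tendsto_mult_left)
qed

text \<open>Scheffe's lemma: nonnegative functions of equal mass that converge pointwise converge in
  L^1.\<close>

lemma heat_kernel_L1_continuous:
  assumes \<alpha>: "0 < \<alpha>" "\<alpha> < 2" and s: "0 < \<sigma>"
  shows "((\<lambda>t. \<integral>x. \<bar>heat_kernel \<alpha> t x - heat_kernel \<alpha> \<sigma> (x::'a::euclidean_space)\<bar> \<partial>lborel) \<longlongrightarrow> 0) (at \<sigma>)"
  unfolding tendsto_at_iff_sequentially comp_def
proof safe
  fix T :: "nat \<Rightarrow> real" assume T: "T \<longlonglongrightarrow> \<sigma>"
  \<comment> \<open>Raising the times to at least \<sigma>/2 alters only finitely many
    terms.\<close>
  define S where "S n = max (\<sigma> / 2) (T n)" for n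
  have S: "\<And>n. \<sigma> / 2 \<le> S n" "S \<longlonglongrightarrow> \<sigma>"
    using s tendsto_max[OF tendsto_const T, of "\<sigma> / 2"] by (auto simp: S_def[abs_def] max_def[of "\<sigma> / 2" \<sigma>])
  have Spos: "0 < S n" for n using S(1)[of n] s by linarith
  let ?D = "\<lambda>n x. heat_kernel \<alpha> (S n) (x::'a) - heat_kernel \<alpha> \<sigma> x"
  have nn1: "(\<integral>\<^sup>+x. norm (heat_kernel \<alpha> t (x::'a)) \<partial>lborel) = 1" if "0 < t" for t
    using heat_kernel_integral[OF that \<alpha>, where 'a='a] heat_kernel_nonneg[OF \<alpha>, where 'a='a]
    by (simp add: has_bochner_integral_iff nn_integral_eq_integral)
  have "(\<lambda>n. \<integral>\<^sup>+x. norm (?D n x) \<partial>lborel) \<longlonglongrightarrow> 0"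
    by (rule Scheffe_lemma2)
      (use s Spos nn1 integrable_heat_kernel[OF \<alpha>, where 'a='a] heat_kernel_tendsto[OF s S, where 'a='a] in auto)
  moreover have "(\<integral>\<^sup>+x. norm (?D n x) \<partial>lborel) = ennreal (\<integral>x. \<bar>?D n x\<bar> \<partial>lborel)" for n
    using integrable_heat_kernel[OF \<alpha>, where 'a='a] by (subst nn_integral_eq_integral) auto
  ultimately have "(\<lambda>n. ennreal (\<integral>x. \<bar>?D n x\<bar> \<partial>lborel)) \<longlonglongrightarrow> ennreal 0" by simp
  then have "(\<lambda>n. \<integral>x. \<bar>?D n x\<bar> \<partial>lborel) \<longlonglongrightarrow> 0"
    by (subst (asm) tendsto_ennreal_iff) auto
  moreover have "eventually (\<lambda>n. \<sigma> / 2 < T n) sequentially"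
    using s by (intro order_tendstoD(1)[OF T]) auto
  then have "eventually (\<lambda>n. (\<integral>x. \<bar>?D n x\<bar> \<partial>lborel) = (\<integral>x. \<bar>heat_kernel \<alpha> (T n) x - heat_kernel \<alpha> \<sigma> (x::'a)\<bar> \<partial>lborel)) sequentially"
    by eventually_elim (simp add: S_def max_def)
  ultimately show "(\<lambda>n. \<integral>x. \<bar>heat_kernel \<alpha> (T n) x - heat_kernel \<alpha> \<sigma> (x::'a)\<bar> \<partial>lborel) \<longlonglongrightarrow> 0"
    by (rule Lim_transform_eventually)
qed

section \<open>Convolution semigroups\<close>

text \<open>Young's inequality, read as the tangent line at b lying below the convex function a^q.
  In this form it gives both Jensen's inequality and the Lipschitz bound of the reaction.\<close>

lemma young_powr:
  fixes a b q :: real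
  assumes "1 \<le> q" "0 \<le> a" "0 \<le> b"
  shows "q * (a * b powr (q - 1)) \<le> a powr q + (q - 1) * b powr q"
proof (cases "q = 1 \<or> a = 0 \<or> b = 0")
  case True
  then show ?thesis using assms by (auto simp: powr_def)
next
  case False
  then have q: "1 < q" and ab: "0 < a" "0 < b" using assms by auto
  have "(a powr q) powr (1 / q) * (b powr q) powr (1 - 1 / q) \<le> 1 / q * a powr q + (1 - 1 / q) * b powr q"
    by (rule Youngs_inequality_0) (use q ab in auto)
  also have "(a powr q) powr (1 / q) * (b powr q) powr (1 - 1 / q) = a * b powr (q - 1)"
    using q ab by (simp add: powr_powr right_diff_distrib)
  finally show ?thesis using q by (simp add: field_simps)
qed

text \<open>The properties of the heat kernel on which the study of the evolution rests. Continuity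
  at time 0 appears only as concentration of mass, because the kernels have no limit in L^1
  there.\<close>

locale convolution_semigroup =
  fixes k :: "real \<Rightarrow> 'a::euclidean_space \<Rightarrow> real"
  assumes k_measurable [measurable]: "(\<lambda>(\<tau>, x). k \<tau> x) \<in> borel_measurable (borel \<Otimes>\<^sub>M borel)"
    and k_nonpos: "\<tau> \<le> 0 \<Longrightarrow> k \<tau> x = 0"
    and k_nonneg: "0 \<le> k \<tau> x"
    and k_minus: "k \<tau> (- x) = k \<tau> x"
    and k_integrable: "integrable lborel (k \<tau>)"
    and k_integral: "0 < \<tau> \<Longrightarrow> (\<integral>x. k \<tau> x \<partial>lborel) = 1"
    and k_semigroup: "0 < \<tau> \<Longrightarrow> 0 < \<sigma> \<Longrightarrow> (\<integral>y. k \<tau> (x - y) * k \<sigma> y \<partial>lborel) = k (\<tau> + \<sigma>) x"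
    and k_L1_continuous: "0 < \<sigma> \<Longrightarrow> ((\<lambda>\<tau>. \<integral>x. \<bar>k \<tau> x - k \<sigma> x\<bar> \<partial>lborel) \<longlongrightarrow> 0) (at \<sigma>)"
    and k_concentrates: "0 < d \<Longrightarrow> ((\<lambda>\<tau>. \<integral>x. indicator {x. d \<le> norm x} x * k \<tau> x \<partial>lborel) \<longlongrightarrow> 0) (at_right 0)"
begin

definition heat :: "real \<Rightarrow> ('a \<Rightarrow> real) \<Rightarrow> 'a \<Rightarrow> real" where
  "heat \<tau> f x = (\<integral>y. k \<tau> (x - y) * f y \<partial>lborel)"

text \<open>The L^1 distance of two kernels controls the difference of the heat operators on bounded
  and on integrable functions alike.\<close>

definition kdist :: "real \<Rightarrow> real \<Rightarrow> real" where
  "kdist \<tau> \<sigma> = (\<integral>x. \<bar>k \<tau> x - k \<sigma> x\<bar> \<partial>lborel)"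

lemma k_borel [measurable]: "k \<tau> \<in> borel_measurable borel"
  using measurable_compose[OF measurable_Pair1', OF _ k_measurable, of \<tau>] by simp

lemma k_integral_le: "(\<integral>x. k \<tau> x \<partial>lborel) \<le> 1"
  by (cases "0 < \<tau>") (auto simp: k_integral k_nonpos)

lemma k_reflect_integrable: "integrable lborel (\<lambda>y. k \<tau> (x - y))"
  by (subst integrable_reflect) (auto simp: k_integrable)

lemma k_reflect_integral: "(\<integral>y. k \<tau> (x - y) \<partial>lborel) = (\<integral>y. k \<tau> y \<partial>lborel)"
  by (subst integral_reflect) auto

lemma heat_nonpos: "\<tau> \<le> 0 \<Longrightarrow> heat \<tau> f x = 0"
  by (simp add: heat_def k_nonpos)

lemma heat_measurable_pair:
  assumes [measurable]: "\<tau> \<in> borel_measurable M" "(\<lambda>(s, y). F s y) \<in> borel_measurable (M \<Otimes>\<^sub>M borel)"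
  shows "(\<lambda>(s, x). heat (\<tau> s) (F s) x) \<in> borel_measurable (M \<Otimes>\<^sub>M borel)"
proof -
  have [measurable]: "(\<lambda>((s, x), y). k (\<tau> s) (x - y)) \<in> borel_measurable ((M \<Otimes>\<^sub>M borel) \<Otimes>\<^sub>M borel)"
    using measurable_compose[of "\<lambda>((s, x), y). (\<tau> s, x - y)" "(M \<Otimes>\<^sub>M borel) \<Otimes>\<^sub>M borel" "borel \<Otimes>\<^sub>M borel", OF _ k_measurable]
    by (simp add: case_prod_unfold)
  show ?thesis unfolding heat_def by measurable
qed

lemma heat_measurable [measurable]:
  assumes [measurable]: "f \<in> borel_measurable borel"
  shows "heat \<tau> f \<in> borel_measurable borel"
  unfolding heat_def[abs_def] by measurable

lemma heat_integrable:
  assumes [measurable]: "f \<in> borel_measurable borel" and f: "\<And>y. \<bar>f y\<bar> \<le> C"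
  shows "integrable lborel (\<lambda>y. k \<tau> (x - y) * f y)"
proof (rule Bochner_Integration.integrable_bound)
  show "integrable lborel (\<lambda>y. k \<tau> (x - y) * C)" using k_reflect_integrable by simp
  show "AE y in lborel. norm (k \<tau> (x - y) * f y) \<le> norm (k \<tau> (x - y) * C)"
    using f by (auto simp: abs_mult k_nonneg intro!: AE_I2 mult_left_mono intro: order_trans[OF f])
qed measurable

lemma heat_mono:
  assumes "f \<in> borel_measurable borel" "\<And>y. \<bar>f y\<bar> \<le> C" "g \<in> borel_measurable borel" "\<And>y. \<bar>g y\<bar> \<le> D"
    and "\<And>y. f y \<le> g y"
  shows "heat \<tau> f x \<le> heat \<tau> g x"
  unfolding heat_def
  by (rule integral_mono[OF heat_integrable heat_integrable]) (use assms k_nonneg in \<open>auto intro!: mult_left_mono\<close>)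

lemma heat_nonneg: "(\<And>y. 0 \<le> f y) \<Longrightarrow> 0 \<le> heat \<tau> f x"
  unfolding heat_def by (auto intro!: Bochner_Integration.integral_nonneg mult_nonneg_nonneg k_nonneg)

lemma heat_const: "heat \<tau> (\<lambda>_. c) x = (if 0 < \<tau> then c else 0)"
  by (simp add: heat_def k_reflect_integral k_integral k_nonpos)

lemma heat_cmult: "heat \<tau> (\<lambda>y. c * f y) x = c * heat \<tau> f x"
proof -
  have "k \<tau> (x - y) * (c * f y) = c * (k \<tau> (x - y) * f y)" for y by simp
  then show ?thesis unfolding heat_def by (simp only: integral_mult_right_zero)
qed

lemma heat_uminus: "heat \<tau> (\<lambda>y. - f y) x = - heat \<tau> f x"
  using heat_cmult[of \<tau> "- 1" f x] by simp

lemma heat_add: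
  assumes "f \<in> borel_measurable borel" "\<And>y. \<bar>f y\<bar> \<le> C" "g \<in> borel_measurable borel" "\<And>y. \<bar>g y\<bar> \<le> D"
  shows "heat \<tau> (\<lambda>y. f y + g y) x = heat \<tau> f x + heat \<tau> g x"
  unfolding heat_def distrib_left
  by (intro Bochner_Integration.integral_add heat_integrable[OF assms(1,2)] heat_integrable[OF assms(3,4)])

lemma heat_diff:
  assumes "f \<in> borel_measurable borel" "\<And>y. \<bar>f y\<bar> \<le> C" "g \<in> borel_measurable borel" "\<And>y. \<bar>g y\<bar> \<le> D"
  shows "heat \<tau> (\<lambda>y. f y - g y) x = heat \<tau> f x - heat \<tau> g x"
  unfolding heat_def right_diff_distrib
  by (intro Bochner_Integration.integral_diff heat_integrable[OF assms(1,2)] heat_integrable[OF assms(3,4)])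

lemma heat_cong_AE:
  assumes "f \<in> borel_measurable borel" "g \<in> borel_measurable borel" "AE y in lborel. f y = g y"
  shows "heat \<tau> f x = heat \<tau> g x"
  unfolding heat_def using assms by (intro integral_cong_AE) auto

lemma heat_abs_le:
  assumes "f \<in> borel_measurable borel" "\<And>y. \<bar>f y\<bar> \<le> C"
  shows "\<bar>heat \<tau> f x\<bar> \<le> heat \<tau> (\<lambda>y. \<bar>f y\<bar>) x"
proof -
  have "\<bar>heat \<tau> f x\<bar> \<le> (\<integral>y. \<bar>k \<tau> (x - y) * f y\<bar> \<partial>lborel)"
    unfolding heat_def by (rule integral_abs_bound)
  then show ?thesis by (simp add: heat_def abs_mult k_nonneg)
qed

lemma heat_bound:
  assumes "f \<in> borel_measurable borel" "\<And>y. \<bar>f y\<bar> \<le> C"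
  shows "\<bar>heat \<tau> f x\<bar> \<le> C"
proof -
  have C: "0 \<le> C" using assms(2)[of undefined] by linarith
  have "heat \<tau> (\<lambda>y. \<bar>f y\<bar>) x \<le> heat \<tau> (\<lambda>_. C) x"
    by (rule heat_mono[where C = C and D = C]) (use assms C in auto)
  then show ?thesis using heat_abs_le[OF assms, of \<tau> x] C by (auto simp: heat_const split: if_splits)
qed

lemma heat_heat:
  assumes t: "0 < \<tau>" "0 < \<sigma>" and [measurable]: "f \<in> borel_measurable borel" and f: "\<And>y. \<bar>f y\<bar> \<le> C"
  shows "heat \<tau> (heat \<sigma> f) x = heat (\<tau> + \<sigma>) f x"
proof -
  have af: "\<And>y. \<bar>\<bar>f y\<bar>\<bar> \<le> C" using f by simp
  have int: "integrable (lborel \<Otimes>\<^sub>M lborel) (\<lambda>(y, z). k \<tau> (x - y) * (k \<sigma> (y - z) * f z))"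
  proof (rule lborel_pair.Fubini_integrable)
    have "integrable lborel (\<lambda>y. k \<tau> (x - y) * heat \<sigma> (\<lambda>z. \<bar>f z\<bar>) y)"
      by (rule heat_integrable[OF _ heat_bound[OF _ af]]) auto
    then show "integrable lborel (\<lambda>y. LBINT z. norm (case (y, z) of (y, z) \<Rightarrow> k \<tau> (x - y) * (k \<sigma> (y - z) * f z)))"
      by (simp add: abs_mult k_nonneg heat_def)
    show "AE y in lborel. integrable lborel (\<lambda>z. case (y, z) of (y, z) \<Rightarrow> k \<tau> (x - y) * (k \<sigma> (y - z) * f z))"
      using heat_integrable[OF _ f] by simp
  qed measurable
  have "heat \<tau> (heat \<sigma> f) x = (\<integral>y. \<integral>z. k \<tau> (x - y) * (k \<sigma> (y - z) * f z) \<partial>lborel \<partial>lborel)"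
    unfolding heat_def by simp
  also have "\<dots> = (\<integral>z. \<integral>y. k \<tau> (x - y) * (k \<sigma> (y - z) * f z) \<partial>lborel \<partial>lborel)"
    by (rule lborel_pair.Fubini_integral[OF int, symmetric])
  also have "\<dots> = (\<integral>z. k (\<tau> + \<sigma>) (x - z) * f z \<partial>lborel)"
  proof (intro Bochner_Integration.integral_cong refl)
    fix z
    have "(\<integral>y. k \<tau> (x - y) * k \<sigma> (y - z) \<partial>lborel) = (\<integral>y. k \<tau> ((x - z) - y) * k \<sigma> y \<partial>lborel)"
      using integral_shift[of "\<lambda>y. k \<tau> ((x - z) - y) * k \<sigma> y" z] by simp
    then show "(\<integral>y. k \<tau> (x - y) * (k \<sigma> (y - z) * f z) \<partial>lborel) = k (\<tau> + \<sigma>) (x - z) * f z"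
      by (simp add: k_semigroup[OF t] flip: mult.assoc)
  qed
  finally show ?thesis by (simp add: heat_def)
qed

text \<open>Used to propagate a Duhamel integral: the heat operator passes under the time integral
  by Fubini, with the time majorant g times the kernel dominating.\<close>

lemma heat_time_integral:
  fixes F :: "real \<Rightarrow> 'a \<Rightarrow> real"
  assumes F[measurable]: "(\<lambda>(s, y). F s y) \<in> borel_measurable (borel \<Otimes>\<^sub>M borel)"
    and g: "integrable lborel g" "\<And>s y. \<bar>F s y\<bar> \<le> g s"
  shows "heat \<tau> (\<lambda>y. \<integral>s. F s y \<partial>lborel) x = (\<integral>s. heat \<tau> (F s) x \<partial>lborel)"
proof -
  have g0: "0 \<le> g s" for s using g(2)[of s undefined] by linarith
  have [measurable]: "F s \<in> borel_measurable borel" for s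
    using measurable_compose[OF measurable_Pair1', OF _ F, of s] by simp
  have [measurable]: "g \<in> borel_measurable borel" using g by auto
  have int: "integrable (lborel \<Otimes>\<^sub>M lborel) (\<lambda>(s, y). k \<tau> (x - y) * F s y)"
  proof (rule lborel_pair.Fubini_integrable)
    show "integrable lborel (\<lambda>s. LBINT y. norm (case (s, y) of (s, y) \<Rightarrow> k \<tau> (x - y) * F s y))"
    proof (rule Bochner_Integration.integrable_bound[OF g(1)])
      show "AE s in lborel. norm (LBINT y. norm (case (s, y) of (s, y) \<Rightarrow> k \<tau> (x - y) * F s y)) \<le> norm (g s)"
      proof (rule AE_I2)
        fix s
        have "(LBINT y. norm (case (s, y) of (s, y) \<Rightarrow> k \<tau> (x - y) * F s y)) = heat \<tau> (\<lambda>y. \<bar>F s y\<bar>) x"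
          by (simp add: heat_def abs_mult k_nonneg)
        then show "norm (LBINT y. norm (case (s, y) of (s, y) \<Rightarrow> k \<tau> (x - y) * F s y)) \<le> norm (g s)"
          using heat_bound[of "\<lambda>y. \<bar>F s y\<bar>" "g s" \<tau> x] g g0[of s] by simp
      qed
    qed measurable
    show "AE s in lborel. integrable lborel (\<lambda>y. case (s, y) of (s, y) \<Rightarrow> k \<tau> (x - y) * F s y)"
      using heat_integrable[OF _ g(2)] by simp
  qed measurable
  show ?thesis
    using lborel_pair.Fubini_integral[OF int] by (simp add: heat_def)
qed

lemma kdist_nonneg: "0 \<le> kdist \<tau> \<sigma>"
  by (simp add: kdist_def)

lemma kdist_le: "kdist \<tau> \<sigma> \<le> 2"
proof -
  have "kdist \<tau> \<sigma> \<le> (\<integral>x. k \<tau> x + k \<sigma> x \<partial>lborel)"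
    unfolding kdist_def by (rule integral_mono) (use k_integrable k_nonneg in \<open>auto simp: abs_le_iff intro: add_increasing add_increasing2\<close>)
  also have "\<dots> \<le> 2" using k_integral_le[of \<tau>] k_integral_le[of \<sigma>] by (simp add: k_integrable)
  finally show ?thesis .
qed

text \<open>At \<sigma> = 0 this fails, since the kernel jumps from 0 to mass 1; for negative
  \<sigma> both kernels vanish nearby.\<close>

lemma kdist_tendsto:
  assumes "\<sigma> \<noteq> 0"
  shows "((\<lambda>\<tau>. kdist \<tau> \<sigma>) \<longlongrightarrow> 0) (at \<sigma>)"
proof (cases "0 < \<sigma>")
  case True
  then show ?thesis unfolding kdist_def by (rule k_L1_continuous)
next
  case False
  then have "\<sigma> < 0" using assms by simp
  then have "eventually (\<lambda>\<tau>. \<tau> < 0) (at \<sigma>)" by (intro order_tendstoD) auto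
  then have "eventually (\<lambda>\<tau>. 0 = kdist \<tau> \<sigma>) (at \<sigma>)"
    by eventually_elim (use False in \<open>simp add: kdist_def k_nonpos\<close>)
  then show ?thesis by (rule Lim_transform_eventually[OF tendsto_const])
qed

lemma kdist_reflect: "(\<integral>y. \<bar>k \<tau> (x - y) - k \<sigma> (x - y)\<bar> \<partial>lborel) = kdist \<tau> \<sigma>"
  unfolding kdist_def by (rule integral_reflect) simp

lemma kdist_measurable [measurable]:
  assumes [measurable]: "f \<in> borel_measurable M" "g \<in> borel_measurable M"
  shows "(\<lambda>s. kdist (f s) (g s)) \<in> borel_measurable M"
proof -
  have [measurable]: "(\<lambda>(s, x). k (f s) x) \<in> borel_measurable (M \<Otimes>\<^sub>M borel)"
    "(\<lambda>(s, x). k (g s) x) \<in> borel_measurable (M \<Otimes>\<^sub>M borel)"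
    using measurable_compose[of "\<lambda>(s, x). (f s, x)" "M \<Otimes>\<^sub>M borel" "borel \<Otimes>\<^sub>M borel", OF _ k_measurable]
      measurable_compose[of "\<lambda>(s, x). (g s, x)" "M \<Otimes>\<^sub>M borel" "borel \<Otimes>\<^sub>M borel", OF _ k_measurable]
    by (simp_all add: case_prod_unfold)
  show ?thesis unfolding kdist_def by measurable
qed

lemma heat_kdist:
  assumes f[measurable]: "f \<in> borel_measurable borel" and fC: "\<And>y. \<bar>f y\<bar> \<le> C"
  shows "\<bar>heat \<tau> f x - heat \<sigma> f x\<bar> \<le> C * kdist \<tau> \<sigma>"
proof -
  have C: "0 \<le> C" using fC[of undefined] by linarith
  have int: "integrable lborel (\<lambda>y. \<bar>k \<tau> (x - y) - k \<sigma> (x - y)\<bar>)"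
    using k_reflect_integrable by simp
  have "heat \<tau> f x - heat \<sigma> f x = (\<integral>y. (k \<tau> (x - y) - k \<sigma> (x - y)) * f y \<partial>lborel)"
    unfolding heat_def by (simp add: left_diff_distrib heat_integrable[OF f fC])
  also have "\<bar>\<dots>\<bar> \<le> (\<integral>y. \<bar>(k \<tau> (x - y) - k \<sigma> (x - y)) * f y\<bar> \<partial>lborel)"
    by (rule integral_abs_bound)
  also have "\<dots> \<le> (\<integral>y. \<bar>k \<tau> (x - y) - k \<sigma> (x - y)\<bar> * C \<partial>lborel)"
  proof (rule integral_mono)
    show "integrable lborel (\<lambda>y. \<bar>(k \<tau> (x - y) - k \<sigma> (x - y)) * f y\<bar>)"
      by (simp add: left_diff_distrib heat_integrable[OF f fC])
  qed (use int fC in \<open>auto simp: abs_mult intro!: mult_left_mono\<close>)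
  finally show ?thesis using int by (simp add: kdist_reflect mult.commute)
qed

lemma heat_L1:
  assumes f[measurable]: "f \<in> borel_measurable borel" and fC: "\<And>y. \<bar>f y\<bar> \<le> C" and fi: "integrable lborel f"
  shows heat_L1_integrable: "integrable lborel (heat \<tau> f)"
    and heat_L1_integral: "0 < \<tau> \<Longrightarrow> (\<integral>x. heat \<tau> f x \<partial>lborel) = (\<integral>x. f x \<partial>lborel)"
    and heat_L1_kdist: "(\<integral>x. \<bar>heat \<tau> f x - heat \<sigma> f x\<bar> \<partial>lborel) \<le> kdist \<tau> \<sigma> * (\<integral>x. \<bar>f x\<bar> \<partial>lborel)"
proof -
  \<comment> \<open>Stated for a general q because it serves for the kernel itself and for the
    absolute difference of two kernels.\<close>
  have key: "integrable (lborel \<Otimes>\<^sub>M lborel) (\<lambda>(y, x). q (x - y) * f y)"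
    if [measurable]: "q \<in> borel_measurable borel" and q: "integrable lborel q" for q :: "'a \<Rightarrow> real"
  proof (rule lborel_pair.Fubini_integrable)
    have "(LBINT x. \<bar>q (x - y)\<bar>) = (LBINT x. \<bar>q x\<bar>)" for y
      by (rule integral_shift) simp
    then show "integrable lborel (\<lambda>y. LBINT x. norm (case (y, x) of (y, x) \<Rightarrow> q (x - y) * f y))"
      using fi by (simp add: abs_mult)
    show "AE y in lborel. integrable lborel (\<lambda>x. case (y, x) of (y, x) \<Rightarrow> q (x - y) * f y)"
      using q by (simp add: integrable_shift)
  qed measurable
  have val: "(\<integral>x. \<integral>y. q (x - y) * f y \<partial>lborel \<partial>lborel) = (\<integral>x. q x \<partial>lborel) * (\<integral>y. f y \<partial>lborel)"
    if [measurable]: "q \<in> borel_measurable borel" and q: "integrable lborel q" for q :: "'a \<Rightarrow> real"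
  proof -
    have "(\<integral>x. q (x - y) \<partial>lborel) = (\<integral>x. q x \<partial>lborel)" for y by (rule integral_shift) simp
    then show ?thesis using lborel_pair.Fubini_integral[OF key[OF _ q]] by simp
  qed
  show i: "integrable lborel (heat \<tau> f)" for \<tau>
    using lborel_pair.integrable_snd[OF key[OF _ k_integrable]] by (simp add: heat_def[abs_def])
  show "(\<integral>x. heat \<tau> f x \<partial>lborel) = (\<integral>x. f x \<partial>lborel)" if "0 < \<tau>"
    using val[OF _ k_integrable[of \<tau>]] that by (simp add: heat_def k_integral)
  let ?q = "\<lambda>x. \<bar>k \<tau> x - k \<sigma> x\<bar>"
  have q: "?q \<in> borel_measurable borel" "integrable lborel ?q" using k_integrable by auto
  have "(\<integral>x. \<bar>heat \<tau> f x - heat \<sigma> f x\<bar> \<partial>lborel) \<le> (\<integral>x. \<integral>y. \<bar>?q (x - y) * f y\<bar> \<partial>lborel \<partial>lborel)"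
  proof (rule integral_mono)
    show "integrable lborel (\<lambda>x. \<bar>heat \<tau> f x - heat \<sigma> f x\<bar>)" using i by simp
    show "integrable lborel (\<lambda>x. \<integral>y. \<bar>?q (x - y) * f y\<bar> \<partial>lborel)"
      using lborel_pair.integrable_snd[of "\<lambda>y x. \<bar>?q (x - y) * f y\<bar>"] integrable_abs[OF key[OF q]]
      by (simp add: case_prod_unfold)
    show "\<bar>heat \<tau> f x - heat \<sigma> f x\<bar> \<le> (\<integral>y. \<bar>?q (x - y) * f y\<bar> \<partial>lborel)" for x
    proof -
      have "heat \<tau> f x - heat \<sigma> f x = (\<integral>y. (k \<tau> (x - y) - k \<sigma> (x - y)) * f y \<partial>lborel)"
        unfolding heat_def by (simp add: left_diff_distrib heat_integrable[OF f fC])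
      also have "\<bar>\<dots>\<bar> \<le> (\<integral>y. \<bar>(k \<tau> (x - y) - k \<sigma> (x - y)) * f y\<bar> \<partial>lborel)"
        by (rule integral_abs_bound)
      finally show ?thesis by (simp add: abs_mult)
    qed
  qed
  also have "\<dots> = kdist \<tau> \<sigma> * (\<integral>x. \<bar>f x\<bar> \<partial>lborel)"
  proof -
    have "integrable (lborel \<Otimes>\<^sub>M lborel) (\<lambda>(y, x). \<bar>?q (x - y) * f y\<bar>)"
      using integrable_abs[OF key[OF q]] by (simp add: case_prod_unfold)
    note lborel_pair.Fubini_integral[OF this]
    moreover have "(\<integral>x. \<bar>?q (x - y) * f y\<bar> \<partial>lborel) = kdist \<tau> \<sigma> * \<bar>f y\<bar>" for y
      using integral_shift[of ?q y] by (simp add: abs_mult kdist_def)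
    ultimately show ?thesis by simp
  qed
  finally show "(\<integral>x. \<bar>heat \<tau> f x - heat \<sigma> f x\<bar> \<partial>lborel) \<le> kdist \<tau> \<sigma> * (\<integral>x. \<bar>f x\<bar> \<partial>lborel)" .
qed

text \<open>Jensen's inequality without a probability space: the tangent-line inequality at the
  average A is integrated against the kernel, whose mass is 1, and (q - 1) A^q is cancelled.\<close>

lemma heat_jensen:
  assumes f[measurable]: "f \<in> borel_measurable borel" and fC: "\<And>y. \<bar>f y\<bar> \<le> C" and q: "1 \<le> q" and t: "0 < \<tau>"
  shows "(heat \<tau> (\<lambda>y. \<bar>f y\<bar>) x) powr q \<le> heat \<tau> (\<lambda>y. \<bar>f y\<bar> powr q) x"
proof -
  define A where "A = heat \<tau> (\<lambda>y. \<bar>f y\<bar>) x"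
  have A: "0 \<le> A" unfolding A_def by (rule heat_nonneg) simp
  have b1: "\<bar>q * (\<bar>f y\<bar> * A powr (q - 1))\<bar> \<le> q * (C * A powr (q - 1))" for y
    using q A fC[of y] by (auto simp: abs_mult intro!: mult_left_mono mult_right_mono)
  have b0: "\<bar>\<bar>f y\<bar> powr q\<bar> \<le> C powr q" for y using fC[of y] q by (auto intro: powr_mono2)
  have b2: "\<bar>\<bar>f y\<bar> powr q + (q - 1) * A powr q\<bar> \<le> C powr q + (q - 1) * A powr q" for y
    using b0[of y] q by simp
  have "heat \<tau> (\<lambda>y. q * (\<bar>f y\<bar> * A powr (q - 1))) x \<le> heat \<tau> (\<lambda>y. \<bar>f y\<bar> powr q + (q - 1) * A powr q) x"
    by (rule heat_mono[OF _ b1 _ b2]) (use young_powr[OF q] A in auto)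
  also have "heat \<tau> (\<lambda>y. q * (\<bar>f y\<bar> * A powr (q - 1))) x = q * A powr q"
  proof -
    have "heat \<tau> (\<lambda>y. q * (\<bar>f y\<bar> * A powr (q - 1))) x = heat \<tau> (\<lambda>y. (q * A powr (q - 1)) * \<bar>f y\<bar>) x"
      by (simp add: mult_ac)
    also have "\<dots> = (q * A powr (q - 1)) * A" unfolding A_def by (rule heat_cmult)
    also have "\<dots> = q * A powr q" using A by (cases "A = 0") (simp_all add: powr_diff)
    finally show ?thesis .
  qed
  also have "heat \<tau> (\<lambda>y. \<bar>f y\<bar> powr q + (q - 1) * A powr q) x = heat \<tau> (\<lambda>y. \<bar>f y\<bar> powr q) x + (q - 1) * A powr q"
    by (subst heat_add[OF _ b0, where D = "\<bar>(q - 1) * A powr q\<bar>"]) (use t in \<open>auto simp: heat_const\<close>)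
  finally show ?thesis unfolding A_def[symmetric] by (simp add: algebra_simps)
qed

text \<open>The kernel is even, so the heat operator can be moved onto the test function; this is
  what gives weak-star continuity for data without regularity.\<close>

lemma heat_symmetric:
  assumes f[measurable]: "f \<in> borel_measurable borel" and fC: "\<And>y. \<bar>f y\<bar> \<le> C"
    and g[measurable]: "g \<in> borel_measurable borel" and gi: "integrable lborel g"
  shows "(\<integral>x. heat \<tau> f x * g x \<partial>lborel) = (\<integral>x. f x * heat \<tau> g x \<partial>lborel)"
proof -
  have af: "\<And>y. \<bar>\<bar>f y\<bar>\<bar> \<le> C" using fC by simp
  have int: "integrable (lborel \<Otimes>\<^sub>M lborel) (\<lambda>(x, y). k \<tau> (x - y) * f y * g x)"
  proof (rule lborel_pair.Fubini_integrable)
    have "integrable lborel (\<lambda>x. heat \<tau> (\<lambda>y. \<bar>f y\<bar>) x * \<bar>g x\<bar>)"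
    proof (rule Bochner_Integration.integrable_bound)
      show "integrable lborel (\<lambda>x. C * \<bar>g x\<bar>)" using gi by simp
      show "AE x in lborel. norm (heat \<tau> (\<lambda>y. \<bar>f y\<bar>) x * \<bar>g x\<bar>) \<le> norm (C * \<bar>g x\<bar>)"
        by (auto simp: abs_mult intro!: AE_I2 mult_right_mono order_trans[OF heat_bound[OF _ af]])
    qed measurable
    then show "integrable lborel (\<lambda>x. LBINT y. norm (case (x, y) of (x, y) \<Rightarrow> k \<tau> (x - y) * f y * g x))"
      by (simp add: abs_mult k_nonneg heat_def)
    show "AE x in lborel. integrable lborel (\<lambda>y. case (x, y) of (x, y) \<Rightarrow> k \<tau> (x - y) * f y * g x)"
      using heat_integrable[OF f fC] by simp
  qed measurable
  have k: "k \<tau> (x - y) = k \<tau> (y - x)" for x y using k_minus[of \<tau> "x - y"] by simp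
  have "(\<integral>x. heat \<tau> f x * g x \<partial>lborel) = (\<integral>x. \<integral>y. k \<tau> (x - y) * f y * g x \<partial>lborel \<partial>lborel)"
    by (simp add: heat_def)
  also have "\<dots> = (\<integral>y. \<integral>x. k \<tau> (x - y) * f y * g x \<partial>lborel \<partial>lborel)"
    by (rule lborel_pair.Fubini_integral[OF int, symmetric])
  also have "\<dots> = (\<integral>y. f y * heat \<tau> g y \<partial>lborel)"
  proof (intro Bochner_Integration.integral_cong refl)
    fix y
    have "(\<integral>x. k \<tau> (x - y) * f y * g x \<partial>lborel) = (\<integral>x. f y * (k \<tau> (y - x) * g x) \<partial>lborel)"
      by (simp add: k[of _ y] mult_ac)
    then show "(\<integral>x. k \<tau> (x - y) * f y * g x \<partial>lborel) = f y * heat \<tau> g y" by (simp add: heat_def)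
  qed
  finally show ?thesis .
qed

text \<open>Near x the modulus of continuity gives e/2; far from x the oscillation is at most 2 C
  and is multiplied by the escaping mass.\<close>

lemma heat_uniform_limit:
  assumes w: "uniformly_continuous_on UNIV w" and wC: "\<And>y. \<bar>w y\<bar> \<le> C" and e: "0 < e"
  shows "eventually (\<lambda>\<tau>. \<forall>x. \<bar>heat \<tau> w x - w x\<bar> \<le> e) (at_right 0)"
proof -
  have C: "0 \<le> C" using wC[of undefined] by linarith
  have [measurable]: "w \<in> borel_measurable borel"
    by (rule borel_measurable_continuous_onI) (rule uniformly_continuous_imp_continuous[OF w])
  obtain d where d: "0 < d" "\<And>x y. dist x y < d \<Longrightarrow> dist (w x) (w y) < e / 2"
    using w e unfolding uniformly_continuous_on_def by (metis UNIV_I half_gt_zero)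
  let ?tail = "\<lambda>\<tau>. \<integral>x. indicator {x. d \<le> norm x} x * k \<tau> x \<partial>lborel"
  \<comment> \<open>With this threshold the far part 2 C \<open>?tail \<tau>\<close> stays below
    e/2; C + 1 in place of C covers C = 0.\<close>
  have "eventually (\<lambda>\<tau>. ?tail \<tau> < e / (4 * (C + 1))) (at_right 0)"
    by (rule order_tendstoD[OF k_concentrates[OF d(1)]]) (use e C in auto)
  moreover have "eventually (\<lambda>\<tau>::real. 0 < \<tau>) (at_right 0)" by (rule eventually_at_right_less)
  ultimately show ?thesis
  proof eventually_elim
    case (elim \<tau>)
    show ?case
    proof
      fix x
      have i1: "integrable lborel (\<lambda>y. indicator {x. d \<le> norm x} (x - y) * k \<tau> (x - y))"
        by (rule Bochner_Integration.integrable_bound[OF k_reflect_integrable[of \<tau> x]])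
          (auto simp: indicator_def)
      have "heat \<tau> w x - w x = (\<integral>y. k \<tau> (x - y) * (w y - w x) \<partial>lborel)"
        using elim by (simp add: right_diff_distrib heat_integrable[OF _ wC] k_reflect_integrable k_reflect_integral k_integral heat_def)
      also have "\<bar>\<dots>\<bar> \<le> (\<integral>y. \<bar>k \<tau> (x - y) * (w y - w x)\<bar> \<partial>lborel)" by (rule integral_abs_bound)
      also have "\<dots> \<le> (\<integral>y. k \<tau> (x - y) * (e / 2) + 2 * C * (indicator {x. d \<le> norm x} (x - y) * k \<tau> (x - y)) \<partial>lborel)"
      proof (rule integral_mono)
        show "integrable lborel (\<lambda>y. \<bar>k \<tau> (x - y) * (w y - w x)\<bar>)"
          by (simp add: right_diff_distrib heat_integrable[OF _ wC] k_reflect_integrable)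
        show "integrable lborel (\<lambda>y. k \<tau> (x - y) * (e / 2) + 2 * C * (indicator {x. d \<le> norm x} (x - y) * k \<tau> (x - y)))"
          using i1 k_reflect_integrable by simp
        fix y
        have "\<bar>w y - w x\<bar> \<le> e / 2 + 2 * C * indicator {x. d \<le> norm x} (x - y)"
        proof (cases "d \<le> norm (x - y)")
          case True
          then show ?thesis using wC[of x] wC[of y] e by (auto simp: abs_le_iff)
        next
          case False
          then show ?thesis using d(2)[of y x] by (simp add: dist_norm norm_minus_commute)
        qed
        then have "k \<tau> (x - y) * \<bar>w y - w x\<bar> \<le> k \<tau> (x - y) * (e / 2 + 2 * C * indicator {x. d \<le> norm x} (x - y))"
          by (intro mult_left_mono k_nonneg)
        then show "\<bar>k \<tau> (x - y) * (w y - w x)\<bar> \<le> k \<tau> (x - y) * (e / 2) + 2 * C * (indicator {x. d \<le> norm x} (x - y) * k \<tau> (x - y))"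
          by (simp only: abs_mult abs_of_nonneg[OF k_nonneg]) (simp add: algebra_simps)
      qed
      also have "\<dots> = e / 2 + 2 * C * ?tail \<tau>"
        using i1 k_reflect_integrable elim integral_reflect[of "\<lambda>y. indicator {x. d \<le> norm x} y * k \<tau> y" x]
        by (simp add: k_reflect_integral k_integral)
      also have "\<dots> \<le> e / 2 + 2 * C * (e / (4 * (C + 1)))"
        using elim C by (intro add_left_mono mult_left_mono) auto
      also have "\<dots> \<le> e"
      proof -
        have "2 * C * (e / (4 * (C + 1))) = (e / 2) * (C / (C + 1))" using C by (simp add: field_simps)
        also have "\<dots> \<le> (e / 2) * 1" using C e by (intro mult_left_mono) auto
        finally show ?thesis by simp
      qed
      finally show "\<bar>heat \<tau> w x - w x\<bar> \<le> e" .
    qed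
  qed
qed

end

section \<open>Convergence and density in Lebesgue spaces\<close>

lemma powr_add_le:
  fixes a b q :: real
  assumes "0 \<le> a" "0 \<le> b" "0 \<le> q"
  shows "(a + b) powr q \<le> 2 powr q * (a powr q + b powr q)"
proof -
  have "(a + b) powr q \<le> (2 * max a b) powr q" using assms by (intro powr_mono2) auto
  also have "\<dots> = 2 powr q * max a b powr q" using assms by (simp add: powr_mult)
  also have "\<dots> \<le> 2 powr q * (a powr q + b powr q)" by (intro mult_left_mono) (auto simp: max_def)
  finally show ?thesis .
qed

lemma abs_add_powr_le:
  fixes a b q :: real
  assumes "0 \<le> q"
  shows "\<bar>a + b\<bar> powr q \<le> 2 powr q * (\<bar>a\<bar> powr q + \<bar>b\<bar> powr q)"
proof -
  have "\<bar>a + b\<bar> powr q \<le> (\<bar>a\<bar> + \<bar>b\<bar>) powr q" using assms by (intro powr_mono2) auto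
  also have "\<dots> \<le> 2 powr q * (\<bar>a\<bar> powr q + \<bar>b\<bar> powr q)" using assms by (intro powr_add_le) auto
  finally show ?thesis .
qed

lemma integrable_powr_diff:
  fixes u v :: "'a \<Rightarrow> real"
  assumes q: "0 \<le> q" and [measurable]: "u \<in> borel_measurable M" "v \<in> borel_measurable M"
    and u: "integrable M (\<lambda>x. \<bar>u x\<bar> powr q)" and v: "integrable M (\<lambda>x. \<bar>v x\<bar> powr q)"
  shows "integrable M (\<lambda>x. \<bar>u x - v x\<bar> powr q)"
proof (rule Bochner_Integration.integrable_bound)
  show "integrable M (\<lambda>x. 2 powr q * (\<bar>u x\<bar> powr q + \<bar>v x\<bar> powr q))" using u v by simp
  show "AE x in M. norm (\<bar>u x - v x\<bar> powr q) \<le> norm (2 powr q * (\<bar>u x\<bar> powr q + \<bar>v x\<bar> powr q))"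
    using abs_add_powr_le[OF q, of "u _" "- v _"] by (auto intro!: AE_I2)
qed measurable

text \<open>Pratt's form of dominated convergence: the dominating functions \<open>g n\<close> may vary with \<open>n\<close>
  as long as they converge in \<open>L\<^sup>1\<close>.\<close>

lemma dominated_powr_tendsto:
  fixes u g :: "nat \<Rightarrow> 'a \<Rightarrow> real"
  assumes q: "0 < q"
    and [measurable]: "\<And>n. u n \<in> borel_measurable M" "v \<in> borel_measurable M"
    and g: "\<And>n. integrable M (g n)" "integrable M G" "(\<lambda>n. \<integral>x. \<bar>g n x - G x\<bar> \<partial>M) \<longlonglongrightarrow> 0"
    and lim: "AE x in M. (\<lambda>n. u n x) \<longlonglongrightarrow> v x"
    and u: "\<And>n x. \<bar>u n x\<bar> powr q \<le> g n x" and v: "\<And>x. \<bar>v x\<bar> powr q \<le> G x"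
  shows "(\<lambda>n. \<integral>x. \<bar>u n x - v x\<bar> powr q \<partial>M) \<longlonglongrightarrow> 0"
proof -
  have [measurable]: "g n \<in> borel_measurable M" "G \<in> borel_measurable M" for n using g by auto
  have G0: "0 \<le> G x" for x using v[of x] order_trans[OF powr_ge_zero] by blast
  define B where "B x = 2 powr q * 2 * G x" for x
  have [measurable]: "B \<in> borel_measurable M" unfolding B_def by measurable
  have B: "integrable M B" "\<And>x. 0 \<le> B x" using g G0 by (simp_all add: B_def[abs_def])
  \<comment> \<open>The truncated difference has the fixed majorant B, so ordinary dominated
    convergence handles it; the excess is paid for by the L^1 convergence of the varying
    majorants.\<close>
  have le: "\<bar>u n x - v x\<bar> powr q \<le> 2 powr q * \<bar>g n x - G x\<bar> + min (\<bar>u n x - v x\<bar> powr q) (B x)" for n x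
  proof -
    have "\<bar>u n x - v x\<bar> powr q \<le> 2 powr q * (\<bar>u n x\<bar> powr q + \<bar>v x\<bar> powr q)"
      using abs_add_powr_le[of q "u n x" "- v x"] q by simp
    also have "\<dots> \<le> 2 powr q * (\<bar>g n x - G x\<bar> + 2 * G x)"
      using u[of n x] v[of x] by (intro mult_left_mono) auto
    finally have "\<bar>u n x - v x\<bar> powr q \<le> 2 powr q * \<bar>g n x - G x\<bar> + B x"
      by (simp add: B_def algebra_simps)
    moreover have "0 \<le> 2 powr q * \<bar>g n x - G x\<bar>" by simp
    ultimately show ?thesis by (auto simp: min_def)
  qed
  have i1: "integrable M (\<lambda>x. min (\<bar>u n x - v x\<bar> powr q) (B x))" for n
    by (rule Bochner_Integration.integrable_bound[OF B(1)]) (use B in \<open>auto simp: min_def\<close>)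
  have i2: "integrable M (\<lambda>x. 2 powr q * \<bar>g n x - G x\<bar>)" for n using g by simp
  have "(\<lambda>n. \<integral>x. min (\<bar>u n x - v x\<bar> powr q) (B x) \<partial>M) \<longlonglongrightarrow> (\<integral>x. 0 \<partial>M)"
  proof (rule integral_dominated_convergence[OF _ _ B(1)])
    show "AE x in M. (\<lambda>n. min (\<bar>u n x - v x\<bar> powr q) (B x)) \<longlonglongrightarrow> 0"
      using lim
    proof eventually_elim
      case (elim x)
      then have "(\<lambda>n. \<bar>u n x - v x\<bar>) \<longlonglongrightarrow> \<bar>v x - v x\<bar>" by (intro tendsto_intros)
      then have "(\<lambda>n. \<bar>u n x - v x\<bar> powr q) \<longlonglongrightarrow> \<bar>v x - v x\<bar> powr q"
        by (rule tendsto_powr') (use q in \<open>auto intro: always_eventually\<close>)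
      from tendsto_min[OF this tendsto_const[of "B x"]] show ?case using B(2)[of x] by simp
    qed
  qed (use B in \<open>auto simp: min_def\<close>)
  then have "(\<lambda>n. 2 powr q * (\<integral>x. \<bar>g n x - G x\<bar> \<partial>M) + (\<integral>x. min (\<bar>u n x - v x\<bar> powr q) (B x) \<partial>M)) \<longlonglongrightarrow> 2 powr q * 0 + 0"
    by (intro tendsto_intros g) simp
  then have upper: "(\<lambda>n. 2 powr q * (\<integral>x. \<bar>g n x - G x\<bar> \<partial>M) + (\<integral>x. min (\<bar>u n x - v x\<bar> powr q) (B x) \<partial>M)) \<longlonglongrightarrow> 0" by simp
  have "(\<integral>x. \<bar>u n x - v x\<bar> powr q \<partial>M) \<le> 2 powr q * (\<integral>x. \<bar>g n x - G x\<bar> \<partial>M) + (\<integral>x. min (\<bar>u n x - v x\<bar> powr q) (B x) \<partial>M)" for n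
  proof -
    have s: "integrable M (\<lambda>x. 2 powr q * \<bar>g n x - G x\<bar> + min (\<bar>u n x - v x\<bar> powr q) (B x))"
      using i1 i2 by simp
    have "integrable M (\<lambda>x. \<bar>u n x - v x\<bar> powr q)"
      by (rule Bochner_Integration.integrable_bound[OF s])
        (auto intro!: AE_I2 order_trans[OF le abs_ge_self])
    from integral_mono[OF this s le] show ?thesis using i1[of n] i2[of n] by simp
  qed
  then show ?thesis
    by (intro tendsto_sandwich[OF _ _ tendsto_const upper] always_eventually) auto
qed

lemma uniformly_continuous_compact_support:
  fixes g :: "'a::euclidean_space \<Rightarrow> real"
  assumes g: "continuous_on UNIV g" and B: "\<And>x. B \<le> norm x \<Longrightarrow> g x = 0"
  shows "uniformly_continuous_on UNIV g" and "\<exists>C. \<forall>x. \<bar>g x\<bar> \<le> C" and "integrable lborel g"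
proof -
  have cb: "continuous_on (cball 0 r) g" for r using g continuous_on_subset by blast
  \<comment> \<open>The margin 2 is for points at distance below 1: either both lie in this ball, or
    both lie outside the ball of radius B, where g vanishes.\<close>
  have u: "uniformly_continuous_on (cball 0 (B + 2)) g"
    by (rule compact_uniformly_continuous[OF cb]) simp
  show "uniformly_continuous_on UNIV g"
    unfolding uniformly_continuous_on_def
  proof safe
    fix e :: real assume "0 < e"
    then obtain d where d: "0 < d" "\<And>x y. x \<in> cball 0 (B + 2) \<Longrightarrow> y \<in> cball 0 (B + 2) \<Longrightarrow> dist y x < d \<Longrightarrow> dist (g y) (g x) < e"
      using u unfolding uniformly_continuous_on_def by metis
    show "\<exists>d>0. \<forall>x\<in>UNIV. \<forall>x'\<in>UNIV. dist x' x < d \<longrightarrow> dist (g x') (g x) < e"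
    proof (intro exI[of _ "min d 1"] conjI ballI impI)
      fix x y :: 'a assume "dist y x < min d 1"
      then have xy: "dist y x < d" "dist y x < 1" by auto
      have tri: "\<bar>norm y - norm x\<bar> \<le> dist y x" using norm_triangle_ineq3[of y x] by (simp add: dist_norm)
      show "dist (g y) (g x) < e"
      proof (cases "norm x \<le> B + 2 \<and> norm y \<le> B + 2")
        case True
        then show ?thesis using d(2)[of x y] xy by auto
      next
        case False
        then have "B \<le> norm x" "B \<le> norm y" using tri xy by auto
        then show ?thesis using B[of x] B[of y] \<open>0 < e\<close> by simp
      qed
    qed (use d in auto)
  qed
  have "bounded (g ` cball 0 B)" by (intro compact_imp_bounded compact_continuous_image cb compact_cball)
  then have "\<exists>C. \<forall>x\<in>cball 0 B. \<bar>g x\<bar> \<le> C" by (auto simp: bounded_iff)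
  then obtain C where C: "\<And>x. x \<in> cball 0 B \<Longrightarrow> \<bar>g x\<bar> \<le> C" by blast
  have C': "\<bar>g x\<bar> \<le> max C 0" for x
    using C[of x] B[of x] by (cases "norm x \<le> B") auto
  then show "\<exists>C. \<forall>x. \<bar>g x\<bar> \<le> C" by blast
  have [measurable]: "g \<in> borel_measurable borel" using g by (rule borel_measurable_continuous_onI)
  have "integrable lborel (\<lambda>x::'a. indicator (cball 0 B) x * max C 0)"
    by (intro integrable_mult_left integrable_real_indicator) (use emeasure_bounded_finite[OF bounded_cball, of "0::'a"] in auto)
  then show "integrable lborel g"
  proof (rule Bochner_Integration.integrable_bound)
    show "AE x in lborel. norm (g x) \<le> norm (indicator (cball 0 B) x * max C 0)"
      using C' B by (auto simp: indicator_def intro!: AE_I2)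
  qed measurable
qed

text \<open>f is truncated in value and in space. The truncation is then approximated by applying
  the same two truncations to continuous functions that converge to f almost everywhere; being
  uniformly bounded with common compact support, these converge by dominated convergence.\<close>

lemma Lq_dense_compact_support:
  fixes f :: "'a::euclidean_space \<Rightarrow> real"
  assumes q: "1 \<le> q" and f[measurable]: "f \<in> borel_measurable borel" and fi: "integrable lborel (\<lambda>x. \<bar>f x\<bar> powr q)" and e: "0 < e"
  shows "\<exists>g B. continuous_on UNIV g \<and> (\<forall>x. B \<le> norm x \<longrightarrow> g x = 0) \<and> (\<integral>x. \<bar>f x - g x\<bar> powr q \<partial>lborel) < e"
proof -
  define cut where "cut m x = max 0 (min 1 (real m - norm x))" for m and x :: 'a
  define clip where "clip m v = max (- real m) (min (real m) v)" for m v
  have cut01: "0 \<le> cut m x" "cut m x \<le> 1" for m x by (auto simp: cut_def)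
  have cut_c: "continuous_on UNIV (cut m)" for m unfolding cut_def by (intro continuous_intros)
  have clip_c: "continuous_on UNIV (clip m)" for m unfolding clip_def by (intro continuous_intros)
  have [measurable]: "cut m \<in> borel_measurable borel" "clip m \<in> borel_measurable borel" for m
    using cut_c clip_c by (auto intro: borel_measurable_continuous_onI)
  have clip_le: "\<bar>clip m v\<bar> \<le> m" "\<bar>v - clip m v * c\<bar> \<le> \<bar>v\<bar>" if "0 \<le> c" "c \<le> 1" for m v c
  proof -
    show "\<bar>clip m v\<bar> \<le> m" by (auto simp: clip_def)
    show "\<bar>v - clip m v * c\<bar> \<le> \<bar>v\<bar>"
    proof (cases "0 \<le> v")
      case True
      then have "0 \<le> clip m v" "clip m v \<le> v" by (auto simp: clip_def)
      moreover from this have "0 \<le> clip m v * c" "clip m v * c \<le> clip m v" using that by (auto intro: mult_left_le)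
      ultimately show ?thesis using True by auto
    next
      case False
      then have *: "clip m v \<le> 0" "v \<le> clip m v" by (auto simp: clip_def)
      then have "clip m v * c \<le> 0" "clip m v \<le> clip m v * c" using that
        by (auto intro: mult_nonpos_nonneg) (metis mult_left_mono_neg mult.right_neutral)
      then show ?thesis using False * by auto
    qed
  qed
  define F where "F m x = clip m (f x) * cut m x" for m x
  have [measurable]: "F m \<in> borel_measurable borel" for m unfolding F_def by measurable
  have "(\<lambda>m. \<integral>x. \<bar>f x - F m x\<bar> powr q \<partial>lborel) \<longlonglongrightarrow> (\<integral>x. 0 \<partial>(lborel :: 'a measure))"
  proof (rule integral_dominated_convergence[OF _ _ fi])
    show "AE x in lborel. (\<lambda>m. \<bar>f x - F m x\<bar> powr q) \<longlonglongrightarrow> 0"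
    proof (rule AE_I2)
      fix x
      \<comment> \<open>From m0 on neither truncation acts at x: m \<ge> |x| + 1 makes the cut-off
        equal to 1.\<close>
      obtain m0 :: nat where m0: "norm x + 1 \<le> m0" "\<bar>f x\<bar> \<le> m0"
        using real_arch_simple[of "max (norm x + 1) \<bar>f x\<bar>"] by auto
      have "eventually (\<lambda>m. 0 = \<bar>f x - F m x\<bar> powr q) sequentially"
        using eventually_ge_at_top[of m0]
        by eventually_elim (use m0 in \<open>auto simp: F_def clip_def cut_def min_def max_def\<close>)
      then show "(\<lambda>m. \<bar>f x - F m x\<bar> powr q) \<longlonglongrightarrow> 0" by (rule Lim_transform_eventually[OF tendsto_const])
    qed
    show "AE x in lborel. norm (\<bar>f x - F m x\<bar> powr q) \<le> \<bar>f x\<bar> powr q" for m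
      using clip_le(2)[OF cut01] q by (auto simp: F_def intro!: AE_I2 powr_mono2)
  qed auto
  \<comment> \<open>Two errors of this size, each multiplied by 2^q in the triangle inequality, add
    up to e/2.\<close>
  then have "eventually (\<lambda>m. (\<integral>x. \<bar>f x - F m x\<bar> powr q \<partial>lborel) < e / (4 * 2 powr q)) sequentially"
    using e by (intro order_tendstoD) auto
  then obtain m where m: "(\<integral>x. \<bar>f x - F m x\<bar> powr q \<partial>lborel) < e / (4 * 2 powr q)"
    by (auto simp: eventually_sequentially)
  \<comment> \<open>This notion of measurability supplies the continuous functions converging to f
    off a negligible set.\<close>
  have "f measurable_on UNIV"
    using f by (intro lebesgue_measurable_imp_measurable_on_real) (auto intro: measurable_completion)
  then obtain N g where N: "negligible N" and g: "\<And>n. continuous_on UNIV (g n)"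
    and lim: "\<And>x. x \<notin> N \<Longrightarrow> (\<lambda>n. g n x) \<longlonglongrightarrow> f x"
    unfolding measurable_on_def by auto
  define H where "H n x = clip m (g n x) * cut m x" for n x
  have H_c: "continuous_on UNIV (H n)" for n
    unfolding H_def by (intro continuous_on_mult continuous_on_compose2[OF clip_c g] cut_c) auto
  have [measurable]: "H n \<in> borel_measurable borel" for n using H_c by (rule borel_measurable_continuous_onI)
  have supp: "real m \<le> norm x \<Longrightarrow> H n x = 0" "real m \<le> norm x \<Longrightarrow> F m x = 0" for n x
    by (simp_all add: H_def F_def cut_def)
  have bnd: "\<bar>H n x\<bar> \<le> m" "\<bar>F m x\<bar> \<le> m" for n x
    using clip_le(1)[OF order_refl, of m] cut01[of m x]
    by (auto simp: H_def F_def abs_mult intro!: mult_left_le order_trans[OF mult_right_le_one_le])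
  have "AE x in lebesgue. x \<notin> N" using N by (simp add: negligible_iff_null_sets AE_not_in)
  then have aeN: "AE x in lborel. x \<notin> N" by (simp add: AE_completion_iff)
  have dom: "integrable lborel (\<lambda>x::'a. indicator (cball 0 (real m)) x * (2 * real m) powr q)"
    by (intro integrable_mult_left integrable_real_indicator) (use emeasure_bounded_finite[OF bounded_cball, of "0::'a"] in auto)
  have "(\<lambda>n. \<integral>x. \<bar>F m x - H n x\<bar> powr q \<partial>lborel) \<longlonglongrightarrow> (\<integral>x. 0 \<partial>(lborel :: 'a measure))"
  proof (rule integral_dominated_convergence[OF _ _ dom])
    show "AE x in lborel. (\<lambda>n. \<bar>F m x - H n x\<bar> powr q) \<longlonglongrightarrow> 0"
      using aeN
    proof eventually_elim
      case (elim x)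
      have "(\<lambda>n. clip m (g n x)) \<longlonglongrightarrow> clip m (f x)"
        unfolding clip_def by (intro tendsto_intros lim elim)
      then have "(\<lambda>n. \<bar>F m x - H n x\<bar>) \<longlonglongrightarrow> \<bar>F m x - F m x\<bar>"
        unfolding F_def H_def by (intro tendsto_intros)
      then have "(\<lambda>n. \<bar>F m x - H n x\<bar> powr q) \<longlonglongrightarrow> \<bar>F m x - F m x\<bar> powr q"
        by (rule tendsto_powr') (use q in \<open>auto intro: always_eventually\<close>)
      then show ?case by simp
    qed
    show "AE x in lborel. norm (\<bar>F m x - H n x\<bar> powr q) \<le> indicator (cball 0 (real m)) x * (2 * real m) powr q" for n
    proof (rule AE_I2)
      fix x
      show "norm (\<bar>F m x - H n x\<bar> powr q) \<le> indicator (cball 0 (real m)) x * (2 * real m) powr q"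
      proof (cases "norm x \<le> m")
        case True
        have "\<bar>F m x - H n x\<bar> \<le> 2 * m" using bnd(1)[of n x] bnd(2)[of x] by auto
        then show ?thesis using True q by (auto intro!: powr_mono2)
      qed (use supp in simp)
    qed
  qed auto
  then have "eventually (\<lambda>n. (\<integral>x. \<bar>F m x - H n x\<bar> powr q \<partial>lborel) < e / (4 * 2 powr q)) sequentially"
    using e by (intro order_tendstoD) auto
  then obtain n where n: "(\<integral>x. \<bar>F m x - H n x\<bar> powr q \<partial>lborel) < e / (4 * 2 powr q)"
    by (auto simp: eventually_sequentially)
  have q0: "0 \<le> q" using q by simp
  have i1: "integrable lborel (\<lambda>x. \<bar>f x - F m x\<bar> powr q)"
    by (rule Bochner_Integration.integrable_bound[OF fi])
      (use clip_le(2)[OF cut01] q in \<open>auto simp: F_def intro!: AE_I2 powr_mono2\<close>)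
  have i2: "integrable lborel (\<lambda>x. \<bar>F m x - H n x\<bar> powr q)"
  proof (rule Bochner_Integration.integrable_bound[OF dom])
    have "norm (\<bar>F m x - H n x\<bar> powr q) \<le> indicator (cball 0 (real m)) x * (2 * real m) powr q" for x
    proof (cases "norm x \<le> m")
      case True
      have "\<bar>F m x - H n x\<bar> \<le> 2 * m" using bnd(1)[of n x] bnd(2)[of x] by auto
      then show ?thesis using True q by (auto intro!: powr_mono2)
    qed (use supp in simp)
    then show "AE x in lborel. norm (\<bar>F m x - H n x\<bar> powr q) \<le> norm (indicator (cball 0 (real m)) x * (2 * real m) powr q)"
      by (auto intro!: AE_I2)
  qed auto
  have "(\<integral>x. \<bar>f x - H n x\<bar> powr q \<partial>lborel) \<le> (\<integral>x. 2 powr q * (\<bar>f x - F m x\<bar> powr q + \<bar>F m x - H n x\<bar> powr q) \<partial>lborel)"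
  proof (rule integral_mono')
    show "integrable lborel (\<lambda>x. 2 powr q * (\<bar>f x - F m x\<bar> powr q + \<bar>F m x - H n x\<bar> powr q))"
      using i1 i2 by simp
    show "\<bar>f x - H n x\<bar> powr q \<le> 2 powr q * (\<bar>f x - F m x\<bar> powr q + \<bar>F m x - H n x\<bar> powr q)" for x
      using abs_add_powr_le[OF q0, of "f x - F m x" "F m x - H n x"] by simp
  qed auto
  also have "\<dots> = 2 powr q * ((\<integral>x. \<bar>f x - F m x\<bar> powr q \<partial>lborel) + (\<integral>x. \<bar>F m x - H n x\<bar> powr q \<partial>lborel))"
    using i1 i2 by simp
  also have "\<dots> < 2 powr q * (e / (4 * 2 powr q) + e / (4 * 2 powr q))"
    using m n by (intro mult_strict_left_mono add_strict_mono) auto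
  also have "\<dots> \<le> e" using e by (simp add: field_simps)
  finally show ?thesis using H_c supp by blast
qed

section \<open>Behaviour of the heat operator on L^q and at time zero\<close>

context convolution_semigroup
begin

text \<open>Jensen's inequality combined with conservation of mass for |f|^q makes the heat operator
  a contraction of L^q.\<close>

lemma heat_powr_bound:
  assumes f[measurable]: "f \<in> borel_measurable borel" and fC: "\<And>y. \<bar>f y\<bar> \<le> C" and q: "1 \<le> q"
    and fi: "integrable lborel (\<lambda>x. \<bar>f x\<bar> powr q)" and t: "0 < \<tau>"
  shows "\<bar>heat \<tau> f x\<bar> powr q \<le> heat \<tau> (\<lambda>y. \<bar>f y\<bar> powr q) x"
    and "integrable lborel (heat \<tau> (\<lambda>y. \<bar>f y\<bar> powr q))"
    and "(\<integral>x. heat \<tau> (\<lambda>y. \<bar>f y\<bar> powr q) x \<partial>lborel) = (\<integral>x. \<bar>f x\<bar> powr q \<partial>lborel)"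
    and "integrable lborel (\<lambda>x. \<bar>heat \<tau> f x\<bar> powr q)"
    and "(\<integral>x. \<bar>heat \<tau> f x\<bar> powr q \<partial>lborel) \<le> (\<integral>x. \<bar>f x\<bar> powr q \<partial>lborel)"
proof -
  have b: "\<bar>\<bar>f y\<bar> powr q\<bar> \<le> C powr q" for y using fC[of y] q by (auto intro: powr_mono2)
  show 1: "\<bar>heat \<tau> f x\<bar> powr q \<le> heat \<tau> (\<lambda>y. \<bar>f y\<bar> powr q) x" for x
    using heat_jensen[OF f fC q t, of x] heat_abs_le[OF f fC, of \<tau> x] q
    by (auto intro: order_trans[OF powr_mono2])
  show 2: "integrable lborel (heat \<tau> (\<lambda>y. \<bar>f y\<bar> powr q))"
    by (rule heat_L1_integrable[OF _ b fi]) measurable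
  show 3: "(\<integral>x. heat \<tau> (\<lambda>y. \<bar>f y\<bar> powr q) x \<partial>lborel) = (\<integral>x. \<bar>f x\<bar> powr q \<partial>lborel)"
    by (rule heat_L1_integral[OF _ b fi t]) measurable
  show 4: "integrable lborel (\<lambda>x. \<bar>heat \<tau> f x\<bar> powr q)"
    by (rule Bochner_Integration.integrable_bound[OF 2])
      (auto intro!: AE_I2 order_trans[OF 1 abs_ge_self])
  show "(\<integral>x. \<bar>heat \<tau> f x\<bar> powr q \<partial>lborel) \<le> (\<integral>x. \<bar>f x\<bar> powr q \<partial>lborel)"
    using integral_mono[OF 4 2 1] 3 by simp
qed

text \<open>By Jensen the heat flow of G = |g|^q dominates the q-th power of the heat flow of g. It
  keeps the mass of G, hence converges to G in L^1 by Scheffe's lemma, and so serves as the varying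
  majorant of \<open>dominated_powr_tendsto\<close>.\<close>

lemma heat_Lq_limit_compact_support:
  assumes q: "1 \<le> q" and g: "continuous_on UNIV g" and B: "\<And>x. B \<le> norm x \<Longrightarrow> g x = 0"
  shows "((\<lambda>\<tau>. \<integral>x. \<bar>heat \<tau> g x - g x\<bar> powr q \<partial>lborel) \<longlongrightarrow> 0) (at_right 0)"
proof (rule tendsto_at_right_sequentially[of _ 1])
  fix T :: "nat \<Rightarrow> real"
  assume T: "\<And>n. 0 < T n" and T0: "T \<longlonglongrightarrow> 0"
  have T_right: "filterlim T (at_right 0) sequentially"
    using T T0 by (intro tendsto_imp_filterlim_at_right) auto
  have ptw: "(\<lambda>n. heat (T n) w x) \<longlonglongrightarrow> w x"
    if "uniformly_continuous_on UNIV w" "\<And>y. \<bar>w y\<bar> \<le> C" for w C x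
    unfolding tendsto_iff
  proof safe
    fix e :: real assume e: "0 < e"
    have "eventually (\<lambda>\<tau>. \<forall>x. \<bar>heat \<tau> w x - w x\<bar> \<le> e / 2) (at_right 0)"
      using e by (intro heat_uniform_limit[OF that]) simp
    from eventually_compose_filterlim[OF this T_right]
    show "eventually (\<lambda>n. dist (heat (T n) w x) (w x) < e) sequentially"
      by eventually_elim (use e in \<open>auto simp: dist_real_def dest!: spec[of _ x]\<close>)
  qed
  define G where "G x = \<bar>g x\<bar> powr q" for x
  have G_c: "continuous_on UNIV G" unfolding G_def using g q
    by (intro continuous_on_powr' continuous_intros) auto
  have GB: "B \<le> norm x \<Longrightarrow> G x = 0" for x by (simp add: G_def B)
  note gs = uniformly_continuous_compact_support[of g B, OF g B]
  note Gs = uniformly_continuous_compact_support[of G B, OF G_c GB]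
  have G0: "0 \<le> G x" for x by (simp add: G_def)
  obtain C where C: "\<And>x. \<bar>g x\<bar> \<le> C" using gs by blast
  obtain D where D: "\<And>x. \<bar>G x\<bar> \<le> D" using Gs by blast
  have gm[measurable]: "g \<in> borel_measurable borel" and Gm[measurable]: "G \<in> borel_measurable borel"
    using g G_c by (auto intro: borel_measurable_continuous_onI)
  have Gi: "integrable lborel (\<lambda>x. \<bar>g x\<bar> powr q)" using Gs by (simp add: G_def[abs_def])
  have G_eq: "(\<lambda>y. \<bar>g y\<bar> powr q) = G" by (simp add: G_def fun_eq_iff)
  note hb = heat_powr_bound[OF gm C q Gi T, unfolded G_eq]
  have hG0: "0 \<le> heat (T n) G x" for n x by (rule heat_nonneg) (simp add: G_def)
  have "(\<lambda>n. \<integral>\<^sup>+x. norm (heat (T n) G x - G x) \<partial>lborel) \<longlonglongrightarrow> 0"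
  proof (rule Scheffe_lemma2)
    show "AE x in lborel. (\<lambda>n. heat (T n) G x) \<longlonglongrightarrow> G x"
      using ptw[OF Gs(1) D] by simp
    show "(\<integral>\<^sup>+x. norm (heat (T n) G x) \<partial>lborel) \<le> (\<integral>\<^sup>+x. norm (G x) \<partial>lborel)" for n
      using hb(2)[of n] hb(3)[of n] hG0[of n] Gs(3) G0 by (simp add: nn_integral_eq_integral)
  qed (use Gs in auto)
  moreover have "(\<integral>\<^sup>+x. norm (heat (T n) G x - G x) \<partial>lborel) = ennreal (\<integral>x. \<bar>heat (T n) G x - G x\<bar> \<partial>lborel)" for n
    using hb(2)[of n] Gs(3) by (subst nn_integral_eq_integral) auto
  ultimately have "(\<lambda>n. ennreal (\<integral>x. \<bar>heat (T n) G x - G x\<bar> \<partial>lborel)) \<longlonglongrightarrow> ennreal 0" by simp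
  then have L1: "(\<lambda>n. \<integral>x. \<bar>heat (T n) G x - G x\<bar> \<partial>lborel) \<longlonglongrightarrow> 0"
    by (subst (asm) tendsto_ennreal_iff) auto
  show "(\<lambda>n. \<integral>x. \<bar>heat (T n) g x - g x\<bar> powr q \<partial>lborel) \<longlonglongrightarrow> 0"
    by (rule dominated_powr_tendsto[OF _ _ _ hb(2) Gs(3) L1])
      (use q ptw[OF gs(1) C] hb(1) in \<open>auto simp: G_def[symmetric]\<close>)
qed simp

text \<open>Density: f = g + d with d small in L^q, and contractivity keeps the heat flow of d
  equally small at all times.\<close>

lemma heat_Lq_limit:
  assumes f[measurable]: "f \<in> borel_measurable borel" and fC: "\<And>y. \<bar>f y\<bar> \<le> C" and q: "1 \<le> q"
    and fi: "integrable lborel (\<lambda>x. \<bar>f x\<bar> powr q)"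
  shows "((\<lambda>\<tau>. \<integral>x. \<bar>heat \<tau> f x - f x\<bar> powr q \<partial>lborel) \<longlongrightarrow> 0) (at_right 0)"
  unfolding tendsto_iff
proof safe
  fix e :: real assume e: "0 < e"
  have q0: "0 \<le> q" using q by simp
  \<comment> \<open>Collects the factors of two nested triangle inequalities for q-th powers: 2^q
    for the g part and 2^q 2^q for each of the two d parts.\<close>
  define K where "K = 2 powr q + 2 powr q * (2 powr q * 2)"
  have K: "0 < K" by (simp add: K_def add_pos_pos)
  define e' where "e' = e / (2 * K)"
  have e': "0 < e'" using e K by (simp add: e'_def)
  obtain g B where g: "continuous_on UNIV g" "\<And>x. B \<le> norm x \<Longrightarrow> g x = 0"
    "(\<integral>x. \<bar>f x - g x\<bar> powr q \<partial>lborel) < e'"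
    using Lq_dense_compact_support[OF q f fi e'] by blast
  obtain D where D: "\<And>x. \<bar>g x\<bar> \<le> D" using uniformly_continuous_compact_support(2)[OF g(1,2)] by blast
  have [measurable]: "g \<in> borel_measurable borel" using g by (auto intro: borel_measurable_continuous_onI)
  have G_c: "continuous_on UNIV (\<lambda>x. \<bar>g x\<bar> powr q)" using g q
    by (intro continuous_on_powr' continuous_intros) auto
  have gi: "integrable lborel (\<lambda>x. \<bar>g x\<bar> powr q)"
    using uniformly_continuous_compact_support(3)[OF G_c, of B] g(2) by simp
  define d where "d x = f x - g x" for x
  have dm[measurable]: "d \<in> borel_measurable borel" unfolding d_def by measurable
  have dC: "\<bar>d x\<bar> \<le> C + D" for x using fC[of x] D[of x] by (simp add: d_def)
  have di: "integrable lborel (\<lambda>x. \<bar>d x\<bar> powr q)"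
    unfolding d_def by (rule integrable_powr_diff[OF q0 _ _ fi gi]) auto
  have "eventually (\<lambda>\<tau>. (\<integral>x. \<bar>heat \<tau> g x - g x\<bar> powr q \<partial>lborel) < e') (at_right 0)"
    by (rule order_tendstoD(2)[OF heat_Lq_limit_compact_support[OF q g(1), of B] e']) (rule g(2))
  moreover have "eventually (\<lambda>\<tau>::real. 0 < \<tau>) (at_right 0)" by (rule eventually_at_right_less)
  ultimately show "eventually (\<lambda>\<tau>. dist (\<integral>x. \<bar>heat \<tau> f x - f x\<bar> powr q \<partial>lborel) 0 < e) (at_right 0)"
  proof eventually_elim
    case (elim \<tau>)
    have hd: "heat \<tau> d x = heat \<tau> f x - heat \<tau> g x" for x
      unfolding d_def by (rule heat_diff[OF f fC _ D]) simp
    note hdb = heat_powr_bound(4,5)[OF dm dC q di elim(2)]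
    note hgi = heat_powr_bound(4)[OF _ D q gi elim(2), simplified]
    have i1: "integrable lborel (\<lambda>x. \<bar>heat \<tau> g x - g x\<bar> powr q)"
      by (rule integrable_powr_diff[OF q0 _ _ hgi gi]) auto
    have "(\<integral>x. \<bar>heat \<tau> f x - f x\<bar> powr q \<partial>lborel) \<le>
      (\<integral>x. 2 powr q * \<bar>heat \<tau> g x - g x\<bar> powr q + 2 powr q * (2 powr q * (\<bar>heat \<tau> d x\<bar> powr q + \<bar>d x\<bar> powr q)) \<partial>lborel)"
    proof (rule integral_mono')
      show "integrable lborel (\<lambda>x. 2 powr q * \<bar>heat \<tau> g x - g x\<bar> powr q + 2 powr q * (2 powr q * (\<bar>heat \<tau> d x\<bar> powr q + \<bar>d x\<bar> powr q)))"
        using i1 hdb di by simp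
      fix x
      have "heat \<tau> f x - f x = (heat \<tau> g x - g x) + (heat \<tau> d x + - d x)" by (simp add: hd d_def)
      then have "\<bar>heat \<tau> f x - f x\<bar> powr q \<le> 2 powr q * (\<bar>heat \<tau> g x - g x\<bar> powr q + \<bar>heat \<tau> d x + - d x\<bar> powr q)"
        by (simp only: abs_add_powr_le[OF q0])
      also have "\<dots> \<le> 2 powr q * (\<bar>heat \<tau> g x - g x\<bar> powr q + 2 powr q * (\<bar>heat \<tau> d x\<bar> powr q + \<bar>- d x\<bar> powr q))"
        by (intro mult_left_mono add_left_mono abs_add_powr_le q0) auto
      finally show "\<bar>heat \<tau> f x - f x\<bar> powr q \<le> 2 powr q * \<bar>heat \<tau> g x - g x\<bar> powr q + 2 powr q * (2 powr q * (\<bar>heat \<tau> d x\<bar> powr q + \<bar>d x\<bar> powr q))"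
        by (simp add: distrib_left)
    qed auto
    also have "\<dots> = 2 powr q * (\<integral>x. \<bar>heat \<tau> g x - g x\<bar> powr q \<partial>lborel) + 2 powr q * (2 powr q * ((\<integral>x. \<bar>heat \<tau> d x\<bar> powr q \<partial>lborel) + (\<integral>x. \<bar>d x\<bar> powr q \<partial>lborel)))"
      using i1 hdb di by simp
    also have "\<dots> \<le> 2 powr q * e' + 2 powr q * (2 powr q * (e' + e'))"
      using elim order_trans[OF hdb(2)] g(3)[folded d_def] by (intro add_mono mult_left_mono) auto
    also have "\<dots> = K * e'" by (simp add: K_def algebra_simps)
    also have "\<dots> < e" using K e by (simp add: e'_def)
    finally show ?case by (simp add: dist_real_def)
  qed
qed

text \<open>g is approximated in L^1 by a continuous w of compact support; for w, symmetry moves the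
  heat operator onto w, where it converges in L^1.\<close>

lemma heat_weak_limit:
  assumes f[measurable]: "f \<in> borel_measurable borel" and fC: "\<And>y. \<bar>f y\<bar> \<le> C"
    and g[measurable]: "g \<in> borel_measurable borel" and gi: "integrable lborel g"
  shows "((\<lambda>\<tau>. \<integral>x. (heat \<tau> f x - f x) * g x \<partial>lborel) \<longlongrightarrow> 0) (at_right 0)"
  unfolding tendsto_iff
proof safe
  fix e :: real assume e: "0 < e"
  have C: "0 \<le> C" using fC[of undefined] by linarith
  \<comment> \<open>The errors add up to 3 C e', which is below 3 e / 4; C + 1 covers C = 0.\<close>
  define e' where "e' = e / (4 * (C + 1))"
  have e': "0 < e'" using e C by (simp add: e'_def)
  obtain w B where w: "continuous_on UNIV w" "\<And>x. B \<le> norm x \<Longrightarrow> w x = 0"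
    "(\<integral>x. \<bar>g x - w x\<bar> powr 1 \<partial>lborel) < e'"
    using Lq_dense_compact_support[OF order_refl g _ e'] gi by auto
  have w3: "(\<integral>x. \<bar>g x - w x\<bar> \<partial>lborel) < e'" using w(3) by simp
  note ws = uniformly_continuous_compact_support[OF w(1,2)]
  obtain D where D: "\<And>x. \<bar>w x\<bar> \<le> D" using ws by blast
  have [measurable]: "w \<in> borel_measurable borel" using w by (auto intro: borel_measurable_continuous_onI)
  have wlim: "((\<lambda>\<tau>. \<integral>x. \<bar>heat \<tau> w x - w x\<bar> \<partial>lborel) \<longlongrightarrow> 0) (at_right 0)"
    using heat_Lq_limit_compact_support[OF order_refl w(1), of B] w(2) by simp
  have "eventually (\<lambda>\<tau>. (\<integral>x. \<bar>heat \<tau> w x - w x\<bar> \<partial>lborel) < e') (at_right 0)"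
    by (rule order_tendstoD(2)[OF wlim e'])
  moreover have "eventually (\<lambda>\<tau>::real. 0 < \<tau>) (at_right 0)" by (rule eventually_at_right_less)
  ultimately show "eventually (\<lambda>\<tau>. dist (\<integral>x. (heat \<tau> f x - f x) * g x \<partial>lborel) 0 < e) (at_right 0)"
  proof eventually_elim
    case (elim \<tau>)
    have hb: "\<bar>heat \<tau> f x\<bar> \<le> C" for x by (rule heat_bound[OF f fC])
    have bi: "integrable lborel (\<lambda>x. b x * v x)"
      if [measurable]: "b \<in> borel_measurable borel" and "\<And>x. \<bar>b x\<bar> \<le> M" and v: "integrable lborel v"
      for b v :: "'a \<Rightarrow> real" and M
    proof (rule Bochner_Integration.integrable_bound)
      have [measurable]: "v \<in> borel_measurable borel" using v by auto
      show "integrable lborel (\<lambda>x. M * v x)" using v by simp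
      show "AE x in lborel. norm (b x * v x) \<le> norm (M * v x)"
        using that(2) by (auto simp: abs_mult intro!: AE_I2 mult_right_mono intro: order_trans[OF _ abs_ge_self])
      show "(\<lambda>x. b x * v x) \<in> borel_measurable lborel" by measurable
    qed
    have d2: "\<bar>heat \<tau> f x - f x\<bar> \<le> 2 * C" for x using hb[of x] fC[of x] by simp
    have hw: "integrable lborel (heat \<tau> w)" by (rule heat_L1_integrable[OF _ D ws(3)]) simp
    have gw: "integrable lborel (\<lambda>x. g x - w x)" using gi ws(3) by simp
    note I1 = bi[OF _ d2 gw, simplified] and I2 = bi[OF _ fC Bochner_Integration.integrable_diff[OF hw ws(3)], simplified]
    have "(\<integral>x. (heat \<tau> f x - f x) * g x \<partial>lborel) = (\<integral>x. (heat \<tau> f x - f x) * (g x - w x) + (heat \<tau> f x * w x - f x * w x) \<partial>lborel)"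
      by (intro Bochner_Integration.integral_cong refl) (simp add: algebra_simps)
    also have "\<dots> = (\<integral>x. (heat \<tau> f x - f x) * (g x - w x) \<partial>lborel) + ((\<integral>x. heat \<tau> f x * w x \<partial>lborel) - (\<integral>x. f x * w x \<partial>lborel))"
      using I1 bi[OF _ hb ws(3)] bi[OF _ fC ws(3)] by simp
    also have "(\<integral>x. heat \<tau> f x * w x \<partial>lborel) = (\<integral>x. f x * heat \<tau> w x \<partial>lborel)"
      by (rule heat_symmetric[OF f fC _ ws(3)]) simp
    also have "(\<integral>x. f x * heat \<tau> w x \<partial>lborel) - (\<integral>x. f x * w x \<partial>lborel) = (\<integral>x. f x * (heat \<tau> w x - w x) \<partial>lborel)"
      using bi[OF _ fC hw] bi[OF _ fC ws(3)] by (simp add: right_diff_distrib)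
    also have "\<bar>(\<integral>x. (heat \<tau> f x - f x) * (g x - w x) \<partial>lborel) + \<dots>\<bar> \<le> 2 * C * e' + C * e'"
    proof -
      have bb: "\<bar>\<integral>x. b x * v x \<partial>lborel\<bar> \<le> M * E"
        if [measurable]: "b \<in> borel_measurable borel" and b: "\<And>x. \<bar>b x\<bar> \<le> M" and v: "integrable lborel v" and E: "(\<integral>x. \<bar>v x\<bar> \<partial>lborel) < E"
        for b v :: "'a \<Rightarrow> real" and M E
      proof -
        have M: "0 \<le> M" using b[of undefined] by linarith
        have "\<bar>\<integral>x. b x * v x \<partial>lborel\<bar> \<le> (\<integral>x. \<bar>b x * v x\<bar> \<partial>lborel)" by (rule integral_abs_bound)
        also have "\<dots> \<le> (\<integral>x. M * \<bar>v x\<bar> \<partial>lborel)"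
          using v b M by (intro integral_mono') (auto simp: abs_mult intro!: mult_right_mono)
        also have "\<dots> \<le> M * E" using E M by (auto intro!: mult_left_mono)
        finally show ?thesis .
      qed
      show ?thesis
        using bb[OF _ d2 gw w3] bb[OF _ fC Bochner_Integration.integrable_diff[OF hw ws(3)] elim(1)]
        by (intro order_trans[OF abs_triangle_ineq] add_mono) auto
    qed
    also have "\<dots> < e"
    proof -
      have "2 * C * e' + C * e' \<le> 3 * ((C + 1) * e')" using e' by (simp add: algebra_simps)
      also have "(C + 1) * e' = e / 4"
      proof -
        have "C + 1 \<noteq> 0" using C by linarith
        then show ?thesis by (simp add: e'_def divide_simps)
      qed
      finally show ?thesis using e by simp
    qed
    finally show ?case by (simp add: dist_real_def)
  qed
qed

end

section \<open>The mild formulation\<close>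

lemma exp_lipschitz:
  fixes x y :: real
  assumes "x \<le> B" "y \<le> B"
  shows "\<bar>exp x - exp y\<bar> \<le> exp B * \<bar>x - y\<bar>"
proof -
  have *: "exp b - exp a \<le> exp B * (b - a)" if "a \<le> b" "b \<le> B" for a b :: real
  proof -
    have "exp b * (1 - exp (a - b)) \<le> exp b * (b - a)"
    proof (rule mult_left_mono)
      show "1 - exp (a - b) \<le> b - a" using exp_ge_add_one_self[of "a - b"] by linarith
    qed simp
    also have "\<dots> \<le> exp B * (b - a)" using that by (intro mult_right_mono) auto
    finally show ?thesis by (simp add: right_diff_distrib flip: exp_add)
  qed
  show ?thesis
    using *[of x y] *[of y x] assms by (cases "x \<le> y") (auto simp: abs_if)
qed

text \<open>Convexity gives the lower bound 0 for the remainder and, with the roles of x and y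
  exchanged, the upper bound (x - y)(exp x - exp y), which is quadratic by the Lipschitz
  estimate.\<close>

lemma exp_taylor1:
  fixes x y :: real
  assumes "x \<le> B" "y \<le> B"
  shows "\<bar>exp x - exp y - (x - y) * exp y\<bar> \<le> exp B * (x - y)\<^sup>2"
proof -
  have "0 \<le> exp y * (exp (x - y) - 1 - (x - y))"
  proof (rule mult_nonneg_nonneg[OF exp_ge_zero])
    show "0 \<le> exp (x - y) - 1 - (x - y)" using exp_ge_add_one_self[of "x - y"] by linarith
  qed
  then have 1: "0 \<le> exp x - exp y - (x - y) * exp y"
    by (simp add: algebra_simps flip: exp_add)
  have "0 \<le> exp x * (exp (y - x) - 1 - (y - x))"
  proof (rule mult_nonneg_nonneg[OF exp_ge_zero])
    show "0 \<le> exp (y - x) - 1 - (y - x)" using exp_ge_add_one_self[of "y - x"] by linarith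
  qed
  then have "exp x - exp y - (x - y) * exp y \<le> (x - y) * (exp x - exp y)"
    by (simp add: algebra_simps flip: exp_add)
  also have "\<dots> \<le> \<bar>x - y\<bar> * \<bar>exp x - exp y\<bar>" by (simp flip: abs_mult)
  also have "\<dots> \<le> \<bar>x - y\<bar> * (exp B * \<bar>x - y\<bar>)"
    by (intro mult_left_mono exp_lipschitz assms) simp
  finally show ?thesis using 1 by (simp add: power2_eq_square mult_ac flip: abs_mult)
qed

text \<open>A function with quadratic increments along a continuous monotone clock is constant:
  bisecting at the midpoint of the clock halves the bound.\<close>

lemma quadratic_increments_constant:
  fixes D H :: "real \<Rightarrow> real"
  assumes H: "continuous_on {a..b} H" "\<And>s t. a \<le> s \<Longrightarrow> s \<le> t \<Longrightarrow> t \<le> b \<Longrightarrow> H s \<le> H t"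
    and D: "\<And>s t. a \<le> s \<Longrightarrow> s \<le> t \<Longrightarrow> t \<le> b \<Longrightarrow> \<bar>D t - D s\<bar> \<le> M * (H t - H s)\<^sup>2"
    and ab: "a \<le> b"
  shows "D b = D a"
proof -
  have *: "\<bar>D t - D s\<bar> \<le> M * (H t - H s)\<^sup>2 / 2 ^ n" if "a \<le> s" "s \<le> t" "t \<le> b" for s t n
    using that
  proof (induction n arbitrary: s t)
    case 0
    then show ?case using D by simp
  next
    case (Suc n)
    have "continuous_on {s..t} H" using H(1) Suc.prems by (auto intro: continuous_on_subset)
    then obtain m where m: "s \<le> m" "m \<le> t" "H m = (H s + H t) / 2"
      using IVT'[of H s "(H s + H t) / 2" t] H(2)[of s t] Suc.prems by auto
    have "\<bar>D t - D s\<bar> \<le> \<bar>D t - D m\<bar> + \<bar>D m - D s\<bar>" by simp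
    also have "\<dots> \<le> M * (H t - H m)\<^sup>2 / 2 ^ n + M * (H m - H s)\<^sup>2 / 2 ^ n"
      using m Suc.prems by (intro add_mono Suc.IH) auto
    also have "\<dots> = M * (H t - H s)\<^sup>2 / 2 ^ Suc n"
      unfolding m(3) by (simp add: field_simps power2_eq_square)
    finally show ?case .
  qed
  have "(\<lambda>n. M * (H b - H a)\<^sup>2 / 2 ^ n) \<longlonglongrightarrow> 0" by real_asymp
  then have "\<bar>D b - D a\<bar> \<le> 0"
    by (rule LIMSEQ_le_const) (use *[of a b] ab in auto)
  then show ?thesis by simp
qed

text \<open>The clock enters through continuity and strict monotonicity: the elapsed time c t - c s
  is positive for s < t, so the semigroup law applies between any two times.\<close>

locale mild_problem = convolution_semigroup k
  for k :: "real \<Rightarrow> 'a::euclidean_space \<Rightarrow> real" +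
  fixes h c :: "real \<Rightarrow> real"
  assumes h_measurable [measurable]: "h \<in> borel_measurable borel"
    and h_nonneg: "0 \<le> h s"
    and h_integrable: "integrable lborel (\<lambda>s. indicator {0<..<b} s * h s)"
    and c_measurable [measurable]: "c \<in> borel_measurable borel"
    and c_zero: "c 0 = 0"
    and c_strict_mono: "0 \<le> s \<Longrightarrow> s < t \<Longrightarrow> c s < c t"
    and c_continuous: "continuous_on {0..} c"
begin

section \<open>The primitive of \<open>h\<close> and its exponentials\<close>

definition H :: "real \<Rightarrow> real" where
  "H t = (\<integral>s. indicator {0<..<t} s * h s \<partial>lborel)"

lemma H_nonneg: "0 \<le> H t"
  unfolding H_def by (auto intro!: Bochner_Integration.integral_nonneg simp: h_nonneg)

lemma H_nonpos: "t \<le> 0 \<Longrightarrow> H t = 0"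
  by (simp add: H_def)

lemma h_integrable_interval:
  assumes "0 \<le> a"
  shows "integrable lborel (\<lambda>s. indicator {a<..<b} s * h s)"
  by (rule Bochner_Integration.integrable_bound[OF h_integrable[of b]])
    (use assms in \<open>auto simp: indicator_def intro!: AE_I2\<close>)

lemma H_diff:
  assumes "0 \<le> s" "s \<le> t"
  shows "H t - H s = (\<integral>r. indicator {s<..<t} r * h r \<partial>lborel)"
proof -
  have "H t = (\<integral>r. indicator {0<..<s} r * h r + indicator {s<..<t} r * h r \<partial>lborel)"
    unfolding H_def
  proof (rule integral_cong_AE)
    have "AE r in lborel. r \<noteq> s" by (rule AE_lborel_singleton)
    then show "AE r in lborel. indicator {0<..<t} r * h r = indicator {0<..<s} r * h r + indicator {s<..<t} r * h r"
      by eventually_elim (use assms in \<open>auto simp: indicator_def\<close>)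
  qed measurable
  then show ?thesis using h_integrable[of s] h_integrable_interval[OF assms(1), of t] by (simp add: H_def)
qed

lemma H_mono: "s \<le> t \<Longrightarrow> H s \<le> H t"
  unfolding H_def
  by (rule integral_mono[OF h_integrable h_integrable]) (auto simp: indicator_def h_nonneg)

lemma H_continuous: "continuous_on UNIV H"
  unfolding continuous_on_eq_continuous_at[OF open_UNIV] continuous_at_sequentially
proof safe
  fix t and X :: "nat \<Rightarrow> real" assume X: "X \<longlonglongrightarrow> t"
  obtain B where B: "\<And>n. \<bar>X n\<bar> \<le> B"
    using convergent_imp_Bseq[of X] X by (auto simp: convergent_def Bseq_def)
  show "(H \<circ> X) \<longlonglongrightarrow> H t"
    unfolding H_def comp_def
  proof (rule integral_dominated_convergence[OF _ _ h_integrable[of "B + 1"]])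
    have "AE r in lborel. r \<noteq> t" by (rule AE_lborel_singleton)
    then show "AE s in lborel. (\<lambda>n. indicator {0<..<X n} s * h s) \<longlonglongrightarrow> indicator {0<..<t} s * h s"
    proof eventually_elim
      case (elim s)
      consider "s < t" | "t < s" using elim by linarith
      then have "eventually (\<lambda>n. (s < X n) = (s < t)) sequentially"
      proof cases
        case 1
        from order_tendstoD(1)[OF X 1] show ?thesis by eventually_elim (use 1 in auto)
      next
        case 2
        from order_tendstoD(2)[OF X 2] show ?thesis by eventually_elim (use 2 in auto)
      qed
      then have "eventually (\<lambda>n. indicator {0<..<t} s * h s = indicator {0<..<X n} s * h s) sequentially"
        by eventually_elim (auto simp: indicator_def)
      then show ?case by (rule Lim_transform_eventually[OF tendsto_const])
    qed
    show "AE s in lborel. norm (indicator {0<..<X n} s * h s) \<le> indicator {0<..<B + 1} s * h s" for n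
      using B[of n] by (auto simp: indicator_def h_nonneg intro!: AE_I2)
  qed measurable
qed

lemma H_measurable [measurable]: "H \<in> borel_measurable borel"
  using H_continuous by (rule borel_measurable_continuous_onI)

lemma h_weight_integrable:
  assumes a: "0 \<le> a" and [measurable]: "m \<in> borel_measurable borel"
    and m: "\<And>s. a < s \<Longrightarrow> s < b \<Longrightarrow> \<bar>m s\<bar> \<le> C"
  shows "integrable lborel (\<lambda>s. indicator {a<..<b} s * (h s * m s))"
proof (rule Bochner_Integration.integrable_bound)
  show "integrable lborel (\<lambda>s. C * (indicator {a<..<b} s * h s))"
    using h_integrable_interval[OF a] by simp
  have "indicator {a<..<b} s * (h s * \<bar>m s\<bar>) \<le> \<bar>C\<bar> * (indicator {a<..<b} s * h s)" for s
  proof (cases "s \<in> {a<..<b}")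
    case True
    then have "h s * \<bar>m s\<bar> \<le> h s * \<bar>C\<bar>"
      using m[of s] by (intro mult_left_mono h_nonneg) auto
    then show ?thesis using True by (simp add: mult_ac)
  qed simp
  then show "AE s in lborel. norm (indicator {a<..<b} s * (h s * m s)) \<le> norm (C * (indicator {a<..<b} s * h s))"
    by (auto simp: abs_mult h_nonneg intro!: AE_I2)
qed measurable

lemma exp_H_le: "s \<le> b \<Longrightarrow> x * H s \<le> \<bar>x\<bar> * H b"
  using mult_mono[of x "\<bar>x\<bar>" "H s" "H b"] H_mono[of s b] H_nonneg[of s] by simp

lemma exp_H_integrable:
  assumes "0 \<le> a"
  shows "integrable lborel (\<lambda>s. indicator {a<..<b} s * (h s * exp (x * H s)))"
  by (rule h_weight_integrable[OF assms, where C = "exp (\<bar>x\<bar> * H b)"]) (auto intro!: exp_H_le)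

text \<open>The chain rule for exp(x H) when the density \<open>h\<close> is only integrable: the
  defect between the two sides has increments quadratic in those of H and is therefore
  constant.\<close>

lemma exp_H_integral:
  assumes a: "0 \<le> a" and ab: "a \<le> b" and x: "x \<noteq> 0"
  shows "(\<integral>s. indicator {a<..<b} s * (h s * exp (x * H s)) \<partial>lborel) = (exp (x * H b) - exp (x * H a)) / x"
proof -
  define g where "g t = (\<integral>s. indicator {a<..<t} s * (h s * exp (x * H s)) \<partial>lborel)" for t
  define B where "B = \<bar>x\<bar> * H b"
  define D where "D t = x * g t - exp (x * H t)" for t
  have g_diff: "g t - g s = (\<integral>r. indicator {s<..<t} r * (h r * exp (x * H r)) \<partial>lborel)"
    if "a \<le> s" "s \<le> t" for s t
  proof -
    have "g t = (\<integral>r. indicator {a<..<s} r * (h r * exp (x * H r)) + indicator {s<..<t} r * (h r * exp (x * H r)) \<partial>lborel)"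
      unfolding g_def
    proof (rule integral_cong_AE)
      have "AE r in lborel. r \<noteq> s" by (rule AE_lborel_singleton)
      then show "AE r in lborel. indicator {a<..<t} r * (h r * exp (x * H r)) =
          indicator {a<..<s} r * (h r * exp (x * H r)) + indicator {s<..<t} r * (h r * exp (x * H r))"
        by eventually_elim (use that in \<open>auto simp: indicator_def\<close>)
    qed measurable
    then show ?thesis using that a by (simp add: g_def exp_H_integrable)
  qed
  have le: "x * H r \<le> B" if "r \<le> b" for r using exp_H_le[OF that] by (simp add: B_def)
  have "D b = D a"
  \<comment> \<open>One half of M comes from freezing exp(x H) at the left end of the integral, the
    other from the Taylor remainder of exp.\<close>
  proof (rule quadratic_increments_constant[where H = H and M = "2 * x\<^sup>2 * exp B", OF _ _ _ ab])
    show "continuous_on {a..b} H" using H_continuous continuous_on_subset by blast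
    fix s t assume st: "a \<le> s" "s \<le> t" "t \<le> b"
    show "H s \<le> H t" using st by (intro H_mono)
    have s0: "0 \<le> s" using a st by simp
    have i1: "integrable lborel (\<lambda>r. indicator {s<..<t} r * (h r * (exp (x * H r) - exp (x * H s))))"
      using exp_H_integrable[OF s0, of t x] h_integrable_interval[OF s0, of t]
      by (simp add: right_diff_distrib mult.assoc[symmetric])
    have eq: "g t - g s - (H t - H s) * exp (x * H s) = (\<integral>r. indicator {s<..<t} r * (h r * (exp (x * H r) - exp (x * H s))) \<partial>lborel)"
      unfolding g_diff[OF st(1,2)] H_diff[OF s0 st(2)]
      using exp_H_integrable[OF s0, of t x] h_integrable_interval[OF s0, of t]
      by (simp add: right_diff_distrib mult.assoc[symmetric])
    have "\<bar>g t - g s - (H t - H s) * exp (x * H s)\<bar> \<le> (\<integral>r. \<bar>indicator {s<..<t} r * (h r * (exp (x * H r) - exp (x * H s)))\<bar> \<partial>lborel)"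
      unfolding eq by (rule integral_abs_bound)
    also have "\<dots> \<le> (\<integral>r. (exp B * \<bar>x\<bar> * (H t - H s)) * (indicator {s<..<t} r * h r) \<partial>lborel)"
    proof (rule integral_mono)
      show "integrable lborel (\<lambda>r. \<bar>indicator {s<..<t} r * (h r * (exp (x * H r) - exp (x * H s)))\<bar>)"
        using i1 by simp
      show "integrable lborel (\<lambda>r. (exp B * \<bar>x\<bar> * (H t - H s)) * (indicator {s<..<t} r * h r))"
        using h_integrable_interval[OF s0] by simp
      fix r
      show "\<bar>indicator {s<..<t} r * (h r * (exp (x * H r) - exp (x * H s)))\<bar> \<le> (exp B * \<bar>x\<bar> * (H t - H s)) * (indicator {s<..<t} r * h r)"
      proof (cases "r \<in> {s<..<t}")
        case True
        have "\<bar>exp (x * H r) - exp (x * H s)\<bar> \<le> exp B * \<bar>x * H r - x * H s\<bar>"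
          using True st by (intro exp_lipschitz le) auto
        also have "\<bar>x * H r - x * H s\<bar> = \<bar>x\<bar> * (H r - H s)"
          using True H_mono[of s r] by (simp add: abs_mult flip: right_diff_distrib)
        also have "exp B * (\<bar>x\<bar> * (H r - H s)) \<le> exp B * (\<bar>x\<bar> * (H t - H s))"
          using True H_mono[of r t] by (intro mult_left_mono) auto
        finally have "h r * \<bar>exp (x * H r) - exp (x * H s)\<bar> \<le> h r * (exp B * (\<bar>x\<bar> * (H t - H s)))"
          by (intro mult_left_mono h_nonneg)
        then show ?thesis using True by (simp add: abs_mult h_nonneg mult_ac)
      qed simp
    qed
    also have "\<dots> = exp B * \<bar>x\<bar> * (H t - H s)\<^sup>2"
      by (simp add: H_diff[OF s0 st(2)] power2_eq_square)
    finally have 1: "\<bar>g t - g s - (H t - H s) * exp (x * H s)\<bar> \<le> exp B * \<bar>x\<bar> * (H t - H s)\<^sup>2" .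
    have 2: "\<bar>exp (x * H t) - exp (x * H s) - (x * H t - x * H s) * exp (x * H s)\<bar> \<le> exp B * (x * H t - x * H s)\<^sup>2"
      using st by (intro exp_taylor1 le) auto
    have "D t - D s = x * (g t - g s - (H t - H s) * exp (x * H s)) - (exp (x * H t) - exp (x * H s) - (x * H t - x * H s) * exp (x * H s))"
      by (simp add: D_def algebra_simps)
    then have "\<bar>D t - D s\<bar> \<le> \<bar>x\<bar> * \<bar>g t - g s - (H t - H s) * exp (x * H s)\<bar> + \<bar>exp (x * H t) - exp (x * H s) - (x * H t - x * H s) * exp (x * H s)\<bar>"
      by (simp only: abs_mult[symmetric] abs_triangle_ineq4)
    also have "\<dots> \<le> \<bar>x\<bar> * (exp B * \<bar>x\<bar> * (H t - H s)\<^sup>2) + exp B * (x * H t - x * H s)\<^sup>2"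
      by (intro add_mono mult_left_mono 1 2) auto
    also have "\<dots> = 2 * x\<^sup>2 * exp B * (H t - H s)\<^sup>2"
      by (simp add: power2_eq_square algebra_simps)
    finally show "\<bar>D t - D s\<bar> \<le> 2 * x\<^sup>2 * exp B * (H t - H s)\<^sup>2" .
  qed
  then have "x * g b = exp (x * H b) - exp (x * H a)" by (simp add: D_def g_def)
  then show ?thesis using x by (simp add: g_def field_simps)
qed

text \<open>The initial value is written out separately because \<open>heat\<close> at time 0 is
  zero and not the identity.\<close>

definition free :: "('a \<Rightarrow> real) \<Rightarrow> real \<Rightarrow> 'a \<Rightarrow> real" where
  "free f t x = (if t \<le> 0 then f x else heat (c t) f x)"

definition duhamel :: "(real \<Rightarrow> 'a \<Rightarrow> real) \<Rightarrow> real \<Rightarrow> 'a \<Rightarrow> real" where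
  "duhamel w t x = (\<integral>s. indicator {0<..<t} s * (h s * heat (c t - c s) (w s) x) \<partial>lborel)"

lemma c_pos: "0 < t \<Longrightarrow> 0 < c t"
  using c_strict_mono[of 0 t] c_zero by simp

lemma free_measurable_pair [measurable]:
  assumes [measurable]: "f \<in> borel_measurable borel"
  shows "(\<lambda>(t, x). free f t x) \<in> borel_measurable (borel \<Otimes>\<^sub>M borel)"
proof -
  have [measurable]: "(\<lambda>(t, x). heat (c t) f x) \<in> borel_measurable (borel \<Otimes>\<^sub>M borel)"
    by (rule heat_measurable_pair) measurable
  show ?thesis unfolding free_def by measurable
qed

lemma pair_measurable_section:
  assumes "(\<lambda>(s, y). w s y) \<in> borel_measurable (borel \<Otimes>\<^sub>M (borel :: 'a measure))"
  shows "w (s :: real) \<in> borel_measurable borel"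
  using measurable_compose[OF measurable_Pair1' assms, of s] by simp

lemma heat_shift_measurable:
  assumes [measurable]: "(\<lambda>(s, y). w s y) \<in> borel_measurable (borel \<Otimes>\<^sub>M borel)"
  shows "(\<lambda>s. heat (c t - c s) (w s) x) \<in> borel_measurable borel"
proof -
  have "(\<lambda>(s, x). heat (c t - c s) (w s) x) \<in> borel_measurable (borel \<Otimes>\<^sub>M borel)"
    by (rule heat_measurable_pair) measurable
  from measurable_compose[OF measurable_Pair2' this, of x] show ?thesis by simp
qed

lemma duhamel_measurable_pair:
  assumes [measurable]: "(\<lambda>(s, y). w s y) \<in> borel_measurable (borel \<Otimes>\<^sub>M borel)"
  shows "(\<lambda>(t, x). duhamel w t x) \<in> borel_measurable (borel \<Otimes>\<^sub>M borel)"
proof -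
  have A: "(\<lambda>p. heat (c (fst (fst p)) - c (snd (fst p))) (w (snd (fst p))) (snd p)) \<in> borel_measurable ((borel \<Otimes>\<^sub>M borel) \<Otimes>\<^sub>M borel)"
    using heat_measurable_pair[of "\<lambda>(t, s). c t - c s" "borel \<Otimes>\<^sub>M borel" "\<lambda>(t, s). w s"]
    by (simp add: case_prod_unfold)
  \<comment> \<open>Regroups ((t, x), s) as ((t, s), x), since the heat operator is jointly
    measurable in a parameter, here (t, s), and the point x.\<close>
  have B: "(\<lambda>p::(real \<times> 'a) \<times> real. ((fst (fst p), snd p), snd (fst p))) \<in>
      (borel \<Otimes>\<^sub>M borel) \<Otimes>\<^sub>M borel \<rightarrow>\<^sub>M (borel \<Otimes>\<^sub>M borel) \<Otimes>\<^sub>M borel"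
    by measurable
  have 1: "(\<lambda>p. heat (c (fst (fst p)) - c (snd p)) (w (snd p)) (snd (fst p))) \<in> borel_measurable ((borel \<Otimes>\<^sub>M borel) \<Otimes>\<^sub>M borel)"
    using measurable_compose[OF B A] by (simp only: fst_conv snd_conv)
  have 2: "(\<lambda>p::(real \<times> 'a) \<times> real. indicator {0<..<fst (fst p)} (snd p) :: real) \<in> borel_measurable ((borel \<Otimes>\<^sub>M borel) \<Otimes>\<^sub>M borel)"
    unfolding indicator_def greaterThanLessThan_iff by measurable
  have 3: "(\<lambda>p::(real \<times> 'a) \<times> real. h (snd p)) \<in> borel_measurable ((borel \<Otimes>\<^sub>M borel) \<Otimes>\<^sub>M borel)"
    by measurable
  have "(\<lambda>(z, s). indicator {0<..<fst z} s * (h s * heat (c (fst z) - c s) (w s) (snd z)))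
    \<in> borel_measurable ((borel \<Otimes>\<^sub>M borel) \<Otimes>\<^sub>M (borel :: real measure))"
    using borel_measurable_times[OF 2 borel_measurable_times[OF 3 1]] by (simp add: case_prod_unfold)
  then have "(\<lambda>(z, s). indicator {0<..<fst z} s * (h s * heat (c (fst z) - c s) (w s) (snd z)))
    \<in> borel_measurable ((borel \<Otimes>\<^sub>M borel) \<Otimes>\<^sub>M (lborel :: real measure))"
    by (simp cong: measurable_cong_sets sets_pair_measure_cong)
  from lborel.borel_measurable_lebesgue_integral[OF this] show ?thesis
    by (simp add: duhamel_def case_prod_unfold)
qed

lemma duhamel_integrable:
  assumes w: "(\<lambda>(s, y). w s y) \<in> borel_measurable (borel \<Otimes>\<^sub>M borel)"
    and C: "\<And>s y. 0 < s \<Longrightarrow> s < t \<Longrightarrow> \<bar>w s y\<bar> \<le> C"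
  shows "integrable lborel (\<lambda>s. indicator {0<..<t} s * (h s * heat (c t - c s) (w s) x))"
  by (rule h_weight_integrable[OF order_refl heat_shift_measurable[OF w], where C = C])
    (auto intro!: heat_bound C pair_measurable_section[OF w])

lemma duhamel_mono:
  assumes w: "(\<lambda>(s, y). w s y) \<in> borel_measurable (borel \<Otimes>\<^sub>M borel)" "\<And>s y. 0 < s \<Longrightarrow> s < t \<Longrightarrow> \<bar>w s y\<bar> \<le> C"
    and v: "(\<lambda>(s, y). v s y) \<in> borel_measurable (borel \<Otimes>\<^sub>M borel)" "\<And>s y. 0 < s \<Longrightarrow> s < t \<Longrightarrow> \<bar>v s y\<bar> \<le> D"
    and le: "\<And>s y. 0 < s \<Longrightarrow> s < t \<Longrightarrow> w s y \<le> v s y"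
  shows "duhamel w t x \<le> duhamel v t x"
  unfolding duhamel_def
proof (rule integral_mono[OF duhamel_integrable[OF w] duhamel_integrable[OF v]])
  fix s
  show "indicator {0<..<t} s * (h s * heat (c t - c s) (w s) x) \<le> indicator {0<..<t} s * (h s * heat (c t - c s) (v s) x)"
  proof (cases "s \<in> {0<..<t}")
    case True
    then have "heat (c t - c s) (w s) x \<le> heat (c t - c s) (v s) x"
      by (intro heat_mono[OF _ w(2) _ v(2)] le pair_measurable_section[OF w(1)] pair_measurable_section[OF v(1)]) auto
    then show ?thesis by (intro mult_left_mono h_nonneg) auto
  qed simp
qed auto

lemma duhamel_diff:
  assumes w: "(\<lambda>(s, y). w s y) \<in> borel_measurable (borel \<Otimes>\<^sub>M borel)" "\<And>s y. 0 < s \<Longrightarrow> s < t \<Longrightarrow> \<bar>w s y\<bar> \<le> C"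
    and v: "(\<lambda>(s, y). v s y) \<in> borel_measurable (borel \<Otimes>\<^sub>M borel)" "\<And>s y. 0 < s \<Longrightarrow> s < t \<Longrightarrow> \<bar>v s y\<bar> \<le> D"
  shows "duhamel (\<lambda>s y. w s y - v s y) t x = duhamel w t x - duhamel v t x"
proof -
  have "indicator {0<..<t} s * (h s * heat (c t - c s) (\<lambda>y. w s y - v s y) x) =
    indicator {0<..<t} s * (h s * heat (c t - c s) (w s) x) - indicator {0<..<t} s * (h s * heat (c t - c s) (v s) x)" for s
  proof (cases "s \<in> {0<..<t}")
    case True
    then have "heat (c t - c s) (\<lambda>y. w s y - v s y) x = heat (c t - c s) (w s) x - heat (c t - c s) (v s) x"
      by (intro heat_diff[OF _ w(2) _ v(2)] pair_measurable_section[OF w(1)] pair_measurable_section[OF v(1)]) auto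
    then show ?thesis by (simp add: right_diff_distrib)
  qed simp
  then show ?thesis
    unfolding duhamel_def using duhamel_integrable[OF w, where t = t] duhamel_integrable[OF v, where t = t] by simp
qed

lemma duhamel_cmult: "duhamel (\<lambda>s y. a * w s y) t x = a * duhamel w t x"
proof -
  have "indicator {0<..<t} s * (h s * heat (c t - c s) (\<lambda>y. a * w s y) x) = a * (indicator {0<..<t} s * (h s * heat (c t - c s) (w s) x))" for s
    by (simp add: heat_cmult)
  then show ?thesis unfolding duhamel_def by (simp only: integral_mult_right_zero)
qed

lemma heat_free:
  assumes "f \<in> borel_measurable borel" "\<And>y. \<bar>f y\<bar> \<le> C" "0 < s" "s < t"
  shows "heat (c t - c s) (free f s) x = free f t x"
proof -
  have "free f s = heat (c s) f" using assms by (simp add: free_def fun_eq_iff)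
  then show ?thesis
    using heat_heat[of "c t - c s" "c s" f C x] c_pos[of s] c_strict_mono[of s t] assms by (simp add: free_def)
qed

text \<open>The semigroup law under the time integral: propagating a source from r to s and then to
  t is propagating it from r to t. This links the two mild formulations.\<close>

lemma heat_duhamel:
  assumes w: "(\<lambda>(s, y). w s y) \<in> borel_measurable (borel \<Otimes>\<^sub>M borel)"
    and C: "\<And>r y. 0 < r \<Longrightarrow> r < s \<Longrightarrow> \<bar>w r y\<bar> \<le> C" and st: "0 < s" "s < t"
  shows "heat (c t - c s) (duhamel w s) x = (\<integral>r. indicator {0<..<s} r * (h r * heat (c t - c r) (w r) x) \<partial>lborel)"
proof -
  have [measurable]: "(\<lambda>(r, x). heat (c s - c r) (w r) x) \<in> borel_measurable (borel \<Otimes>\<^sub>M borel)"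
    by (rule heat_measurable_pair) (use w in measurable)
  have "heat (c t - c s) (duhamel w s) x = heat (c t - c s) (\<lambda>y. \<integral>r. indicator {0<..<s} r * (h r * heat (c s - c r) (w r) y) \<partial>lborel) x"
    by (simp add: duhamel_def[abs_def])
  also have "\<dots> = (\<integral>r. heat (c t - c s) (\<lambda>y. indicator {0<..<s} r * (h r * heat (c s - c r) (w r) y)) x \<partial>lborel)"
  proof (rule heat_time_integral)
    show "integrable lborel (\<lambda>r. (indicator {0<..<s} r * h r) * C)" using h_integrable by simp
    show "\<bar>indicator {0<..<s} r * (h r * heat (c s - c r) (w r) y)\<bar> \<le> (indicator {0<..<s} r * h r) * C" for r y
    proof (cases "r \<in> {0<..<s}")
      case True
      then have "\<bar>heat (c s - c r) (w r) y\<bar> \<le> C"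
        by (intro heat_bound C pair_measurable_section[OF w]) auto
      then show ?thesis using True by (simp add: abs_mult h_nonneg mult_left_mono)
    qed simp
  qed measurable
  also have "\<dots> = (\<integral>r. indicator {0<..<s} r * (h r * heat (c t - c r) (w r) x) \<partial>lborel)"
  proof (intro Bochner_Integration.integral_cong refl)
    fix r
    show "heat (c t - c s) (\<lambda>y. indicator {0<..<s} r * (h r * heat (c s - c r) (w r) y)) x = indicator {0<..<s} r * (h r * heat (c t - c r) (w r) x)"
    proof (cases "r \<in> {0<..<s}")
      case True
      then have "heat (c t - c s) (heat (c s - c r) (w r)) x = heat (c t - c r) (w r) x"
        using st heat_heat[OF _ _ pair_measurable_section[OF w] C, of "c t - c s" "c s - c r" r x] c_strict_mono[of r s] c_strict_mono[of s t] by simp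
      then show ?thesis using True by (simp add: heat_cmult)
    qed (simp add: heat_const)
  qed
  finally show ?thesis .
qed

lemma heat_tendsto:
  assumes "\<And>n. f n \<in> borel_measurable borel" "\<And>n y. \<bar>f n y\<bar> \<le> C" "\<And>y. (\<lambda>n. f n y) \<longlonglongrightarrow> g y"
  shows "(\<lambda>n. heat \<tau> (f n) x) \<longlonglongrightarrow> heat \<tau> g x"
proof -
  have [measurable]: "g \<in> borel_measurable borel" using borel_measurable_LIMSEQ_real[OF assms(3,1)] .
  note [measurable] = assms(1)
  show ?thesis unfolding heat_def
  proof (rule integral_dominated_convergence[where w = "\<lambda>y. k \<tau> (x - y) * C"])
    show "integrable lborel (\<lambda>y. k \<tau> (x - y) * C)" using k_reflect_integrable by simp
    show "AE y in lborel. (\<lambda>n. k \<tau> (x - y) * f n y) \<longlonglongrightarrow> k \<tau> (x - y) * g y"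
      by (intro AE_I2 tendsto_intros assms)
    show "AE y in lborel. norm (k \<tau> (x - y) * f n y) \<le> k \<tau> (x - y) * C" for n
      using assms(2) by (auto simp: abs_mult k_nonneg intro!: mult_left_mono)
  qed measurable
qed

lemma duhamel_tendsto:
  assumes w: "\<And>n. (\<lambda>(s, y). w n s y) \<in> borel_measurable (borel \<Otimes>\<^sub>M borel)"
    and v: "(\<lambda>(s, y). v s y) \<in> borel_measurable (borel \<Otimes>\<^sub>M borel)"
    and C: "\<And>n s y. 0 < s \<Longrightarrow> s < t \<Longrightarrow> \<bar>w n s y\<bar> \<le> C"
    and lim: "\<And>s y. 0 < s \<Longrightarrow> s < t \<Longrightarrow> (\<lambda>n. w n s y) \<longlonglongrightarrow> v s y"
  shows "(\<lambda>n. duhamel (w n) t x) \<longlonglongrightarrow> duhamel v t x"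
  unfolding duhamel_def
proof (rule integral_dominated_convergence[where w = "\<lambda>s. (indicator {0<..<t} s * h s) * C"])
  note [measurable] = heat_shift_measurable[OF w] heat_shift_measurable[OF v]
  show "integrable lborel (\<lambda>s. (indicator {0<..<t} s * h s) * C)" using h_integrable by simp
  show "AE s in lborel. (\<lambda>n. indicator {0<..<t} s * (h s * heat (c t - c s) (w n s) x)) \<longlonglongrightarrow> indicator {0<..<t} s * (h s * heat (c t - c s) (v s) x)"
  proof (rule AE_I2)
    fix s
    show "(\<lambda>n. indicator {0<..<t} s * (h s * heat (c t - c s) (w n s) x)) \<longlonglongrightarrow> indicator {0<..<t} s * (h s * heat (c t - c s) (v s) x)"
    proof (cases "s \<in> {0<..<t}")
      case True
      then show ?thesis
        by (intro tendsto_intros heat_tendsto[where C = C] pair_measurable_section[OF w] C lim) auto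
    qed simp
  qed
  show "AE s in lborel. norm (indicator {0<..<t} s * (h s * heat (c t - c s) (w n s) x)) \<le> (indicator {0<..<t} s * h s) * C" for n
  proof (rule AE_I2)
    fix s
    show "norm (indicator {0<..<t} s * (h s * heat (c t - c s) (w n s) x)) \<le> (indicator {0<..<t} s * h s) * C"
    proof (cases "s \<in> {0<..<t}")
      case True
      then have "\<bar>heat (c t - c s) (w n s) x\<bar> \<le> C"
        by (intro heat_bound C pair_measurable_section[OF w]) auto
      then show ?thesis using True by (simp add: abs_mult h_nonneg mult_left_mono)
    qed simp
  qed
  show "(\<lambda>s. indicator {0<..<t} s * (h s * heat (c t - c s) (w n s) x)) \<in> borel_measurable lborel" for n by measurable
  show "(\<lambda>s. indicator {0<..<t} s * (h s * heat (c t - c s) (v s) x)) \<in> borel_measurable lborel" by measurable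
qed

end

section \<open>Monotone iteration\<close>

lemma signed_power_measurable [measurable]: "signed_power p \<in> borel_measurable borel"
  unfolding signed_power_def[abs_def] by measurable

lemma signed_power_minus: "signed_power p (- v) = - signed_power p v"
  by (simp add: signed_power_def)

lemma signed_power_zero [simp]: "signed_power p 0 = 0"
  by (simp add: signed_power_def)

lemma signed_power_nonneg: "0 \<le> v \<Longrightarrow> 0 \<le> signed_power p v"
  by (simp add: signed_power_def)

lemma signed_power_eq_powr: "0 \<le> v \<Longrightarrow> signed_power p v = v powr p"
  by (cases "v = 0") (simp_all add: signed_power_def powr_diff)

lemma signed_power_abs_le:
  assumes "1 \<le> p" "\<bar>v\<bar> \<le> R"
  shows "\<bar>signed_power p v\<bar> \<le> R powr (p - 1) * \<bar>v\<bar>"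
  using assms by (auto simp: signed_power_def abs_mult intro!: mult_right_mono powr_mono2)

lemma signed_power_bound:
  assumes "1 \<le> p" "\<bar>v\<bar> \<le> R"
  shows "\<bar>signed_power p v\<bar> \<le> R powr (p - 1) * R"
  by (rule order_trans[OF signed_power_abs_le mult_left_mono]) (use assms in auto)

text \<open>For nonnegative arguments the upper bound is the tangent-line inequality at b. Oddness
  carries both bounds to nonpositive arguments, and opposite signs are handled by splitting at
  0.\<close>

lemma signed_power_increment:
  assumes p: "1 < p" and ab: "a \<le> b" "\<bar>a\<bar> \<le> R" "\<bar>b\<bar> \<le> R"
  shows "signed_power p a \<le> signed_power p b"
    and "signed_power p b - signed_power p a \<le> p * R powr (p - 1) * (b - a)"
proof -
  have pos: "signed_power p a \<le> signed_power p b \<and> signed_power p b - signed_power p a \<le> p * R powr (p - 1) * (b - a)"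
    if "0 \<le> a" "a \<le> b" "b \<le> R" for a b
  proof
    show "signed_power p a \<le> signed_power p b"
      using that p by (simp add: signed_power_eq_powr powr_mono2)
    have "p * (a * b powr (p - 1)) \<le> a powr p + (p - 1) * b powr p"
      using young_powr[of p a b] p that by simp
    moreover have "b powr p = b powr (p - 1) * b" using that by (cases "b = 0") (simp_all add: powr_diff)
    ultimately have "b powr p - a powr p \<le> p * b powr (p - 1) * (b - a)"
      by (simp add: algebra_simps)
    also have "\<dots> \<le> p * R powr (p - 1) * (b - a)"
      using that p by (intro mult_right_mono mult_left_mono powr_mono2) auto
    finally show "signed_power p b - signed_power p a \<le> p * R powr (p - 1) * (b - a)"
      using that by (simp add: signed_power_eq_powr)
  qed
  consider "0 \<le> a" | "b \<le> 0" | "a \<le> 0" "0 \<le> b" using ab by linarith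
  then have "signed_power p a \<le> signed_power p b \<and> signed_power p b - signed_power p a \<le> p * R powr (p - 1) * (b - a)"
  proof cases
    case 1
    then show ?thesis using pos[of a b] ab by simp
  next
    case 2
    then show ?thesis using pos[of "- b" "- a"] ab by (simp add: signed_power_minus)
  next
    case 3
    then show ?thesis using pos[of 0 b] pos[of 0 "- a"] ab by (simp add: signed_power_minus algebra_simps)
  qed
  then show "signed_power p a \<le> signed_power p b"
    and "signed_power p b - signed_power p a \<le> p * R powr (p - 1) * (b - a)" by auto
qed

lemma signed_power_lipschitz:
  assumes p: "1 < p" and ab: "\<bar>a\<bar> \<le> R" "\<bar>b\<bar> \<le> R"
  shows "\<bar>signed_power p b - signed_power p a\<bar> \<le> p * R powr (p - 1) * \<bar>b - a\<bar>"
  using signed_power_increment[OF p, of a b R] signed_power_increment[OF p, of b a R] ab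
  by (cases "a \<le> b") (auto simp: abs_if)

section \<open>The order-preserving map and its fixed point\<close>

locale absorption = mild_problem k h c
  for k :: "real \<Rightarrow> 'a::euclidean_space \<Rightarrow> real" and h c :: "real \<Rightarrow> real" +
  fixes p R :: real and u0 :: "'a \<Rightarrow> real"
  assumes p_gt_1: "1 < p"
    and R_pos: "0 < R"
    and u0_measurable [measurable]: "u0 \<in> borel_measurable borel"
    and u0_bound: "\<bar>u0 y\<bar> \<le> R"
begin

text \<open>The Lipschitz constant of \<open>signed_power p\<close> on [-R, R] from
  \<open>signed_power_increment\<close>. It is positive because R > 0, and the exponential integrals
  divide by it.\<close>

definition \<kappa> :: real where "\<kappa> = p * R powr (p - 1)"

definition gain :: "real \<Rightarrow> real" where "gain v = \<kappa> * v - signed_power p v"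

text \<open>The Duhamel map of \<open>\<partial>\<^sub>t u + t\<^sup>\<beta>\<L>u + \<kappa> h u = h (\<kappa> u - |u|\<^sup>p\<^sup>-\<^sup>1 u)\<close>. On \<open>|v| \<le> R\<close> the
  right-hand side is nondecreasing in \<open>u\<close>, so the map is order preserving.\<close>

definition picard :: "(real \<Rightarrow> 'a \<Rightarrow> real) \<Rightarrow> real \<Rightarrow> 'a \<Rightarrow> real" where
  "picard w t x = exp (- \<kappa> * H t) * (free u0 t x + duhamel (\<lambda>s y. exp (\<kappa> * H s) * gain (w s y)) t x)"

text \<open>Evolution of the negative part of the data without reaction. As it never changes sign,
  the reaction could only push it up towards 0, so it is a subsolution; \<open>upper\<close> is its
  mirror image.\<close>

definition lower :: "real \<Rightarrow> 'a \<Rightarrow> real" where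
  "lower t x = - free (\<lambda>y. max 0 (- u0 y)) t x"

definition upper :: "real \<Rightarrow> 'a \<Rightarrow> real" where
  "upper t x = free (\<lambda>y. max 0 (u0 y)) t x"

lemma kappa_pos: "0 < \<kappa>"
  using p_gt_1 R_pos by (simp add: \<kappa>_def)

lemma gain_measurable [measurable]: "gain \<in> borel_measurable borel"
  unfolding gain_def[abs_def] by measurable

lemma gain_mono:
  assumes "a \<le> b" "\<bar>a\<bar> \<le> R" "\<bar>b\<bar> \<le> R"
  shows "gain a \<le> gain b"
  using signed_power_increment(2)[OF p_gt_1 assms] by (simp add: gain_def \<kappa>_def algebra_simps)

lemma gain_abs_le: "\<bar>v\<bar> \<le> R \<Longrightarrow> \<bar>gain v\<bar> \<le> \<kappa> * \<bar>v\<bar>"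
  using gain_mono[of 0 v] gain_mono[of v 0] R_pos kappa_pos signed_power_nonneg[of v p] signed_power_nonneg[of "- v" p]
  by (cases "0 \<le> v") (auto simp: gain_def signed_power_minus)

lemma gain_upper: "0 \<le> v \<Longrightarrow> gain v \<le> \<kappa> * v"
  by (simp add: gain_def signed_power_nonneg)

lemma gain_lower: "v \<le> 0 \<Longrightarrow> \<kappa> * v \<le> gain v"
  using signed_power_nonneg[of "- v" p] by (simp add: gain_def signed_power_minus)

lemma free_bound:
  assumes "f \<in> borel_measurable borel" "\<And>y. \<bar>f y\<bar> \<le> C"
  shows "\<bar>free f t x\<bar> \<le> C"
  using assms heat_bound[OF assms] by (simp add: free_def)

lemma free_nonneg: "(\<And>y. 0 \<le> f y) \<Longrightarrow> 0 \<le> free f t x"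
  by (simp add: free_def heat_nonneg)

lemma free_mono:
  assumes "f \<in> borel_measurable borel" "\<And>y. \<bar>f y\<bar> \<le> C" "g \<in> borel_measurable borel" "\<And>y. \<bar>g y\<bar> \<le> D"
    and "\<And>y. f y \<le> g y"
  shows "free f t x \<le> free g t x"
  using assms heat_mono[OF assms] by (simp add: free_def)

lemma pos_part: "\<bar>max 0 (u0 y)\<bar> \<le> R" and neg_part: "\<bar>max 0 (- u0 y)\<bar> \<le> R"
  using u0_bound[of y] by auto

lemma upper_bounds: "0 \<le> upper t x" "\<bar>upper t x\<bar> \<le> R"
  unfolding upper_def by (auto intro!: free_nonneg free_bound pos_part)

lemma lower_bounds: "lower t x \<le> 0" "\<bar>lower t x\<bar> \<le> R"
  unfolding lower_def abs_minus_cancel by (auto intro!: free_nonneg free_bound neg_part)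

lemma lower_le_free: "lower t x \<le> free u0 t x"
proof -
  have "free (\<lambda>y. - max 0 (- u0 y)) t x \<le> free u0 t x"
    by (rule free_mono[where C = R and D = R]) (use u0_bound neg_part in auto)
  then show ?thesis by (simp add: lower_def free_def heat_uminus split: if_splits)
qed

lemma free_le_upper: "free u0 t x \<le> upper t x"
  unfolding upper_def by (rule free_mono[where C = R and D = R]) (use u0_bound pos_part in auto)

lemma upper_measurable: "(\<lambda>(t, x). upper t x) \<in> borel_measurable (borel \<Otimes>\<^sub>M borel)"
  unfolding upper_def by measurable

lemma lower_measurable: "(\<lambda>(t, x). lower t x) \<in> borel_measurable (borel \<Otimes>\<^sub>M borel)"
  unfolding lower_def by measurable

lemma weight_le: "s < t \<Longrightarrow> exp (\<kappa> * H s) \<le> exp (\<kappa> * H t)"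
  using kappa_pos H_mono[of s t] by simp

lemma weighted_measurable:
  assumes [measurable]: "(\<lambda>(s, y). w s y) \<in> borel_measurable (borel \<Otimes>\<^sub>M borel)"
  shows "(\<lambda>(s, y). exp (\<kappa> * H s) * gain (w s y)) \<in> borel_measurable (borel \<Otimes>\<^sub>M borel)"
    and "(\<lambda>(s, y). exp (\<kappa> * H s) * (\<kappa> * w s y)) \<in> borel_measurable (borel \<Otimes>\<^sub>M borel)"
  by measurable

lemma weighted_bound:
  assumes "\<bar>g\<bar> \<le> \<kappa> * R" "s < t"
  shows "\<bar>exp (\<kappa> * H s) * g\<bar> \<le> exp (\<kappa> * H t) * (\<kappa> * R)"
  unfolding abs_mult abs_exp_cancel by (intro mult_mono weight_le assms) auto

lemma gain_bound: "\<bar>v\<bar> \<le> R \<Longrightarrow> \<bar>gain v\<bar> \<le> \<kappa> * R"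
  using gain_abs_le[of v] kappa_pos by (auto intro: order_trans mult_left_mono)

lemma linear_bound: "\<bar>v\<bar> \<le> R \<Longrightarrow> \<bar>\<kappa> * v\<bar> \<le> \<kappa> * R"
  using kappa_pos by (simp add: abs_mult)

lemma picard_measurable:
  assumes "(\<lambda>(s, y). w s y) \<in> borel_measurable (borel \<Otimes>\<^sub>M borel)"
  shows "(\<lambda>(t, x). picard w t x) \<in> borel_measurable (borel \<Otimes>\<^sub>M borel)"
proof -
  note [measurable] = duhamel_measurable_pair[OF weighted_measurable(1)[OF assms]]
  show ?thesis unfolding picard_def by measurable
qed

text \<open>A free evolution propagated from s to t does not depend on s, so only the scalar
  integral of \<kappa> h exp(\<kappa> H) remains. Hence damping and linear source cancel on free
  evolutions.\<close>

lemma duhamel_weighted_free: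
  assumes f: "f \<in> borel_measurable borel" "\<And>y. \<bar>f y\<bar> \<le> C"
  shows "duhamel (\<lambda>s y. exp (\<kappa> * H s) * (\<kappa> * free f s y)) t x = (exp (\<kappa> * H t) - 1) * free f t x"
proof (cases "0 \<le> t")
  case False
  then show ?thesis by (simp add: duhamel_def H_nonpos)
next
  case True
  have "indicator {0<..<t} s * (h s * heat (c t - c s) (\<lambda>y. exp (\<kappa> * H s) * (\<kappa> * free f s y)) x) =
    \<kappa> * free f t x * (indicator {0<..<t} s * (h s * exp (\<kappa> * H s)))" for s
  proof (cases "s \<in> {0<..<t}")
    case True
    then have "heat (c t - c s) (\<lambda>y. exp (\<kappa> * H s) * (\<kappa> * free f s y)) x = exp (\<kappa> * H s) * (\<kappa> * free f t x)"
      using heat_free[OF f, of s t x] by (simp add: heat_cmult)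
    then show ?thesis by simp
  qed simp
  then have "duhamel (\<lambda>s y. exp (\<kappa> * H s) * (\<kappa> * free f s y)) t x = \<kappa> * free f t x * (\<integral>s. indicator {0<..<t} s * (h s * exp (\<kappa> * H s)) \<partial>lborel)"
    unfolding duhamel_def by (simp only: integral_mult_right_zero)
  also have "\<dots> = (exp (\<kappa> * H t) - 1) * free f t x"
    using exp_H_integral[of 0 t \<kappa>] kappa_pos True by (simp add: H_nonpos)
  finally show ?thesis .
qed

text \<open>\<open>gain (w s y)\<close> is at most \<open>gain (upper s y)\<close>, hence at most
  \<kappa> times \<open>upper s y\<close>, and for that source the Duhamel integral is
  explicit.\<close>

lemma picard_le_upper:
  assumes w: "(\<lambda>(s, y). w s y) \<in> borel_measurable (borel \<Otimes>\<^sub>M borel)" "\<And>s y. \<bar>w s y\<bar> \<le> R"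
    and le: "\<And>s y. w s y \<le> upper s y"
  shows "picard w t x \<le> upper t x"
proof -
  have "duhamel (\<lambda>s y. exp (\<kappa> * H s) * gain (w s y)) t x \<le> duhamel (\<lambda>s y. exp (\<kappa> * H s) * (\<kappa> * upper s y)) t x"
  proof (rule duhamel_mono[OF weighted_measurable(1)[OF w(1)] weighted_bound weighted_measurable(2)[OF upper_measurable] weighted_bound])
    show "exp (\<kappa> * H s) * gain (w s y) \<le> exp (\<kappa> * H s) * (\<kappa> * upper s y)" for s y
      by (intro mult_left_mono order_trans[OF gain_mono[OF le w(2) upper_bounds(2)] gain_upper[OF upper_bounds(1)]]) auto
  qed (auto intro!: gain_bound w linear_bound upper_bounds)
  also have "\<dots> = (exp (\<kappa> * H t) - 1) * upper t x"
    unfolding upper_def by (rule duhamel_weighted_free[where C = R]) (use pos_part in auto)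
  finally have "picard w t x \<le> exp (- \<kappa> * H t) * (upper t x + (exp (\<kappa> * H t) - 1) * upper t x)"
    unfolding picard_def by (intro mult_left_mono add_mono free_le_upper) auto
  then show ?thesis by (simp add: algebra_simps exp_minus)
qed

lemma lower_le_picard:
  assumes w: "(\<lambda>(s, y). w s y) \<in> borel_measurable (borel \<Otimes>\<^sub>M borel)" "\<And>s y. \<bar>w s y\<bar> \<le> R"
    and le: "\<And>s y. lower s y \<le> w s y"
  shows "lower t x \<le> picard w t x"
proof -
  have "(exp (\<kappa> * H t) - 1) * lower t x = duhamel (\<lambda>s y. exp (\<kappa> * H s) * (\<kappa> * lower s y)) t x"
  proof -
    have "duhamel (\<lambda>s y. exp (\<kappa> * H s) * (\<kappa> * lower s y)) t x = - duhamel (\<lambda>s y. exp (\<kappa> * H s) * (\<kappa> * free (\<lambda>y. max 0 (- u0 y)) s y)) t x"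
      using duhamel_cmult[of "- 1" "\<lambda>s y. exp (\<kappa> * H s) * (\<kappa> * free (\<lambda>y. max 0 (- u0 y)) s y)" t x] by (simp add: lower_def)
    also have "\<dots> = - ((exp (\<kappa> * H t) - 1) * free (\<lambda>y. max 0 (- u0 y)) t x)"
      by (subst duhamel_weighted_free[where C = R]) (use neg_part in auto)
    finally show ?thesis by (simp add: lower_def)
  qed
  also have "duhamel (\<lambda>s y. exp (\<kappa> * H s) * (\<kappa> * lower s y)) t x \<le> duhamel (\<lambda>s y. exp (\<kappa> * H s) * gain (w s y)) t x"
  proof (rule duhamel_mono[OF weighted_measurable(2)[OF lower_measurable] weighted_bound weighted_measurable(1)[OF w(1)] weighted_bound])
    show "exp (\<kappa> * H s) * (\<kappa> * lower s y) \<le> exp (\<kappa> * H s) * gain (w s y)" for s y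
      by (intro mult_left_mono order_trans[OF gain_lower[OF lower_bounds(1)] gain_mono[OF le lower_bounds(2) w(2)]]) auto
  qed (auto intro!: gain_bound w linear_bound lower_bounds)
  finally have "exp (- \<kappa> * H t) * (lower t x + (exp (\<kappa> * H t) - 1) * lower t x) \<le> picard w t x"
    unfolding picard_def by (intro mult_left_mono add_mono lower_le_free) auto
  then show ?thesis by (simp add: algebra_simps exp_minus)
qed

lemma picard_mono:
  assumes w: "(\<lambda>(s, y). w s y) \<in> borel_measurable (borel \<Otimes>\<^sub>M borel)" "\<And>s y. \<bar>w s y\<bar> \<le> R"
    and v: "(\<lambda>(s, y). v s y) \<in> borel_measurable (borel \<Otimes>\<^sub>M borel)" "\<And>s y. \<bar>v s y\<bar> \<le> R"
    and le: "\<And>s y. w s y \<le> v s y"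
  shows "picard w t x \<le> picard v t x"
  unfolding picard_def
  by (intro mult_left_mono add_left_mono
      duhamel_mono[OF weighted_measurable(1)[OF w(1)] weighted_bound weighted_measurable(1)[OF v(1)] weighted_bound])
    (auto intro!: gain_bound w v gain_mono le)

text \<open>The iterates from \<open>lower\<close> increase at every point and stay below
  \<open>upper\<close>, so they converge everywhere, and dominated convergence passes to the limit
  in the map. Nothing requires a short time interval, so the fixed point is global.\<close>

lemma picard_fixed_point:
  "\<exists>u. (\<lambda>(s, y). u s y) \<in> borel_measurable (borel \<Otimes>\<^sub>M borel) \<and>
    (\<forall>t x. lower t x \<le> u t x \<and> u t x \<le> upper t x) \<and> (\<forall>t x. u t x = picard u t x)"
proof -
  define U where "U n = (picard ^^ n) lower" for n
  have U0: "U 0 = lower" and US: "U (Suc n) = picard (U n)" for n by (simp_all add: U_def)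
  have sandwich: "\<bar>v\<bar> \<le> R" if "lower t x \<le> v" "v \<le> upper t x" for t x v
    using that lower_bounds(2)[of t x] upper_bounds(2)[of t x] by linarith
  have U: "(\<lambda>(s, y). U n s y) \<in> borel_measurable (borel \<Otimes>\<^sub>M borel) \<and> (\<forall>s y. lower s y \<le> U n s y \<and> U n s y \<le> upper s y)" for n
  proof (induction n)
    case 0
    then show ?case using lower_measurable order_trans[OF lower_le_free free_le_upper] by (auto simp: U0)
  next
    case (Suc n)
    then show ?case unfolding US
      by (auto intro!: picard_measurable lower_le_picard picard_le_upper sandwich)
  qed
  have Um: "(\<lambda>(s, y). U n s y) \<in> borel_measurable (borel \<Otimes>\<^sub>M borel)"
    and Ul: "lower s y \<le> U n s y" and Uu: "U n s y \<le> upper s y" and Ub: "\<bar>U n s y\<bar> \<le> R" for n s y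
    using U[of n] by (auto intro: sandwich)
  have mono: "U n s y \<le> U (Suc n) s y" for n s y
  proof (induction n arbitrary: s y)
    case 0
    show ?case using Ul[of s y 1] by (simp add: U0)
  next
    case (Suc n)
    have "picard (U n) s y \<le> picard (U (Suc n)) s y" by (rule picard_mono[OF Um Ub Um Ub Suc])
    then show ?case by (simp only: US)
  qed
  define u where "u s y = lim (\<lambda>n. U n s y)" for s y
  have lim: "(\<lambda>n. U n s y) \<longlonglongrightarrow> u s y" for s y
  proof -
    have "incseq (\<lambda>n. U n s y)" using mono by (intro incseq_SucI)
    moreover have "Bseq (\<lambda>n. U n s y)" using Ub R_pos by (intro BseqI[of R]) auto
    ultimately have "convergent (\<lambda>n. U n s y)" by (intro Bseq_monoseq_convergent) (auto simp: incseq_imp_monoseq)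
    then show ?thesis unfolding u_def by (simp add: convergent_LIMSEQ_iff)
  qed
  have um: "(\<lambda>(s, y). u s y) \<in> borel_measurable (borel \<Otimes>\<^sub>M borel)"
    by (rule borel_measurable_LIMSEQ_real[OF _ Um]) (auto intro: lim)
  have u_bounds: "lower t x \<le> u t x" "u t x \<le> upper t x" for t x
    using LIMSEQ_le_const[OF lim, of "lower t x"] LIMSEQ_le_const2[OF lim, of _ _ "upper t x"] Ul Uu by auto
  have gain_lim: "(\<lambda>n. gain (U n s y)) \<longlonglongrightarrow> gain (u s y)" for s y
  proof (rule LIM_zero_cancel, rule Lim_null_comparison)
    show "eventually (\<lambda>n. norm (gain (U n s y) - gain (u s y)) \<le> 2 * \<kappa> * \<bar>U n s y - u s y\<bar>) sequentially"
    proof (rule always_eventually, rule allI)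
      fix n
      have "\<bar>signed_power p (U n s y) - signed_power p (u s y)\<bar> \<le> \<kappa> * \<bar>U n s y - u s y\<bar>"
        unfolding \<kappa>_def by (rule signed_power_lipschitz[OF p_gt_1 sandwich[OF u_bounds] Ub])
      moreover have "\<bar>\<kappa> * U n s y - \<kappa> * u s y\<bar> = \<kappa> * \<bar>U n s y - u s y\<bar>"
        using kappa_pos by (simp add: abs_mult flip: right_diff_distrib)
      ultimately show "norm (gain (U n s y) - gain (u s y)) \<le> 2 * \<kappa> * \<bar>U n s y - u s y\<bar>"
        by (simp add: gain_def)
    qed
    have "(\<lambda>n. 2 * \<kappa> * \<bar>U n s y - u s y\<bar>) \<longlonglongrightarrow> 2 * \<kappa> * \<bar>u s y - u s y\<bar>"
      by (intro tendsto_intros lim)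
    then show "(\<lambda>n. 2 * \<kappa> * \<bar>U n s y - u s y\<bar>) \<longlonglongrightarrow> 0" by simp
  qed
  have "u t x = picard u t x" for t x
  proof (rule LIMSEQ_unique)
    show "(\<lambda>n. U (Suc n) t x) \<longlonglongrightarrow> u t x" using lim by (rule LIMSEQ_Suc)
    show "(\<lambda>n. U (Suc n) t x) \<longlonglongrightarrow> picard u t x"
      unfolding US picard_def
      by (intro tendsto_mult tendsto_add tendsto_const
          duhamel_tendsto[OF weighted_measurable(1)[OF Um] weighted_measurable(1)[OF um] weighted_bound[OF gain_bound[OF Ub]]]
          gain_lim)
  qed
  then show ?thesis using um u_bounds by blast
qed

end

section \<open>Removing the damping, and uniqueness\<close>

context mild_problem
begin

lemma heat_bound_AE:
  assumes [measurable]: "f \<in> borel_measurable borel" and C: "0 \<le> C" "AE y in lborel. \<bar>f y\<bar> \<le> C"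
  shows "\<bar>heat \<tau> f x\<bar> \<le> C"
proof -
  define g where "g y = max (- C) (min C (f y))" for y
  have [measurable]: "g \<in> borel_measurable borel" unfolding g_def by measurable
  have "heat \<tau> f x = heat \<tau> g x"
    by (rule heat_cong_AE) (use C(2) in \<open>auto simp: g_def elim!: eventually_mono\<close>)
  moreover have "\<bar>heat \<tau> g x\<bar> \<le> C" by (rule heat_bound) (use C(1) in \<open>auto simp: g_def\<close>)
  ultimately show ?thesis by simp
qed

text \<open>Prepared for the Gronwall argument: the effective bound m may vary in time and hold
  almost everywhere only, while M and B merely secure integrability.\<close>

lemma duhamel_weighted_bound:
  assumes w: "(\<lambda>(s, y). w s y) \<in> borel_measurable (borel \<Otimes>\<^sub>M borel)" "\<And>s y. 0 < s \<Longrightarrow> s < t \<Longrightarrow> \<bar>w s y\<bar> \<le> M"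
    and m: "m \<in> borel_measurable borel" "\<And>s. 0 < s \<Longrightarrow> s < t \<Longrightarrow> \<bar>m s\<bar> \<le> B" "\<And>s. 0 \<le> m s"
    and le: "AE s in lborel. 0 < s \<longrightarrow> s < t \<longrightarrow> (AE y in lborel. \<bar>w s y\<bar> \<le> m s)"
  shows "\<bar>duhamel w t x\<bar> \<le> (\<integral>s. indicator {0<..<t} s * (h s * m s) \<partial>lborel)"
proof -
  have "\<bar>duhamel w t x\<bar> \<le> (\<integral>s. \<bar>indicator {0<..<t} s * (h s * heat (c t - c s) (w s) x)\<bar> \<partial>lborel)"
    unfolding duhamel_def by (rule integral_abs_bound)
  also have "\<dots> \<le> (\<integral>s. indicator {0<..<t} s * (h s * m s) \<partial>lborel)"
  proof (rule integral_mono_AE)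
    show "integrable lborel (\<lambda>s. \<bar>indicator {0<..<t} s * (h s * heat (c t - c s) (w s) x)\<bar>)"
      using duhamel_integrable[OF w, where t = t] by simp
    show "integrable lborel (\<lambda>s. indicator {0<..<t} s * (h s * m s))"
      by (rule h_weight_integrable[OF order_refl m(1,2)])
    show "AE s in lborel. \<bar>indicator {0<..<t} s * (h s * heat (c t - c s) (w s) x)\<bar> \<le> indicator {0<..<t} s * (h s * m s)"
      using le
    proof eventually_elim
      case (elim s)
      show ?case
      proof (cases "s \<in> {0<..<t}")
        case True
        then have "\<bar>heat (c t - c s) (w s) x\<bar> \<le> m s"
          using elim m(3) by (intro heat_bound_AE pair_measurable_section[OF w(1)]) auto
        then show ?thesis using True by (simp add: abs_mult h_nonneg mult_left_mono)
      qed simp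
    qed
  qed
  finally show ?thesis .
qed

lemma duhamel_bound:
  assumes w: "(\<lambda>(s, y). w s y) \<in> borel_measurable (borel \<Otimes>\<^sub>M borel)" "\<And>s y. 0 < s \<Longrightarrow> s < t \<Longrightarrow> \<bar>w s y\<bar> \<le> M"
    and M: "0 \<le> M"
  shows "\<bar>duhamel w t x\<bar> \<le> M * H t"
proof -
  have "\<bar>duhamel w t x\<bar> \<le> (\<integral>s. indicator {0<..<t} s * (h s * M) \<partial>lborel)"
    by (rule duhamel_weighted_bound[OF w, where B = M]) (use w M in auto)
  also have "\<dots> = (\<integral>s. M * (indicator {0<..<t} s * h s) \<partial>lborel)" by (simp add: mult_ac)
  also have "\<dots> = M * H t" by (simp add: H_def)
  finally show ?thesis .
qed

end

context absorption
begin

text \<open>Variation of constants read backwards, without differentiating in time. The fixed-point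
  equation at time s is propagated to time t, multiplied by h and integrated over s; exchanging the
  integrals over the triangle r < s < t leaves the explicit integral of h exp(-\<kappa> H) over (r,
  t).\<close>

lemma picard_fixed_point_mild:
  assumes um: "(\<lambda>(s, y). u s y) \<in> borel_measurable (borel \<Otimes>\<^sub>M borel)" and ub: "\<And>s y. \<bar>u s y\<bar> \<le> R"
    and fp: "\<And>t x. u t x = picard u t x"
  shows "u t x = free u0 t x - duhamel (\<lambda>s y. signed_power p (u s y)) t x"
proof (cases "0 < t")
  case False
  then show ?thesis using fp[of t x] by (simp add: picard_def duhamel_def H_nonpos)
next
  case t: True
  note [measurable] = um
  define w where "w s y = exp (\<kappa> * H s) * gain (u s y)" for s y
  define e where "e s = exp (- \<kappa> * H s)" for s
  define b where "b r = heat (c t - c r) (w r) x" for r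
  define C where "C = exp (\<kappa> * H t) * (\<kappa> * R)"
  define a where "a = free u0 t x"
  have wm: "(\<lambda>(s, y). w s y) \<in> borel_measurable (borel \<Otimes>\<^sub>M borel)"
    unfolding w_def by (rule weighted_measurable[OF um])
  have wC: "\<bar>w s y\<bar> \<le> C" if "s < t" for s y
    unfolding w_def C_def by (intro weighted_bound gain_bound ub that)
  have C0: "0 \<le> C" using kappa_pos R_pos by (simp add: C_def)
  have [measurable]: "b \<in> borel_measurable borel" unfolding b_def by (rule heat_shift_measurable[OF wm])
  have [measurable]: "e \<in> borel_measurable borel" unfolding e_def by measurable
  have b_bound: "\<bar>b r\<bar> \<le> C" if "r < t" for r
    unfolding b_def by (rule heat_bound[OF pair_measurable_section[OF wm] wC[OF that]])
  define A where "A s = indicator {0<..<t} s * (h s * e s)" for s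
  define B where "B r = indicator {0<..<t} r * (h r * b r)" for r
  \<comment> \<open>The indicator of the triangle 0 < r < s, used as the bounded kernel in
    Fubini.\<close>
  define J where "J s r = (if 0 < r \<and> r < s then 1 else 0 :: real)" for s r :: real
  have Ai: "integrable lborel A" unfolding A_def e_def by (rule exp_H_integrable) simp
  have Bi: "integrable lborel B" unfolding B_def by (rule h_weight_integrable[where C = C]) (auto intro: b_bound)
  have Jm: "(\<lambda>(s, r). J s r) \<in> borel_measurable (borel \<Otimes>\<^sub>M borel)" unfolding J_def by measurable
  have J1: "\<bar>J s r\<bar> \<le> 1" for s r by (simp add: J_def)
  note F = Fubini_bounded_kernel[OF Ai Bi Jm J1]
  have heat_u: "heat (c t - c s) (u s) x = e s * (a + (\<integral>r. J s r * B r \<partial>lborel))" if s: "0 < s" "s < t" for s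
  proof -
    have ws: "\<bar>w r y\<bar> \<le> C" if "0 < r" "r < s" for r y using wC[of r y] that s by simp
    have dm: "duhamel w s \<in> borel_measurable borel"
      by (rule pair_measurable_section[OF duhamel_measurable_pair[OF wm]])
    have fm: "free u0 s \<in> borel_measurable borel"
      by (rule pair_measurable_section[OF free_measurable_pair[OF u0_measurable]])
    have "heat (c t - c s) (u s) x = heat (c t - c s) (\<lambda>y. e s * (free u0 s y + duhamel w s y)) x"
    proof -
      have "u s = (\<lambda>y. e s * (free u0 s y + duhamel w s y))"
        using fp[of s] by (auto simp: picard_def e_def w_def[abs_def] fun_eq_iff)
      then show ?thesis by simp
    qed
    also have "\<dots> = e s * (heat (c t - c s) (free u0 s) x + heat (c t - c s) (duhamel w s) x)"
      unfolding heat_cmult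
      by (subst heat_add[OF fm free_bound[OF u0_measurable u0_bound] dm duhamel_bound[OF wm ws C0]]) auto
    also have "heat (c t - c s) (free u0 s) x = a"
      unfolding a_def by (rule heat_free[OF u0_measurable u0_bound s])
    also have "heat (c t - c s) (duhamel w s) x = (\<integral>r. indicator {0<..<s} r * (h r * b r) \<partial>lborel)"
      unfolding b_def by (rule heat_duhamel[OF wm ws s])
    also have "\<dots> = (\<integral>r. J s r * B r \<partial>lborel)"
      by (intro Bochner_Integration.integral_cong refl) (use s in \<open>auto simp: J_def B_def indicator_def\<close>)
    finally show ?thesis .
  qed
  \<comment> \<open>For r outside (0, t) both sides vanish with B; inside, A supplies the cut-off s
    < t.\<close>
  have inner: "(\<integral>s. A s * J s r \<partial>lborel) * B r = (e r * B r - e t * B r) / \<kappa>" for r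
  proof (cases "r \<in> {0<..<t}")
    case True
    have "(\<integral>s. A s * J s r \<partial>lborel) = (\<integral>s. indicator {r<..<t} s * (h s * exp (- \<kappa> * H s)) \<partial>lborel)"
      by (intro Bochner_Integration.integral_cong refl) (use True in \<open>auto simp: A_def J_def e_def indicator_def\<close>)
    also have "\<dots> = (exp (- \<kappa> * H t) - exp (- \<kappa> * H r)) / (- \<kappa>)"
      by (rule exp_H_integral) (use True kappa_pos in auto)
    also have "\<dots> = (e r - e t) / \<kappa>" using kappa_pos by (simp add: e_def field_simps)
    finally show ?thesis by (simp add: left_diff_distrib)
  qed (simp add: B_def)
  have eBi: "integrable lborel (\<lambda>r. e r * B r)"
  proof -
    have "integrable lborel (\<lambda>r. indicator {0<..<t} r * (h r * (e r * b r)))"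
    proof (rule h_weight_integrable[where C = C])
      fix s assume "0 < s" "s < t"
      have "\<bar>e s\<bar> * \<bar>b s\<bar> \<le> 1 * C"
        using kappa_pos H_nonneg[of s] \<open>s < t\<close> by (intro mult_mono b_bound) (auto simp: e_def)
      then show "\<bar>e s * b s\<bar> \<le> C" by (simp add: abs_mult)
    qed auto
    then show ?thesis by (simp add: B_def mult_ac)
  qed
  have "duhamel u t x = (\<integral>s. A s * a + A s * (\<integral>r. J s r * B r \<partial>lborel) \<partial>lborel)"
    unfolding duhamel_def
  proof (intro Bochner_Integration.integral_cong refl)
    fix s
    show "indicator {0<..<t} s * (h s * heat (c t - c s) (u s) x) = A s * a + A s * (\<integral>r. J s r * B r \<partial>lborel)"
      by (cases "s \<in> {0<..<t}") (auto simp: heat_u A_def algebra_simps)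
  qed
  also have "\<dots> = (\<integral>s. A s \<partial>lborel) * a + (\<integral>r. (e r * B r - e t * B r) / \<kappa> \<partial>lborel)"
    using Ai F(1,2) by (simp add: inner)
  also have "(\<integral>s. A s \<partial>lborel) = (1 - e t) / \<kappa>"
  proof -
    have "(\<integral>s. A s \<partial>lborel) = (exp (- \<kappa> * H t) - exp (- \<kappa> * H 0)) / (- \<kappa>)"
      unfolding A_def e_def by (rule exp_H_integral) (use t kappa_pos in auto)
    then show ?thesis using kappa_pos by (simp add: e_def H_nonpos field_simps)
  qed
  also have "(\<integral>r. (e r * B r - e t * B r) / \<kappa> \<partial>lborel) = ((\<integral>r. e r * B r \<partial>lborel) - e t * (\<integral>r. B r \<partial>lborel)) / \<kappa>"
    using eBi Bi by simp
  finally have D: "duhamel u t x = (1 - e t) / \<kappa> * a + ((\<integral>r. e r * B r \<partial>lborel) - e t * (\<integral>r. B r \<partial>lborel)) / \<kappa>" .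
  have cancel: "\<kappa> * (y / \<kappa> * a + z / \<kappa>) = y * a + z" for y z
    using kappa_pos by (simp add: field_simps)
  \<comment> \<open>The terms below turn the right side into a - u + \<kappa>
    \<open>duhamel u\<close> minus the Duhamel integral of the reaction; the \<kappa> terms then
    cancel.\<close>
  have "\<kappa> * duhamel u t x = a - e t * (a + (\<integral>r. B r \<partial>lborel)) + (\<integral>r. e r * B r \<partial>lborel)"
    unfolding D cancel by (simp add: algebra_simps)
  also have "(\<integral>r. B r \<partial>lborel) = duhamel w t x" by (simp add: B_def b_def duhamel_def)
  also have "e t * (a + duhamel w t x) = u t x"
    using fp[of t x] by (simp add: picard_def e_def w_def[abs_def] a_def)
  also have "(\<integral>r. e r * B r \<partial>lborel) = duhamel (\<lambda>s y. gain (u s y)) t x"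
    unfolding duhamel_def
  proof (intro Bochner_Integration.integral_cong refl)
    fix r
    have "b r = exp (\<kappa> * H r) * heat (c t - c r) (\<lambda>y. gain (u r y)) x"
      unfolding b_def w_def by (rule heat_cmult)
    then have "e r * b r = heat (c t - c r) (\<lambda>y. gain (u r y)) x"
      by (simp add: e_def exp_minus)
    then show "e r * B r = indicator {0<..<t} r * (h r * heat (c t - c r) (\<lambda>y. gain (u r y)) x)"
      unfolding B_def by (metis mult.left_commute)
  qed
  also have "duhamel (\<lambda>s y. gain (u s y)) t x = \<kappa> * duhamel u t x - duhamel (\<lambda>s y. signed_power p (u s y)) t x"
  proof -
    have "duhamel (\<lambda>s y. \<kappa> * u s y - signed_power p (u s y)) t x =
        duhamel (\<lambda>s y. \<kappa> * u s y) t x - duhamel (\<lambda>s y. signed_power p (u s y)) t x"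
    proof (rule duhamel_diff)
      show "\<bar>\<kappa> * u s y\<bar> \<le> \<kappa> * R" for s y by (rule linear_bound[OF ub])
      show "\<bar>signed_power p (u s y)\<bar> \<le> R powr (p - 1) * R" for s y
        by (rule signed_power_bound) (use p_gt_1 ub in auto)
    qed measurable
    then show ?thesis by (simp add: gain_def duhamel_cmult)
  qed
  finally show ?thesis by (simp add: a_def)
qed

text \<open>V is the competing curve of classes and v a Borel function equal to it for almost every
  time. Iterating the integral inequality halves the weighted bound each time: integrating L h exp(2
  L H) yields at most one half of exp(2 L H).\<close>

lemma mild_solution_unique:
  assumes um: "(\<lambda>(s, y). u s y) \<in> borel_measurable (borel \<Otimes>\<^sub>M borel)" and ub: "\<And>s y. \<bar>u s y\<bar> \<le> M"
    and u: "\<And>t x. 0 \<le> t \<Longrightarrow> t \<le> T \<Longrightarrow> u t x = free u0 t x - duhamel (\<lambda>s y. signed_power p (u s y)) t x"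
    and vm: "(\<lambda>(s, y). v s y) \<in> borel_measurable (borel \<Otimes>\<^sub>M borel)" and vb: "\<And>s y. \<bar>v s y\<bar> \<le> M"
    and V: "\<And>t. 0 \<le> t \<Longrightarrow> t \<le> T \<Longrightarrow> AE x in lborel. V t x = free u0 t x - duhamel (\<lambda>s y. signed_power p (v s y)) t x"
    and Vv: "AE s in lborel. 0 \<le> s \<longrightarrow> s \<le> T \<longrightarrow> (AE x in lborel. V s x = v s x)"
    and t: "0 \<le> t" "t \<le> T"
  shows "AE x in lborel. V t x = u t x"
proof -
  note [measurable] = um vm
  have M0: "0 \<le> M" using ub[of 0 undefined] by linarith
  \<comment> \<open>Strictly larger than M so that the Lipschitz constant L is positive even for M =
    0.\<close>
  define M' where "M' = M + 1"
  have M': "0 < M'" "\<And>s y. \<bar>u s y\<bar> \<le> M'" "\<And>s y. \<bar>v s y\<bar> \<le> M'"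
    using M0 by (auto simp: M'_def ub vb add_increasing2)
  define L where "L = p * M' powr (p - 1)"
  have L: "0 < L" using p_gt_1 M' by (simp add: L_def)
  define S where "S = M' powr (p - 1) * M'"
  have S0: "0 \<le> S" using M' by (simp add: S_def)
  have sp: "\<bar>signed_power p z\<bar> \<le> S" if "\<bar>z\<bar> \<le> M'" for z
    unfolding S_def by (rule signed_power_bound) (use that p_gt_1 in auto)
  have spu: "(\<lambda>(s, y). signed_power p (u s y)) \<in> borel_measurable (borel \<Otimes>\<^sub>M borel)"
    and spv: "(\<lambda>(s, y). signed_power p (v s y)) \<in> borel_measurable (borel \<Otimes>\<^sub>M borel)" by measurable
  have diff: "AE x in lborel. V t x - u t x = duhamel (\<lambda>s y. signed_power p (u s y) - signed_power p (v s y)) t x"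
    if t: "0 \<le> t" "t \<le> T" for t
    using V[OF t]
  proof eventually_elim
    case (elim x)
    have "duhamel (\<lambda>s y. signed_power p (u s y) - signed_power p (v s y)) t x =
      duhamel (\<lambda>s y. signed_power p (u s y)) t x - duhamel (\<lambda>s y. signed_power p (v s y)) t x"
      by (rule duhamel_diff[OF spu sp[OF M'(2)] spv sp[OF M'(3)]])
    then show ?case using u[OF t] elim by simp
  qed
  have dm: "(\<lambda>(s, y). signed_power p (u s y) - signed_power p (v s y)) \<in> borel_measurable (borel \<Otimes>\<^sub>M borel)"
    by measurable
  have db: "\<bar>signed_power p (u s y) - signed_power p (v s y)\<bar> \<le> 2 * S" for s y
    using sp[OF M'(2), of s y] sp[OF M'(3), of s y] by linarith
  define C where "C = 2 * S * H T"
  have C0: "0 \<le> C" using S0 H_nonneg by (simp add: C_def)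
  have main: "AE x in lborel. \<bar>V t x - u t x\<bar> \<le> C / 2 ^ n * exp (2 * L * H t)" if t: "0 \<le> t" "t \<le> T" for t n
    using t
  proof (induction n arbitrary: t)
    case 0
    from diff[OF 0] show ?case
    proof eventually_elim
      case (elim x)
      have "\<bar>duhamel (\<lambda>s y. signed_power p (u s y) - signed_power p (v s y)) t x\<bar> \<le> 2 * S * H t"
        by (rule duhamel_bound[OF dm db]) (use S0 in auto)
      also have "\<dots> \<le> C" unfolding C_def using H_mono[OF 0(2)] S0 by (intro mult_left_mono) auto
      also have "\<dots> \<le> C * exp (2 * L * H t)"
        using C0 L H_nonneg[of t] by (simp add: mult_le_cancel_left1)
      finally show ?case using elim by simp
    qed
  next
    case (Suc n)
    define m where "m s = L * (C / 2 ^ n) * exp (2 * L * H s)" for s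
    have [measurable]: "m \<in> borel_measurable borel" unfolding m_def by measurable
    have m0: "0 \<le> m s" for s using L C0 by (simp add: m_def)
    have m_le: "\<bar>m s\<bar> \<le> m t" if "s < t" for s
    proof -
      have "exp (2 * L * H s) \<le> exp (2 * L * H t)" using L H_mono[of s t] that by simp
      then have "m s \<le> m t" unfolding m_def using L C0 by (intro mult_left_mono) auto
      then show ?thesis using m0[of s] by simp
    qed
    \<comment> \<open>The induction hypothesis concerns V at every time; the source contains v,
      which agrees with V for almost every s, and that suffices under the time integral.\<close>
    have ae: "AE s in lborel. 0 < s \<longrightarrow> s < t \<longrightarrow> (AE y in lborel. \<bar>signed_power p (u s y) - signed_power p (v s y)\<bar> \<le> m s)"
      using Vv
    proof eventually_elim
      case (elim s)
      show ?case
      proof (intro impI)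
        assume s: "0 < s" "s < t"
        then have "AE x in lborel. V s x = v s x" using Suc.prems elim by auto
        moreover have "AE x in lborel. \<bar>V s x - u s x\<bar> \<le> C / 2 ^ n * exp (2 * L * H s)"
          using Suc.prems s by (intro Suc.IH) auto
        ultimately show "AE y in lborel. \<bar>signed_power p (u s y) - signed_power p (v s y)\<bar> \<le> m s"
        proof eventually_elim
          case (elim y)
          have "\<bar>signed_power p (u s y) - signed_power p (v s y)\<bar> \<le> L * \<bar>u s y - v s y\<bar>"
            unfolding L_def by (rule signed_power_lipschitz[OF p_gt_1 M'(3) M'(2)])
          also have "\<dots> \<le> L * (C / 2 ^ n * exp (2 * L * H s))"
            using elim L by (intro mult_left_mono) (auto simp: abs_minus_commute)
          finally show ?case by (simp add: m_def)
        qed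
      qed
    qed
    have int_m: "(\<integral>s. indicator {0<..<t} s * (h s * m s) \<partial>lborel) \<le> C / 2 ^ Suc n * exp (2 * L * H t)"
    proof -
      have "(\<integral>s. indicator {0<..<t} s * (h s * m s) \<partial>lborel) = (\<integral>s. (L * (C / 2 ^ n)) * (indicator {0<..<t} s * (h s * exp (2 * L * H s))) \<partial>lborel)"
        by (intro Bochner_Integration.integral_cong refl) (simp add: m_def)
      also have "\<dots> = L * (C / 2 ^ n) * ((exp (2 * L * H t) - exp (2 * L * H 0)) / (2 * L))"
        unfolding integral_mult_right_zero
        using exp_H_integral[of 0 t "2 * L"] Suc.prems L by simp
      also have "\<dots> = C / 2 ^ Suc n * (exp (2 * L * H t) - 1)" using L by (simp add: H_nonpos)
      also have "\<dots> \<le> C / 2 ^ Suc n * exp (2 * L * H t)" using C0 by (intro mult_left_mono) auto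
      finally show ?thesis .
    qed
    from diff[OF Suc.prems] show ?case
    proof eventually_elim
      case (elim x)
      have "\<bar>duhamel (\<lambda>s y. signed_power p (u s y) - signed_power p (v s y)) t x\<bar> \<le> (\<integral>s. indicator {0<..<t} s * (h s * m s) \<partial>lborel)"
        by (rule duhamel_weighted_bound[OF dm db _ m_le m0 ae]) auto
      then show ?case using elim int_m by simp
    qed
  qed
  have "AE x in lborel. \<forall>n. \<bar>V t x - u t x\<bar> \<le> C / 2 ^ n * exp (2 * L * H t)"
    using main[OF t] by (simp add: AE_all_countable)
  then show ?thesis
  proof eventually_elim
    case (elim x)
    have "(\<lambda>n. C * exp (2 * L * H t) * (1 / 2) ^ n) \<longlonglongrightarrow> C * exp (2 * L * H t) * 0"
      by (intro tendsto_intros LIMSEQ_power_zero) simp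
    then have "(\<lambda>n. C / 2 ^ n * exp (2 * L * H t)) \<longlonglongrightarrow> 0"
      by (simp add: power_divide mult.commute)
    then have "\<bar>V t x - u t x\<bar> \<le> 0" by (rule LIMSEQ_le_const) (use elim in auto)
    then show ?case by simp
  qed
qed

end

section \<open>Continuity in time\<close>

text \<open>A nonempty open set is not negligible.\<close>

lemma continuous_AE_bound:
  fixes w :: "'a::euclidean_space \<Rightarrow> real"
  assumes w: "continuous_on UNIV w" and ae: "AE x in lborel. \<bar>w x\<bar> \<le> R"
  shows "\<bar>w x\<bar> \<le> R"
proof (rule ccontr)
  assume "\<not> \<bar>w x\<bar> \<le> R"
  then have x: "x \<in> {x. R < \<bar>w x\<bar>}" by simp
  have "open {x. R < \<bar>w x\<bar>}"
    by (intro open_Collect_less continuous_intros w)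
  moreover from this have "{x. R < \<bar>w x\<bar>} \<in> null_sets lborel"
    using ae by (subst AE_iff_null_sets) (auto simp: not_less)
  then have "negligible {x. R < \<bar>w x\<bar>}"
    by (simp add: negligible_iff_null_sets null_sets_completionI)
  ultimately show False using x open_not_negligible by blast
qed

section \<open>Modulus of continuity of the Duhamel integral\<close>

context mild_problem
begin

lemma c_tendsto:
  assumes "0 < t0" "X \<longlonglongrightarrow> t0"
  shows "(\<lambda>n. c (X n)) \<longlonglongrightarrow> c t0"
proof (rule isCont_tendsto_compose[OF _ assms(2)])
  show "isCont c t0"
    using c_continuous assms(1) by (auto simp: continuous_on_interior)
qed

lemma c_at_right_0: "filterlim c (at_right 0) (at_right 0)"
proof (rule tendsto_imp_filterlim_at_right)
  have "(c \<longlongrightarrow> c 0) (at 0 within {0..})"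
    using c_continuous by (simp add: continuous_on)
  then have "(c \<longlongrightarrow> c 0) (at_right 0)" by (rule tendsto_within_subset) auto
  then show "(c \<longlongrightarrow> 0) (at_right 0)" by (simp add: c_zero)
  show "eventually (\<lambda>t. 0 < c t) (at_right 0)"
    using eventually_at_right_less[of 0] by eventually_elim (rule c_pos)
qed

lemma H_at_right_0: "(H \<longlongrightarrow> 0) (at_right 0)"
proof -
  have "isCont H 0" using H_continuous by (simp add: continuous_on_eq_continuous_at)
  then have "(H \<longlongrightarrow> H 0) (at 0)" by (simp add: isCont_def)
  then show ?thesis by (simp add: H_nonpos filterlim_at_split)
qed

lemma kdist_seq:
  assumes "\<sigma> \<noteq> 0" "X \<longlonglongrightarrow> \<sigma>"
  shows "(\<lambda>n. kdist (X n) \<sigma>) \<longlonglongrightarrow> 0"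
proof -
  have "isCont (\<lambda>\<tau>. kdist \<tau> \<sigma>) \<sigma>"
    using kdist_tendsto[OF assms(1)] by (simp add: isCont_def kdist_def)
  from isCont_tendsto_compose[OF this assms(2)] show ?thesis by (simp add: kdist_def)
qed

text \<open>The range of integration reaches t0 + 1 so that one fixed interval serves all t near t0;
  for s beyond t and t0 both kernels vanish.\<close>

definition modulus :: "real \<Rightarrow> real \<Rightarrow> real" where
  "modulus t0 t = (\<integral>s. indicator {0<..<t0 + 1} s * (h s * kdist (c t - c s) (c t0 - c s)) \<partial>lborel)"

lemma kdist_abs_le: "\<bar>kdist \<tau> \<sigma>\<bar> \<le> 2"
  using kdist_le kdist_nonneg by simp

text \<open>\<open>kdist\<close> is discontinuous only at elapsed time 0, which is met at the single
  instant s = t0; everywhere else the integrand tends to 0, dominated by 2 h.\<close>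

lemma modulus_tendsto:
  assumes t0: "0 < t0" and X: "X \<longlonglongrightarrow> t0"
  shows "(\<lambda>n. modulus t0 (X n)) \<longlonglongrightarrow> 0"
proof -
  have "(\<lambda>n. modulus t0 (X n)) \<longlonglongrightarrow> (\<integral>s. 0 \<partial>(lborel :: real measure))"
    unfolding modulus_def
  proof (rule integral_dominated_convergence[where w = "\<lambda>s. (indicator {0<..<t0 + 1} s * h s) * 2"])
    show "integrable lborel (\<lambda>s. (indicator {0<..<t0 + 1} s * h s) * 2)" using h_integrable by simp
    have "AE s in lborel. s \<noteq> t0" by (rule AE_lborel_singleton)
    then show "AE s in lborel. (\<lambda>n. indicator {0<..<t0 + 1} s * (h s * kdist (c (X n) - c s) (c t0 - c s))) \<longlonglongrightarrow> 0"
    proof eventually_elim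
      case (elim s)
      show ?case
      proof (cases "0 < s")
        case True
        then have "c t0 - c s \<noteq> 0" using c_strict_mono[of s t0] c_strict_mono[of t0 s] elim t0
          by (cases "s < t0") auto
        then have "(\<lambda>n. kdist (c (X n) - c s) (c t0 - c s)) \<longlonglongrightarrow> 0"
          by (rule kdist_seq) (intro tendsto_intros c_tendsto t0 X)
        then have "(\<lambda>n. indicator {0<..<t0 + 1} s * (h s * kdist (c (X n) - c s) (c t0 - c s))) \<longlonglongrightarrow> indicator {0<..<t0 + 1} s * (h s * 0)"
          by (intro tendsto_intros)
        then show ?thesis by simp
      qed simp
    qed
    show "AE s in lborel. norm (indicator {0<..<t0 + 1} s * (h s * kdist (c (X n) - c s) (c t0 - c s))) \<le> (indicator {0<..<t0 + 1} s * h s) * 2" for n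
      using kdist_abs_le by (auto simp: abs_mult h_nonneg indicator_def intro!: AE_I2 mult_left_mono)
  qed measurable
  then show ?thesis by simp
qed

text \<open>As the heat operator vanishes at nonpositive times, both Duhamel integrals can be taken
  over the same interval, and the integrands are compared by \<open>heat_kdist\<close>.\<close>

lemma duhamel_modulus:
  assumes w: "(\<lambda>(s, y). w s y) \<in> borel_measurable (borel \<Otimes>\<^sub>M borel)" "\<And>s y. \<bar>w s y\<bar> \<le> S"
    and t: "0 < t0" "0 \<le> t" "t < t0 + 1"
  shows "\<bar>duhamel w t x - duhamel w t0 x\<bar> \<le> S * modulus t0 t"
proof -
  note wm[measurable] = heat_shift_measurable[OF w(1)]
  have S0: "0 \<le> S" using w(2)[of 0 undefined] by linarith
  let ?I = "\<lambda>t s. indicator {0<..<t0 + 1} s * (h s * heat (c t - c s) (w s) x)"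
  have eq: "duhamel w t x = (\<integral>s. ?I t s \<partial>lborel)" if "0 \<le> t" "t < t0 + 1" for t
    unfolding duhamel_def
  proof (intro Bochner_Integration.integral_cong refl)
    fix s
    have "heat (c t - c s) (w s) x = 0" if "t \<le> s"
      using c_strict_mono[OF \<open>0 \<le> t\<close>, of s] that by (intro heat_nonpos) (cases "t = s", auto)
    then show "indicator {0<..<t} s * (h s * heat (c t - c s) (w s) x) = ?I t s"
      using that by (cases "s < t") (auto simp: indicator_def)
  qed
  have int: "integrable lborel (?I t)" for t
    by (rule h_weight_integrable[OF order_refl wm, where C = S])
      (auto intro!: heat_bound w(2) pair_measurable_section[OF w(1)])
  have "duhamel w t x - duhamel w t0 x = (\<integral>s. ?I t s - ?I t0 s \<partial>lborel)"
    using int t by (simp add: eq)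
  then have "\<bar>duhamel w t x - duhamel w t0 x\<bar> \<le> (\<integral>s. \<bar>?I t s - ?I t0 s\<bar> \<partial>lborel)"
    by (simp only: integral_abs_bound)
  also have "\<dots> \<le> (\<integral>s. S * (indicator {0<..<t0 + 1} s * (h s * kdist (c t - c s) (c t0 - c s))) \<partial>lborel)"
  proof (rule integral_mono)
    show "integrable lborel (\<lambda>s. \<bar>?I t s - ?I t0 s\<bar>)" using int by simp
    show "integrable lborel (\<lambda>s. S * (indicator {0<..<t0 + 1} s * (h s * kdist (c t - c s) (c t0 - c s))))"
      by (intro integrable_mult_right h_weight_integrable[where C = 2] kdist_abs_le) auto
    fix s
    have "\<bar>heat (c t - c s) (w s) x - heat (c t0 - c s) (w s) x\<bar> \<le> S * kdist (c t - c s) (c t0 - c s)"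
      by (rule heat_kdist[OF pair_measurable_section[OF w(1)] w(2)])
    then have "(indicator {0<..<t0 + 1} s * h s) * \<bar>heat (c t - c s) (w s) x - heat (c t0 - c s) (w s) x\<bar> \<le> (indicator {0<..<t0 + 1} s * h s) * (S * kdist (c t - c s) (c t0 - c s))"
      by (intro mult_left_mono) (auto simp: h_nonneg)
    moreover have "?I t s - ?I t0 s = (indicator {0<..<t0 + 1} s * h s) * (heat (c t - c s) (w s) x - heat (c t0 - c s) (w s) x)"
      by (simp add: algebra_simps)
    ultimately show "\<bar>?I t s - ?I t0 s\<bar> \<le> S * (indicator {0<..<t0 + 1} s * (h s * kdist (c t - c s) (c t0 - c s)))"
      by (simp add: abs_mult h_nonneg mult_ac)
  qed
  also have "\<dots> = S * modulus t0 t" by (simp add: modulus_def)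
  finally show ?thesis .
qed

end

section \<open>Bounds and continuity of the constructed solution\<close>

locale absorption_solution = absorption +
  fixes u :: "real \<Rightarrow> 'a \<Rightarrow> real"
  assumes u_measurable: "(\<lambda>(s, y). u s y) \<in> borel_measurable (borel \<Otimes>\<^sub>M borel)"
    and lower_le_u: "lower t x \<le> u t x" and u_le_upper: "u t x \<le> upper t x"
    and u_mild: "u t x = free u0 t x - duhamel (\<lambda>s y. signed_power p (u s y)) t x"
begin

lemma u_bound: "\<bar>u t x\<bar> \<le> R"
  using lower_le_u[of t x] u_le_upper[of t x] lower_bounds(2)[of t x] upper_bounds(2)[of t x] by linarith

lemma u_section [measurable]: "u t \<in> borel_measurable borel"
  by (rule pair_measurable_section[OF u_measurable])

lemma u_initial: "u 0 x = u0 x"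
  using u_mild[of 0 x] by (simp add: free_def duhamel_def)

lemma u_nonneg:
  assumes "\<And>y. 0 \<le> u0 y"
  shows "0 \<le> u t x"
proof -
  have "(\<lambda>y. max 0 (- u0 y)) = (\<lambda>y. 0)"
    by (intro ext max_absorb1) (use assms in simp)
  then have "lower t x = 0" by (simp add: lower_def free_def heat_const)
  then show ?thesis using lower_le_u[of t x] by simp
qed

lemma abs_u0_bound: "\<bar>\<bar>u0 y\<bar>\<bar> \<le> R"
  using u0_bound by simp

lemma free_abs_u0_bound: "\<bar>free (\<lambda>y. \<bar>u0 y\<bar>) t x\<bar> \<le> R"
  by (rule free_bound[OF _ abs_u0_bound]) measurable

lemma u_abs_le: "\<bar>u t x\<bar> \<le> free (\<lambda>y. \<bar>u0 y\<bar>) t x"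
proof -
  have "upper t x \<le> free (\<lambda>y. \<bar>u0 y\<bar>) t x"
    unfolding upper_def by (rule free_mono[OF _ pos_part _ abs_u0_bound]) auto
  moreover have "- lower t x \<le> free (\<lambda>y. \<bar>u0 y\<bar>) t x"
    unfolding lower_def minus_minus by (rule free_mono[OF _ neg_part _ abs_u0_bound]) auto
  ultimately show ?thesis using lower_le_u[of t x] u_le_upper[of t x] by linarith
qed

definition reaction_bound :: real where "reaction_bound = R powr (p - 1)"

lemma reaction_measurable: "(\<lambda>(s, y). signed_power p (u s y)) \<in> borel_measurable (borel \<Otimes>\<^sub>M borel)"
  using u_measurable by measurable

lemma reaction_le: "\<bar>signed_power p (u s y)\<bar> \<le> reaction_bound * R"
  unfolding reaction_bound_def by (rule signed_power_bound) (use p_gt_1 u_bound in auto)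

lemma reaction_le_free: "\<bar>signed_power p (u s y)\<bar> \<le> reaction_bound * free (\<lambda>y. \<bar>u0 y\<bar>) s y"
proof -
  have "\<bar>signed_power p (u s y)\<bar> \<le> R powr (p - 1) * \<bar>u s y\<bar>"
    by (rule signed_power_abs_le) (use p_gt_1 u_bound in auto)
  also have "\<dots> \<le> R powr (p - 1) * free (\<lambda>y. \<bar>u0 y\<bar>) s y"
    by (intro mult_left_mono u_abs_le) simp
  finally show ?thesis by (simp add: reaction_bound_def)
qed

text \<open>The reaction at time s is at most a constant times the free evolution of |u0|, and
  propagating that to time t gives a function independent of s. The bound depends on x, so it can be
  integrated in L^q.\<close>

lemma duhamel_reaction_le:
  assumes t: "0 \<le> t"
  shows "\<bar>u t x - free u0 t x\<bar> \<le> reaction_bound * H t * free (\<lambda>y. \<bar>u0 y\<bar>) t x"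
proof -
  let ?N = "\<lambda>s y. signed_power p (u s y)"
  let ?a = "free (\<lambda>y. \<bar>u0 y\<bar>) t x"
  have "\<bar>duhamel ?N t x\<bar> \<le> (\<integral>s. \<bar>indicator {0<..<t} s * (h s * heat (c t - c s) (?N s) x)\<bar> \<partial>lborel)"
    unfolding duhamel_def by (rule integral_abs_bound)
  also have "\<dots> \<le> (\<integral>s. (reaction_bound * ?a) * (indicator {0<..<t} s * h s) \<partial>lborel)"
  proof (rule integral_mono)
    show "integrable lborel (\<lambda>s. \<bar>indicator {0<..<t} s * (h s * heat (c t - c s) (?N s) x)\<bar>)"
      by (intro integrable_abs duhamel_integrable[OF reaction_measurable reaction_le])
    show "integrable lborel (\<lambda>s. (reaction_bound * ?a) * (indicator {0<..<t} s * h s))"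
      using h_integrable by simp
    fix s
    show "\<bar>indicator {0<..<t} s * (h s * heat (c t - c s) (?N s) x)\<bar> \<le> (reaction_bound * ?a) * (indicator {0<..<t} s * h s)"
    proof (cases "s \<in> {0<..<t}")
      case True
      note Nm = pair_measurable_section[OF reaction_measurable, of s]
      have "\<bar>heat (c t - c s) (?N s) x\<bar> \<le> heat (c t - c s) (\<lambda>y. \<bar>?N s y\<bar>) x"
        by (rule heat_abs_le[OF Nm reaction_le])
      also have "\<dots> \<le> heat (c t - c s) (\<lambda>y. reaction_bound * free (\<lambda>y. \<bar>u0 y\<bar>) s y) x"
      proof (rule heat_mono[OF _ _ _ _ reaction_le_free])
        show "\<bar>\<bar>?N s y\<bar>\<bar> \<le> reaction_bound * R" for y using reaction_le[of s y] by simp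
        show "\<bar>reaction_bound * free (\<lambda>y. \<bar>u0 y\<bar>) s y\<bar> \<le> reaction_bound * R" for y
          using free_abs_u0_bound[of s y] by (simp add: abs_mult reaction_bound_def mult_left_mono)
        show "(\<lambda>y. \<bar>?N s y\<bar>) \<in> borel_measurable borel" using Nm by measurable
        show "(\<lambda>y. reaction_bound * free (\<lambda>y. \<bar>u0 y\<bar>) s y) \<in> borel_measurable borel"
          using pair_measurable_section[OF free_measurable_pair, of "\<lambda>y. \<bar>u0 y\<bar>" s] by measurable
      qed
      also have "\<dots> = reaction_bound * ?a"
        unfolding heat_cmult using True by (subst heat_free[OF _ abs_u0_bound]) auto
      finally have "h s * \<bar>heat (c t - c s) (?N s) x\<bar> \<le> h s * (reaction_bound * ?a)"
        by (intro mult_left_mono h_nonneg)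
      then show ?thesis using True by (simp add: abs_mult h_nonneg mult_ac)
    qed simp
  qed
  also have "\<dots> = reaction_bound * H t * ?a"
    unfolding integral_mult_right_zero H_def[symmetric] by (simp only: mult_ac)
  finally show ?thesis using u_mild[of t x] by simp
qed

lemma reaction_bound_nonneg: "0 \<le> reaction_bound"
  by (simp add: reaction_bound_def)

text \<open>Both the heat orbit and the Duhamel term are controlled by L^1 distances of kernels, so
  no regularity of the data is used; t0 > 0 is essential since \<open>kdist\<close> jumps at
  0.\<close>

lemma u_uniform_seq:
  assumes t0: "0 < t0" and X: "X \<longlonglongrightarrow> t0"
  shows "\<exists>\<eta>. \<eta> \<longlonglongrightarrow> 0 \<and> eventually (\<lambda>n. \<forall>x. \<bar>u (X n) x - u t0 x\<bar> \<le> \<eta> n) sequentially"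
proof (intro exI conjI)
  let ?eta = "\<lambda>n. R * kdist (c (X n)) (c t0) + reaction_bound * R * modulus t0 (X n)"
  have "?eta \<longlonglongrightarrow> R * 0 + reaction_bound * R * 0"
    using c_pos[OF t0] by (intro tendsto_intros kdist_seq c_tendsto modulus_tendsto t0 X) auto
  then show "?eta \<longlonglongrightarrow> 0" by simp
  have "eventually (\<lambda>n. 0 < X n) sequentially" using order_tendstoD(1)[OF X t0] .
  moreover have "eventually (\<lambda>n. X n < t0 + 1) sequentially" by (rule order_tendstoD(2)[OF X]) simp
  ultimately show "eventually (\<lambda>n. \<forall>x. \<bar>u (X n) x - u t0 x\<bar> \<le> ?eta n) sequentially"
  proof eventually_elim
    case (elim n)
    show ?case
    proof
      fix x
      let ?N = "\<lambda>s y. signed_power p (u s y)"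
      have "\<bar>heat (c (X n)) u0 x - heat (c t0) u0 x\<bar> \<le> R * kdist (c (X n)) (c t0)"
        by (rule heat_kdist[OF u0_measurable u0_bound])
      moreover have "\<bar>duhamel ?N (X n) x - duhamel ?N t0 x\<bar> \<le> reaction_bound * R * modulus t0 (X n)"
        by (rule duhamel_modulus[OF reaction_measurable reaction_le t0]) (use elim in auto)
      ultimately show "\<bar>u (X n) x - u t0 x\<bar> \<le> ?eta n"
        using u_mild[of "X n" x] u_mild[of t0 x] elim t0 by (simp add: free_def)
    qed
  qed
qed

lemma u_uniform_limit:
  assumes t0: "0 < t0" and e: "0 < e"
  shows "eventually (\<lambda>t. \<forall>x. \<bar>u t x - u t0 x\<bar> \<le> e) (at t0)"
proof (rule sequentially_imp_eventually_at, safe)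
  fix X :: "nat \<Rightarrow> real" assume X: "X \<longlonglongrightarrow> t0"
  obtain \<eta> where \<eta>: "\<eta> \<longlonglongrightarrow> 0" "eventually (\<lambda>n. \<forall>x. \<bar>u (X n) x - u t0 x\<bar> \<le> \<eta> n) sequentially"
    using u_uniform_seq[OF t0 X] by blast
  have "eventually (\<lambda>n. \<eta> n < e) sequentially" by (rule order_tendstoD(2)[OF \<eta>(1) e])
  with \<eta>(2) show "eventually (\<lambda>n. \<forall>x. \<bar>u (X n) x - u t0 x\<bar> \<le> e) sequentially"
    by eventually_elim (auto intro: order_trans less_imp_le)
qed

lemma u_Lq_integrable:
  assumes q: "1 \<le> q" and ui: "integrable lborel (\<lambda>x. \<bar>u0 x\<bar> powr q)" and t: "0 \<le> t"
  shows "integrable lborel (\<lambda>x. \<bar>u t x\<bar> powr q)"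
proof (cases "t = 0")
  case True
  then show ?thesis using ui by (simp add: u_initial)
next
  case False
  then have ct: "0 < c t" using t c_pos by simp
  have ui': "integrable lborel (\<lambda>x. \<bar>\<bar>u0 x\<bar>\<bar> powr q)" using ui by simp
  note hp = heat_powr_bound(4)[OF _ abs_u0_bound q ui' ct]
  have "integrable lborel (\<lambda>x. \<bar>heat (c t) (\<lambda>y. \<bar>u0 y\<bar>) x\<bar> powr q)" by (rule hp) measurable
  then show ?thesis
  proof (rule Bochner_Integration.integrable_bound)
    have "\<bar>u t x\<bar> \<le> \<bar>heat (c t) (\<lambda>y. \<bar>u0 y\<bar>) x\<bar>" for x
      using u_abs_le[of t x] t False by (simp add: free_def)
    then show "AE x in lborel. norm (\<bar>u t x\<bar> powr q) \<le> norm (\<bar>heat (c t) (\<lambda>y. \<bar>u0 y\<bar>) x\<bar> powr q)"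
      using q by (auto intro!: AE_I2 powr_mono2)
  qed measurable
qed

text \<open>By Jensen, |u(t)|^q lies below the heat flow of |u0|^q, and these majorants are L^1
  continuous at positive times. Uniform convergence supplies the pointwise limit.\<close>

lemma u_Lq_limit:
  assumes q: "1 \<le> q" and ui: "integrable lborel (\<lambda>x. \<bar>u0 x\<bar> powr q)" and t0: "0 < t0"
  shows "((\<lambda>t. \<integral>x. \<bar>u t x - u t0 x\<bar> powr q \<partial>lborel) \<longlongrightarrow> 0) (at t0)"
  unfolding tendsto_at_iff_sequentially comp_def
proof safe
  fix X :: "nat \<Rightarrow> real" assume X: "X \<longlonglongrightarrow> t0"
  \<comment> \<open>Keeps all times positive, where the Jensen bound holds; only finitely many terms
    change.\<close>
  define S where "S n = max (t0 / 2) (X n)" for n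
  have S: "S \<longlonglongrightarrow> t0"
    using t0 tendsto_max[OF tendsto_const X, of "t0 / 2"] by (simp add: S_def[abs_def] max_def[of "t0 / 2" t0])
  have Spos: "0 < S n" for n using t0 by (simp add: S_def less_max_iff_disj)
  define V where "V = (\<lambda>y. \<bar>u0 y\<bar> powr q)"
  have Vm[measurable]: "V \<in> borel_measurable borel" unfolding V_def by measurable
  have VC: "\<bar>V y\<bar> \<le> R powr q" for y using u0_bound[of y] q by (auto simp: V_def intro: powr_mono2)
  have Vi: "integrable lborel V" using ui by (simp add: V_def)
  have le: "\<bar>u t x\<bar> powr q \<le> heat (c t) V x" if t: "0 < t" for t x
  proof -
    have "\<bar>u t x\<bar> powr q \<le> heat (c t) (\<lambda>y. \<bar>u0 y\<bar>) x powr q"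
      using u_abs_le[of t x] t q by (intro powr_mono2) (auto simp: free_def)
    also have "\<dots> \<le> heat (c t) V x"
      unfolding V_def by (rule heat_jensen[OF u0_measurable u0_bound q c_pos[OF t]])
    finally show ?thesis .
  qed
  obtain \<eta> where \<eta>: "\<eta> \<longlonglongrightarrow> 0" "eventually (\<lambda>n. \<forall>x. \<bar>u (S n) x - u t0 x\<bar> \<le> \<eta> n) sequentially"
    using u_uniform_seq[OF t0 S] by blast
  have ptw: "(\<lambda>n. u (S n) x) \<longlonglongrightarrow> u t0 x" for x
  proof (rule LIM_zero_cancel, rule Lim_null_comparison[OF _ \<eta>(1)])
    show "eventually (\<lambda>n. norm (u (S n) x - u t0 x) \<le> \<eta> n) sequentially"
      using \<eta>(2) by eventually_elim simp
  qed
  have L1: "(\<lambda>n. \<integral>x. \<bar>heat (c (S n)) V x - heat (c t0) V x\<bar> \<partial>lborel) \<longlonglongrightarrow> 0"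
  proof (rule tendsto_sandwich[OF _ _ tendsto_const])
    have "(\<lambda>n. kdist (c (S n)) (c t0) * (\<integral>x. \<bar>V x\<bar> \<partial>lborel)) \<longlonglongrightarrow> 0 * (\<integral>x. \<bar>V x\<bar> \<partial>lborel)"
      using c_pos[OF t0] by (intro tendsto_intros kdist_seq c_tendsto t0 S) auto
    then show "(\<lambda>n. kdist (c (S n)) (c t0) * (\<integral>x. \<bar>V x\<bar> \<partial>lborel)) \<longlonglongrightarrow> 0" by simp
  qed (use heat_L1_kdist[OF Vm VC Vi] in auto)
  have "(\<lambda>n. \<integral>x. \<bar>u (S n) x - u t0 x\<bar> powr q \<partial>lborel) \<longlonglongrightarrow> 0"
    by (rule dominated_powr_tendsto[OF _ _ _ heat_L1_integrable[OF Vm VC Vi] heat_L1_integrable[OF Vm VC Vi] L1])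
      (use q ptw le Spos t0 in auto)
  moreover have "eventually (\<lambda>n. t0 / 2 < X n) sequentially"
    using t0 by (intro order_tendstoD(1)[OF X]) auto
  then have "eventually (\<lambda>n. (\<integral>x. \<bar>u (S n) x - u t0 x\<bar> powr q \<partial>lborel) = (\<integral>x. \<bar>u (X n) x - u t0 x\<bar> powr q \<partial>lborel)) sequentially"
    by eventually_elim (simp add: S_def max_def)
  ultimately show "(\<lambda>n. \<integral>x. \<bar>u (X n) x - u t0 x\<bar> powr q \<partial>lborel) \<longlonglongrightarrow> 0"
    by (rule Lim_transform_eventually)
qed

text \<open>Kernel distances are of no help at time 0. The heat orbit is treated by
  \<open>heat_Lq_limit\<close>, and the reaction part has L^q norm of order H(t), which tends to
  0.\<close>

lemma u_Lq_limit_0: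
  assumes q: "1 \<le> q" and ui: "integrable lborel (\<lambda>x. \<bar>u0 x\<bar> powr q)"
  shows "((\<lambda>t. \<integral>x. \<bar>u t x - u0 x\<bar> powr q \<partial>lborel) \<longlongrightarrow> 0) (at_right 0)"
proof (rule tendsto_sandwich[OF _ _ tendsto_const])
  define I where "I = (\<integral>x. \<bar>u0 x\<bar> powr q \<partial>lborel)"
  have ui': "integrable lborel (\<lambda>x. \<bar>\<bar>u0 x\<bar>\<bar> powr q)" using ui by simp
  let ?B = "\<lambda>t. 2 powr q * ((\<integral>x. \<bar>heat (c t) u0 x - u0 x\<bar> powr q \<partial>lborel) + (reaction_bound * H t) powr q * I)"
  have "((\<lambda>t. (reaction_bound * H t) powr q) \<longlongrightarrow> (reaction_bound * 0) powr q) (at_right 0)"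
    by (rule tendsto_powr'[OF tendsto_mult[OF tendsto_const H_at_right_0] tendsto_const])
      (use q reaction_bound_nonneg H_nonneg in \<open>auto intro!: always_eventually\<close>)
  moreover have "((\<lambda>t. \<integral>x. \<bar>heat (c t) u0 x - u0 x\<bar> powr q \<partial>lborel) \<longlongrightarrow> 0) (at_right 0)"
    by (rule filterlim_compose[OF heat_Lq_limit[OF u0_measurable u0_bound q ui] c_at_right_0])
  ultimately have "(?B \<longlongrightarrow> 2 powr q * (0 + (reaction_bound * 0) powr q * I)) (at_right 0)"
    by (intro tendsto_mult tendsto_add tendsto_const)
  then show "(?B \<longlongrightarrow> 0) (at_right 0)" using q by simp
  show "eventually (\<lambda>t. (\<integral>x. \<bar>u t x - u0 x\<bar> powr q \<partial>lborel) \<le> ?B t) (at_right 0)"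
    using eventually_at_right_less[of 0]
  proof eventually_elim
    case (elim t)
    have q0: "0 \<le> q" using q by simp
    let ?a = "\<lambda>x. heat (c t) (\<lambda>y. \<bar>u0 y\<bar>) x"
    have a0: "0 \<le> ?a x" for x by (rule heat_nonneg) simp
    have ai: "integrable lborel (\<lambda>x. \<bar>?a x\<bar> powr q)"
      by (rule heat_powr_bound(4)[OF _ abs_u0_bound q ui' c_pos[OF elim]]) measurable
    have aI: "(\<integral>x. \<bar>?a x\<bar> powr q \<partial>lborel) \<le> I"
      using heat_powr_bound(5)[OF _ abs_u0_bound q ui' c_pos[OF elim]] by (simp add: I_def)
    have di: "integrable lborel (\<lambda>x. \<bar>heat (c t) u0 x - u0 x\<bar> powr q)"
      by (rule integrable_powr_diff[OF q0 _ _ heat_powr_bound(4)[OF u0_measurable u0_bound q ui c_pos[OF elim]] ui]) auto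
    let ?D = "\<lambda>x. 2 powr q * (\<bar>heat (c t) u0 x - u0 x\<bar> powr q + (reaction_bound * H t) powr q * \<bar>?a x\<bar> powr q)"
    have "(\<integral>x. \<bar>u t x - u0 x\<bar> powr q \<partial>lborel) \<le> (\<integral>x. ?D x \<partial>lborel)"
    proof (rule integral_mono')
      show "integrable lborel ?D" using di ai by simp
      fix x
      have "\<bar>u t x - u0 x\<bar> powr q = \<bar>(heat (c t) u0 x - u0 x) + (u t x - heat (c t) u0 x)\<bar> powr q" by simp
      also have "\<dots> \<le> 2 powr q * (\<bar>heat (c t) u0 x - u0 x\<bar> powr q + \<bar>u t x - heat (c t) u0 x\<bar> powr q)"
        by (rule abs_add_powr_le[OF q0])
      also have "\<bar>u t x - heat (c t) u0 x\<bar> powr q \<le> (reaction_bound * H t * ?a x) powr q"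
        using duhamel_reaction_le[of t x] elim q by (intro powr_mono2) (auto simp: free_def)
      also have "\<dots> = (reaction_bound * H t) powr q * \<bar>?a x\<bar> powr q"
        using a0[of x] reaction_bound_nonneg H_nonneg[of t] by (simp add: powr_mult)
      finally show "\<bar>u t x - u0 x\<bar> powr q \<le> ?D x" by (simp add: distrib_left)
    qed auto
    also have "\<dots> = 2 powr q * ((\<integral>x. \<bar>heat (c t) u0 x - u0 x\<bar> powr q \<partial>lborel) + (reaction_bound * H t) powr q * (\<integral>x. \<bar>?a x\<bar> powr q \<partial>lborel))"
      using di ai by simp
    also have "\<dots> \<le> ?B t" using aI by (intro mult_left_mono add_left_mono) auto
    finally show ?case .
  qed
qed auto

lemma u_weak_limit_0:
  assumes g[measurable]: "g \<in> borel_measurable borel" and gi: "integrable lborel g"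
  shows "((\<lambda>t. \<integral>x. (u t x - u0 x) * g x \<partial>lborel) \<longlongrightarrow> 0) (at_right 0)"
proof -
  let ?I = "\<integral>x. \<bar>g x\<bar> \<partial>lborel"
  let ?B = "\<lambda>t. \<bar>\<integral>x. (heat (c t) u0 x - u0 x) * g x \<partial>lborel\<bar> + reaction_bound * H t * R * ?I"
  have "((\<lambda>t. \<integral>x. (heat (c t) u0 x - u0 x) * g x \<partial>lborel) \<longlongrightarrow> 0) (at_right 0)"
    by (rule filterlim_compose[OF heat_weak_limit[OF u0_measurable u0_bound g gi] c_at_right_0])
  then have "(?B \<longlongrightarrow> \<bar>0\<bar> + reaction_bound * 0 * R * ?I) (at_right 0)"
    by (intro tendsto_intros H_at_right_0)
  then have lim: "(?B \<longlongrightarrow> 0) (at_right 0)" by simp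
  show ?thesis
  proof (rule Lim_null_comparison[OF _ lim])
    show "eventually (\<lambda>t. norm (\<integral>x. (u t x - u0 x) * g x \<partial>lborel) \<le> ?B t) (at_right 0)"
      using eventually_at_right_less[of 0]
    proof eventually_elim
      case (elim t)
      have bi: "integrable lborel (\<lambda>x. b x * g x)" if [measurable]: "b \<in> borel_measurable borel" and "\<And>x. \<bar>b x\<bar> \<le> M" for b M
      proof (rule Bochner_Integration.integrable_bound)
        show "integrable lborel (\<lambda>x. M * g x)" using gi by simp
        show "AE x in lborel. norm (b x * g x) \<le> norm (M * g x)"
          using that(2) by (auto simp: abs_mult intro!: AE_I2 mult_right_mono intro: order_trans[OF _ abs_ge_self])
      qed measurable
      have hb: "\<bar>heat (c t) u0 x\<bar> \<le> R" for x by (rule heat_bound[OF u0_measurable u0_bound])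
      have d1: "\<bar>heat (c t) u0 x - u0 x\<bar> \<le> 2 * R" for x using hb[of x] u0_bound[of x] by simp
      have d2: "\<bar>u t x - heat (c t) u0 x\<bar> \<le> reaction_bound * H t * R" for x
      proof -
        have "\<bar>u t x - heat (c t) u0 x\<bar> \<le> reaction_bound * H t * free (\<lambda>y. \<bar>u0 y\<bar>) t x"
          using duhamel_reaction_le[of t x] elim by (simp add: free_def)
        also have "\<dots> \<le> reaction_bound * H t * R"
          using free_abs_u0_bound[of t x] reaction_bound_nonneg H_nonneg[of t] by (intro mult_left_mono) auto
        finally show ?thesis .
      qed
      have i1: "integrable lborel (\<lambda>x. (heat (c t) u0 x - u0 x) * g x)" by (rule bi[OF _ d1]) measurable
      have i2: "integrable lborel (\<lambda>x. (u t x - heat (c t) u0 x) * g x)" by (rule bi[OF _ d2]) measurable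
      have "(\<integral>x. (u t x - u0 x) * g x \<partial>lborel) = (\<integral>x. (heat (c t) u0 x - u0 x) * g x + (u t x - heat (c t) u0 x) * g x \<partial>lborel)"
        by (intro Bochner_Integration.integral_cong refl) (simp add: algebra_simps)
      also have "\<dots> = (\<integral>x. (heat (c t) u0 x - u0 x) * g x \<partial>lborel) + (\<integral>x. (u t x - heat (c t) u0 x) * g x \<partial>lborel)"
        using i1 i2 by simp
      finally have eq: "(\<integral>x. (u t x - u0 x) * g x \<partial>lborel) = (\<integral>x. (heat (c t) u0 x - u0 x) * g x \<partial>lborel) + (\<integral>x. (u t x - heat (c t) u0 x) * g x \<partial>lborel)" .
      have "\<bar>\<integral>x. (u t x - heat (c t) u0 x) * g x \<partial>lborel\<bar> \<le> (\<integral>x. \<bar>(u t x - heat (c t) u0 x) * g x\<bar> \<partial>lborel)"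
        by (rule integral_abs_bound)
      also have "\<dots> \<le> (\<integral>x. reaction_bound * H t * R * \<bar>g x\<bar> \<partial>lborel)"
        using gi d2 by (intro integral_mono[OF integrable_abs[OF i2]]) (auto simp: abs_mult intro!: mult_right_mono)
      finally show ?case using eq by simp
    qed
  qed
qed

text \<open>The heat operator sees only the class of the data, so u0 may be replaced by its
  uniformly continuous version w, which inherits the bound R everywhere by continuity.\<close>

lemma u_uniform_limit_0:
  assumes w: "uniformly_continuous_on UNIV w" and uw: "AE x in lborel. u0 x = w x" and e: "0 < e"
  shows "eventually (\<lambda>t. \<forall>x. \<bar>u t x - w x\<bar> \<le> e) (at_right 0)"
proof -
  note wc = uniformly_continuous_imp_continuous[OF w]
  have [measurable]: "w \<in> borel_measurable borel" using wc by (rule borel_measurable_continuous_onI)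
  have "AE x in lborel. \<bar>w x\<bar> \<le> R"
    using uw
  proof eventually_elim
    case (elim x)
    then show ?case using u0_bound[of x] by simp
  qed
  then have wR: "\<bar>w x\<bar> \<le> R" for x by (rule continuous_AE_bound[OF wc])
  have "eventually (\<lambda>\<tau>. \<forall>x. \<bar>heat \<tau> w x - w x\<bar> \<le> e / 2) (at_right 0)"
    by (rule heat_uniform_limit[OF w wR]) (use e in simp)
  from eventually_compose_filterlim[OF this c_at_right_0]
  have 1: "eventually (\<lambda>t. \<forall>x. \<bar>heat (c t) w x - w x\<bar> \<le> e / 2) (at_right 0)" .
  have "((\<lambda>t. reaction_bound * H t * R) \<longlongrightarrow> reaction_bound * 0 * R) (at_right 0)"
    by (intro tendsto_intros H_at_right_0)
  then have 2: "eventually (\<lambda>t. reaction_bound * H t * R < e / 2) (at_right 0)"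
    by (rule order_tendstoD) (use e in simp)
  show ?thesis
    using 1 2 eventually_at_right_less[of 0]
  proof eventually_elim
    case (elim t)
    show ?case
    proof
      fix x
      have "heat (c t) u0 x = heat (c t) w x" by (rule heat_cong_AE[OF _ _ uw]) auto
      moreover have "\<bar>u t x - heat (c t) u0 x\<bar> \<le> reaction_bound * H t * free (\<lambda>y. \<bar>u0 y\<bar>) t x"
        using duhamel_reaction_le[of t x] elim by (simp add: free_def)
      moreover have "reaction_bound * H t * free (\<lambda>y. \<bar>u0 y\<bar>) t x \<le> reaction_bound * H t * R"
        using free_abs_u0_bound[of t x] reaction_bound_nonneg H_nonneg[of t] by (intro mult_left_mono) auto
      ultimately show "\<bar>u t x - w x\<bar> \<le> e" using elim(1)[rule_format, of x] elim(2) by linarith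
    qed
  qed
qed

end

lemma (in absorption) solution_exists: "\<exists>u. absorption_solution k h c p R u0 u"
proof -
  obtain u where u: "(\<lambda>(s, y). u s y) \<in> borel_measurable (borel \<Otimes>\<^sub>M borel)"
    "\<And>t x. lower t x \<le> u t x" "\<And>t x. u t x \<le> upper t x" "\<And>t x. u t x = picard u t x"
    using picard_fixed_point by blast
  have ub: "\<bar>u t x\<bar> \<le> R" for t x
    using u(2,3)[of t x] lower_bounds(2)[of t x] upper_bounds(2)[of t x] by linarith
  have "absorption_solution k h c p R u0 u"
    by unfold_locales (fact u(1) u(2) u(3) picard_fixed_point_mild[OF u(1) ub u(4)])+
  then show ?thesis by blast
qed

section \<open>Representatives in Lebesgue spaces\<close>

lemma AE_lebesgue_iff: "(AE x in lebesgue. P x) \<longleftrightarrow> (AE x in lborel. P x)"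
  by (rule AE_completion_iff)

lemma lebesgue_borel_representative:
  fixes f :: "'a::euclidean_space \<Rightarrow> real"
  assumes "f \<in> borel_measurable lebesgue"
  obtains g where "g \<in> borel_measurable borel" "AE x in lborel. f x = g x"
  using completion_ex_borel_measurable_real[OF assms] by auto

lemma lebesgue_measurable_AE_eq:
  fixes f g :: "'a::euclidean_space \<Rightarrow> real"
  assumes "g \<in> borel_measurable borel" "AE x in lborel. f x = g x"
  shows "f \<in> borel_measurable lebesgue"
proof (rule borel_measurable_AE)
  show "g \<in> borel_measurable lebesgue" using assms(1) by (simp add: measurable_completion)
  show "AE x in lebesgue. g x = f x" using assms(2) by (auto simp: AE_lebesgue_iff elim: eventually_mono)
qed

lemma integral_lebesgue_AE_eq:
  fixes f g :: "'a::euclidean_space \<Rightarrow> real"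
  assumes g: "g \<in> borel_measurable borel" and eq: "AE x in lborel. f x = g x"
  shows "(\<integral>x. f x \<partial>lebesgue) = (\<integral>x. g x \<partial>lborel)"
proof -
  have "(\<integral>x. f x \<partial>lebesgue) = (\<integral>x. g x \<partial>lebesgue)"
    using g eq lebesgue_measurable_AE_eq[OF g eq]
    by (intro integral_cong_AE) (auto simp: AE_lebesgue_iff measurable_completion)
  also have "\<dots> = (\<integral>x. g x \<partial>lborel)" using g by (intro integral_completion) simp
  finally show ?thesis .
qed

lemma Linf_norm_le:
  assumes f: "f \<in> borel_measurable lebesgue" and M: "AE x in lborel. \<bar>f x\<bar> \<le> M"
  shows "Lp_norm \<infinity> f \<le> ennreal M"
proof -
  have "AE x in lebesgue. ennreal \<bar>f x\<bar> \<le> ennreal M"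
    using M by (auto simp: AE_lebesgue_iff intro: ennreal_leI elim: eventually_mono)
  then show ?thesis unfolding Lp_norm_def using f by (auto intro: esssup_I)
qed

lemma Linf_norm_AE: "AE x in lborel. ennreal \<bar>f x\<bar> \<le> Lp_norm \<infinity> f"
  using esssup_AE[of "\<lambda>x. ennreal \<bar>f x\<bar>" lebesgue] by (simp add: Lp_norm_def AE_lebesgue_iff)

lemma Linf_norm_leD:
  assumes "Lp_norm \<infinity> f \<le> ennreal M" "0 \<le> M"
  shows "AE x in lborel. \<bar>f x\<bar> \<le> M"
  using Linf_norm_AE[of f]
proof eventually_elim
  case (elim x)
  then have "ennreal \<bar>f x\<bar> \<le> ennreal M" using assms(1) by (rule order_trans)
  then show ?case using assms(2) by simp
qed

lemma in_LinfI:
  assumes f: "f \<in> borel_measurable lebesgue" and M: "AE x in lborel. \<bar>f x\<bar> \<le> M"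
  shows "in_Lp \<infinity> f"
  using Linf_norm_le[OF assms] f by (auto simp: in_Lp_def intro: le_less_trans)

lemma in_LinfD:
  assumes "in_Lp \<infinity> f"
  obtains M where "0 \<le> M" "AE x in lborel. \<bar>f x\<bar> \<le> M"
proof
  show "0 \<le> enn2real (Lp_norm \<infinity> f)" by simp
  have "Lp_norm \<infinity> f = ennreal (enn2real (Lp_norm \<infinity> f))"
    using assms by (simp add: in_Lp_def)
  then show "AE x in lborel. \<bar>f x\<bar> \<le> enn2real (Lp_norm \<infinity> f)"
    by (intro Linf_norm_leD) auto
qed

lemma Linf_norm_tendsto_0:
  assumes "\<And>e. 0 < e \<Longrightarrow> eventually (\<lambda>t. Lp_norm \<infinity> (f t) \<le> ennreal e) F"
  shows "((\<lambda>t. Lp_norm \<infinity> (f t)) \<longlongrightarrow> 0) F"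
proof (rule order_tendstoI)
  fix a :: ennreal assume "0 < a"
  then obtain y where y: "0 < y" "y < a" using dense by blast
  then have "y < top" using top.not_eq_extremum by fastforce
  then have e: "0 < enn2real y" "ennreal (enn2real y) < a"
    using y by (simp_all add: enn2real_positive_iff)
  show "eventually (\<lambda>t. Lp_norm \<infinity> (f t) < a) F"
    using assms[OF e(1)] by eventually_elim (use e in auto)
qed auto

lemma in_Lp_finite_iff:
  fixes f :: "'a::euclidean_space \<Rightarrow> real"
  assumes r: "r \<noteq> \<infinity>" and f: "f \<in> borel_measurable borel"
  shows "in_Lp r f \<longleftrightarrow> integrable lborel (\<lambda>x. \<bar>f x\<bar> powr enn2real r)"
proof -
  note [measurable] = f
  have "(\<integral>\<^sup>+x. ennreal (\<bar>f x\<bar> powr enn2real r) \<partial>lebesgue) = (\<integral>\<^sup>+x. ennreal (\<bar>f x\<bar> powr enn2real r) \<partial>lborel)"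
    by (rule nn_integral_completion)
  moreover have "f \<in> borel_measurable lebesgue" using f by (simp add: measurable_completion)
  ultimately show ?thesis
    using r by (auto simp: in_Lp_def Lp_norm_def Let_def integrable_iff_bounded less_top[symmetric])
qed

lemma Lp_norm_finite_eq:
  fixes f :: "'a::euclidean_space \<Rightarrow> real"
  assumes r: "r \<noteq> \<infinity>" and f: "f \<in> borel_measurable borel" and i: "integrable lborel (\<lambda>x. \<bar>f x\<bar> powr enn2real r)"
  shows "Lp_norm r f = ennreal ((\<integral>x. \<bar>f x\<bar> powr enn2real r \<partial>lborel) powr (1 / enn2real r))"
proof -
  have "(\<integral>\<^sup>+x. ennreal (\<bar>f x\<bar> powr enn2real r) \<partial>lebesgue) = ennreal (\<integral>x. \<bar>f x\<bar> powr enn2real r \<partial>lborel)"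
    using i by (simp add: nn_integral_completion nn_integral_eq_integral)
  then show ?thesis using r by (simp add: Lp_norm_def)
qed

lemma Lp_norm_finite_tendsto_0:
  fixes f :: "'b \<Rightarrow> 'a::euclidean_space \<Rightarrow> real"
  assumes r: "r \<noteq> \<infinity>" "1 \<le> r" and f: "\<And>t. f t \<in> borel_measurable borel"
    and i: "eventually (\<lambda>t. integrable lborel (\<lambda>x. \<bar>f t x\<bar> powr enn2real r)) F"
    and lim: "((\<lambda>t. \<integral>x. \<bar>f t x\<bar> powr enn2real r \<partial>lborel) \<longlongrightarrow> 0) F"
  shows "((\<lambda>t. Lp_norm r (f t)) \<longlongrightarrow> 0) F"
proof -
  have q: "1 \<le> enn2real r" using r enn2real_mono[of 1 r] by (simp add: less_top)
  have "((\<lambda>t. (\<integral>x. \<bar>f t x\<bar> powr enn2real r \<partial>lborel) powr (1 / enn2real r)) \<longlongrightarrow> 0 powr (1 / enn2real r)) F"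
    by (rule tendsto_powr'[OF lim tendsto_const]) (use q in \<open>auto intro!: always_eventually\<close>)
  then have "((\<lambda>t. ennreal ((\<integral>x. \<bar>f t x\<bar> powr enn2real r \<partial>lborel) powr (1 / enn2real r))) \<longlongrightarrow> ennreal (0 powr (1 / enn2real r))) F"
    by (rule tendsto_ennrealI)
  then have "((\<lambda>t. ennreal ((\<integral>x. \<bar>f t x\<bar> powr enn2real r \<partial>lborel) powr (1 / enn2real r))) \<longlongrightarrow> 0) F" by simp
  then show ?thesis
    by (rule Lim_transform_eventually) (use i in \<open>eventually_elim, simp add: Lp_norm_finite_eq[OF r(1) f]\<close>)
qed

lemma Linf_simple_borel_representative:
  assumes "Linf_simple (\<phi> :: real \<Rightarrow> 'a::euclidean_space \<Rightarrow> real)"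
  shows "\<exists>\<psi>. (\<lambda>(t, x). \<psi> t x) \<in> borel_measurable (borel \<Otimes>\<^sub>M borel) \<and> (AE t in lborel. AE x in lborel. \<phi> t x = \<psi> t x)"
proof -
  obtain m :: nat and A :: "nat \<Rightarrow> real set" and g :: "nat \<Rightarrow> 'a \<Rightarrow> real"
    where A: "\<And>i. i < m \<Longrightarrow> A i \<in> sets lebesgue" and g: "\<And>i. i < m \<Longrightarrow> in_Lp \<infinity> (g i)"
      and \<phi>: "\<phi> = (\<lambda>t x. \<Sum>i<m. indicator (A i) t * g i x)"
    using assms unfolding Linf_simple_def by blast
  have "\<exists>a. a \<in> borel_measurable borel \<and> (AE t in lborel. indicator (A i) t = (a t :: real))" if "i < m" for i
    using lebesgue_borel_representative[of "indicator (A i) :: real \<Rightarrow> real"] A[OF that]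
    by (metis borel_measurable_indicator)
  then obtain a where a: "\<And>i. i < m \<Longrightarrow> a i \<in> borel_measurable borel"
      "\<And>i. i < m \<Longrightarrow> AE t in lborel. indicator (A i) t = (a i t :: real)" by metis
  have "\<exists>b. b \<in> borel_measurable borel \<and> (AE x in lborel. g i x = b x)" if "i < m" for i
    using lebesgue_borel_representative[of "g i"] g[OF that] by (metis in_Lp_def)
  then obtain b where b: "\<And>i. i < m \<Longrightarrow> b i \<in> borel_measurable borel"
      "\<And>i. i < m \<Longrightarrow> AE x in lborel. g i x = b i x" by metis
  define \<psi> where "\<psi> t x = (\<Sum>i<m. a i t * b i x)" for t x
  have "(\<lambda>(t, x). a i t * b i x) \<in> borel_measurable (borel \<Otimes>\<^sub>M borel)" if "i < m" for i
    using a(1)[OF that] b(1)[OF that] by measurable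
  then have "(\<lambda>(t, x). \<psi> t x) \<in> borel_measurable (borel \<Otimes>\<^sub>M borel)"
    unfolding \<psi>_def case_prod_unfold by (intro borel_measurable_sum) auto
  moreover have "AE t in lborel. AE x in lborel. \<phi> t x = \<psi> t x"
  proof -
    have aex: "AE x in lborel. \<forall>i\<in>{..<m}. g i x = b i x"
      using b(2) by (subst AE_finite_all) auto
    have "AE t in lborel. \<forall>i\<in>{..<m}. indicator (A i) t = a i t"
      using a(2) by (subst AE_finite_all) auto
    then show ?thesis
    proof eventually_elim
      case t: (elim t)
      from aex show ?case
      proof eventually_elim
        case (elim x)
        then show ?case using t unfolding \<phi> \<psi>_def by (intro sum.cong) auto
      qed
    qed
  qed
  ultimately show ?thesis by blast
qed

text \<open>The limit of Borel versions of the simple approximants is clipped to [-M, M], so it is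
  bounded even where those do not converge. Equality is stated for almost every t and then almost
  every x: the given curve carries no joint measurability.\<close>

lemma Linf_Linf_borel_representative:
  assumes v: "Linf_Linf T (v :: real \<Rightarrow> 'a::euclidean_space \<Rightarrow> real)"
  shows "\<exists>V M. (\<lambda>(t, x). V t x) \<in> borel_measurable (borel \<Otimes>\<^sub>M borel) \<and> (\<forall>t x. \<bar>V t x\<bar> \<le> M) \<and>
    (AE t in lborel. 0 \<le> t \<longrightarrow> t \<le> T \<longrightarrow> (AE x in lborel. v t x = V t x))"
proof -
  obtain M0 where "AE t in lebesgue. t \<in> {0..T} \<longrightarrow> Lp_norm \<infinity> (v t) \<le> ennreal M0"
    using v unfolding Linf_Linf_def by blast
  then have M0: "AE t in lborel. t \<in> {0..T} \<longrightarrow> Lp_norm \<infinity> (v t) \<le> ennreal M0"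
    by (simp add: AE_lebesgue_iff)
  define M where "M = max M0 0"
  obtain \<phi> :: "nat \<Rightarrow> real \<Rightarrow> 'a \<Rightarrow> real" where \<phi>: "\<And>k. Linf_simple (\<phi> k)"
    and lim: "AE t in lebesgue. t \<in> {0..T} \<longrightarrow> (\<lambda>k. Lp_norm \<infinity> (\<lambda>x. \<phi> k t x - v t x)) \<longlonglongrightarrow> 0"
    using v unfolding Linf_Linf_def Linf_strongly_measurable_on_def by blast
  obtain \<psi> where \<psi>m: "\<And>k. (\<lambda>(t, x). \<psi> k t x) \<in> borel_measurable (borel \<Otimes>\<^sub>M (borel :: 'a measure))"
    and \<psi>: "\<And>k. AE t in lborel. AE x in lborel. \<phi> k t x = \<psi> k t x"
    using Linf_simple_borel_representative[OF \<phi>] by metis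
  define V where "V t x = max (- M) (min M (lim (\<lambda>k. \<psi> k t x)))" for t x
  have Vm: "(\<lambda>(t, x). V t x) \<in> borel_measurable (borel \<Otimes>\<^sub>M borel)"
    using \<psi>m unfolding V_def case_prod_unfold by measurable
  have Vb: "\<bar>V t x\<bar> \<le> M" for t x by (auto simp: V_def M_def)
  have \<psi>': "AE t in lborel. \<forall>k. AE x in lborel. \<phi> k t x = \<psi> k t x"
    using \<psi> by (simp add: AE_all_countable)
  have "AE t in lborel. 0 \<le> t \<longrightarrow> t \<le> T \<longrightarrow> (AE x in lborel. v t x = V t x)"
    using \<psi>' M0 lim[unfolded AE_lebesgue_iff]
  proof eventually_elim
    case (elim t)
    show ?case
    proof (intro impI)
      assume t: "0 \<le> t" "t \<le> T"
      have "Lp_norm \<infinity> (v t) \<le> ennreal M"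
        using elim(2) t by (auto simp: M_def intro: order_trans ennreal_leI)
      then have vM: "AE x in lborel. \<bar>v t x\<bar> \<le> M" by (rule Linf_norm_leD) (simp add: M_def)
      have eq: "AE x in lborel. \<forall>k. \<phi> k t x = \<psi> k t x" using elim(1) by (simp add: AE_all_countable)
      have le: "AE x in lborel. \<forall>k. ennreal \<bar>\<phi> k t x - v t x\<bar> \<le> Lp_norm \<infinity> (\<lambda>x. \<phi> k t x - v t x)"
        using Linf_norm_AE by (auto simp: AE_all_countable)
      have nl: "(\<lambda>k. Lp_norm \<infinity> (\<lambda>x. \<phi> k t x - v t x)) \<longlonglongrightarrow> 0" using elim(3) t by simp
      show "AE x in lborel. v t x = V t x"
        using vM eq le
      proof eventually_elim
        case (elim x)
        have "(\<lambda>k. ennreal \<bar>\<phi> k t x - v t x\<bar>) \<longlonglongrightarrow> 0"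
          by (rule tendsto_sandwich[OF _ _ tendsto_const nl]) (use elim(3) in \<open>auto intro!: always_eventually\<close>)
        then have "(\<lambda>k. ennreal \<bar>\<phi> k t x - v t x\<bar>) \<longlonglongrightarrow> ennreal 0" by simp
        then have "(\<lambda>k. \<bar>\<phi> k t x - v t x\<bar>) \<longlonglongrightarrow> 0" by (subst (asm) tendsto_ennreal_iff) auto
        then have "(\<lambda>k. \<phi> k t x - v t x) \<longlonglongrightarrow> 0" by (rule tendsto_rabs_zero_cancel)
        then have "(\<lambda>k. \<phi> k t x) \<longlonglongrightarrow> v t x" by (rule LIM_zero_cancel)
        then have "lim (\<lambda>k. \<psi> k t x) = v t x" using elim(2) by (auto intro: limI)
        then show ?case using elim(1) by (auto simp: V_def)
      qed
    qed
  qed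
  then show ?thesis using Vm Vb by blast
qed

text \<open>The curve is sampled at the left ends of a time grid of mesh 1/(n+1). Convergence is
  asked at positive times, where the solution is norm continuous; time 0 is a null set.\<close>

lemma strongly_measurable_of_continuous:
  fixes u :: "real \<Rightarrow> 'a::euclidean_space \<Rightarrow> real"
  assumes u: "\<And>t. 0 \<le> t \<Longrightarrow> in_Lp \<infinity> (u t)"
    and lim: "\<And>t0 X. 0 < t0 \<Longrightarrow> X \<longlonglongrightarrow> t0 \<Longrightarrow> (\<lambda>n. Lp_norm \<infinity> (\<lambda>x. u (X n) x - u t0 x)) \<longlonglongrightarrow> 0"
  shows "Linf_strongly_measurable_on {0..T} u"
proof -
  define A where "A n i = {real i / real (Suc n) ..< real (Suc i) / real (Suc n)}" for n i :: nat
  \<comment> \<open>(n+1)^2 cells of length 1/(n+1) reach up to time n + 1, hence eventually past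
    any given t.\<close>
  define \<phi> where "\<phi> n t x = (\<Sum>i<Suc n * Suc n. indicator (A n i) t * u (real i / real (Suc n)) x)" for n t x
  have "Linf_simple (\<phi> n)" for n
    unfolding Linf_simple_def
  proof (intro exI conjI allI impI)
    show "A n i \<in> sets lebesgue" for i by (simp add: A_def)
    show "in_Lp \<infinity> (u (real i / real (Suc n)))" for i by (rule u) simp
    show "\<phi> n = (\<lambda>t x. \<Sum>i<Suc n * Suc n. indicator (A n i) t * u (real i / real (Suc n)) x)"
      unfolding \<phi>_def[abs_def] ..
  qed
  moreover have "AE t in lebesgue. t \<in> {0..T} \<longrightarrow> (\<lambda>k. Lp_norm \<infinity> (\<lambda>x. \<phi> k t x - u t x)) \<longlonglongrightarrow> 0"
  proof -
    have "AE t in lborel. t \<noteq> (0::real)" by (rule AE_lborel_singleton)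
    then have "AE t in lborel. t \<in> {0..T} \<longrightarrow> (\<lambda>k. Lp_norm \<infinity> (\<lambda>x. \<phi> k t x - u t x)) \<longlonglongrightarrow> 0"
    proof (eventually_elim, intro impI)
      fix t :: real assume "t \<noteq> 0" "t \<in> {0..T}"
      then have t: "0 < t" by simp
      define j where "j n = nat \<lfloor>t * real (Suc n)\<rfloor>" for n
      define X where "X n = real (j n) / real (Suc n)" for n
      have j: "real (j n) \<le> t * real (Suc n)" "t * real (Suc n) < real (Suc (j n))" for n
        using t by (auto simp: j_def) linarith+
      have "X \<longlonglongrightarrow> t"
      proof (rule tendsto_sandwich[of "\<lambda>n. t - 1 / real (Suc n)" _ _ "\<lambda>n. t"])
        show "eventually (\<lambda>n. t - 1 / real (Suc n) \<le> X n) sequentially"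
        proof (rule always_eventually, rule allI)
          fix n
          have "t < real (Suc (j n)) / real (Suc n)"
            using j(2)[of n] by (simp only: pos_less_divide_eq of_nat_0_less_iff zero_less_Suc)
          also have "\<dots> = X n + 1 / real (Suc n)"
            by (simp only: X_def of_nat_Suc[of "j n"] add_divide_distrib)
          finally show "t - 1 / real (Suc n) \<le> X n" by simp
        qed
        show "eventually (\<lambda>n. X n \<le> t) sequentially"
          using j(1) by (auto simp: X_def field_simps intro!: always_eventually)
        show "(\<lambda>n. t - 1 / real (Suc n)) \<longlonglongrightarrow> t" by real_asymp
      qed simp
      then have L: "(\<lambda>n. Lp_norm \<infinity> (\<lambda>x. u (X n) x - u t x)) \<longlonglongrightarrow> 0" by (rule lim[OF t])
      have A_iff: "t \<in> A n i \<longleftrightarrow> i = j n" for n i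
      proof
        assume "t \<in> A n i"
        then have "real i \<le> t * real (Suc n)" "t * real (Suc n) < real (Suc i)"
          by (auto simp: A_def field_simps)
        then have "real i < real (Suc (j n))" "real (j n) < real (Suc i)" using j[of n] by linarith+
        then show "i = j n" by simp
      qed (use j[of n] in \<open>auto simp: A_def field_simps\<close>)
      have "eventually (\<lambda>n. t < real (Suc n)) sequentially" by real_asymp
      then have "eventually (\<lambda>n. Lp_norm \<infinity> (\<lambda>x. u (X n) x - u t x) = Lp_norm \<infinity> (\<lambda>x. \<phi> n t x - u t x)) sequentially"
      proof eventually_elim
        case (elim n)
        have "t * real (Suc n) < real (Suc n) * real (Suc n)" using elim by (intro mult_strict_right_mono) auto
        then have "real (j n) < real (Suc n * Suc n)" using j(1)[of n] by (simp only: of_nat_mult)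
        then have jn: "j n < Suc n * Suc n" by (simp only: of_nat_less_iff)
        have "\<phi> n t x = u (X n) x" for x
        proof -
          have "\<phi> n t x = (\<Sum>i<Suc n * Suc n. if i = j n then u (real i / real (Suc n)) x else 0)"
            unfolding \<phi>_def by (intro sum.cong refl) (auto simp: indicator_def A_iff)
          also have "\<dots> = u (X n) x" using jn by (simp only: sum.delta finite_lessThan lessThan_iff X_def if_True)
          finally show ?thesis .
        qed
        then show ?case by simp
      qed
      then show "(\<lambda>k. Lp_norm \<infinity> (\<lambda>x. \<phi> k t x - u t x)) \<longlonglongrightarrow> 0"
        by (rule Lim_transform_eventually[OF L])
    qed
    then show ?thesis by (simp add: AE_lebesgue_iff)
  qed
  ultimately show ?thesis unfolding Linf_strongly_measurable_on_def by blast
qed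

section \<open>The heat kernel, the clock and the data as instances of the abstract setting\<close>

lemma heat_kernel_convolution_semigroup:
  assumes "0 < \<alpha>" "\<alpha> < 2"
  shows "convolution_semigroup (heat_kernel \<alpha> :: real \<Rightarrow> 'a::euclidean_space \<Rightarrow> real)"
proof
  show "(\<lambda>(\<tau>, x). heat_kernel \<alpha> \<tau> (x :: 'a)) \<in> borel_measurable (borel \<Otimes>\<^sub>M borel)"
    by (rule heat_kernel_measurable)
  show "(\<integral>x. heat_kernel \<alpha> \<tau> (x :: 'a) \<partial>lborel) = 1" if "0 < \<tau>" for \<tau>
    using heat_kernel_integral[OF that assms, where 'a='a] by (simp add: has_bochner_integral_iff)
  show "heat_kernel \<alpha> \<tau> x = 0" if "\<tau> \<le> 0" for \<tau> and x :: 'a using that by (simp add: heat_kernel_def)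
qed (use assms in \<open>auto intro: heat_kernel_nonneg heat_kernel_minus integrable_heat_kernel
    heat_kernel_semigroup heat_kernel_L1_continuous heat_kernel_concentrates\<close>)

lemma clock_mono: "0 \<le> \<beta> \<Longrightarrow> 0 \<le> s \<Longrightarrow> s < t \<Longrightarrow> clock \<beta> s < clock \<beta> t"
  by (auto simp: clock_def intro!: divide_strict_right_mono powr_less_mono2)

lemma clock_zero: "clock \<beta> 0 = 0"
  by (simp add: clock_def)

lemma clock_continuous: "0 \<le> \<beta> \<Longrightarrow> continuous_on {0..} (clock \<beta>)"
  unfolding clock_def by (intro continuous_intros continuous_on_powr') auto

text \<open>Measurability on the half-line is obtained as a limit over the intervals (0, n). The
  maximum with 0 makes the representative nonnegative at every point, while changing nothing at
  almost every positive time.\<close>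

lemma locally_integrable_borel_representative:
  assumes h: "locally_integrable_halfline h" and pos: "\<And>t. 0 < t \<Longrightarrow> 0 < h t"
  shows "\<exists>g. g \<in> borel_measurable borel \<and> (\<forall>s. 0 \<le> g s) \<and> (AE s in lborel. 0 < s \<longrightarrow> h s = g s) \<and>
    (\<forall>b. integrable lborel (\<lambda>s. indicator {0<..<b} s * g s))"
proof -
  have hi: "integrable lebesgue (\<lambda>s. indicator {0<..<b} s * h s)" for b
  proof (cases "0 < b")
    case True
    then show ?thesis using h by (simp add: locally_integrable_halfline_def set_integrable_def)
  qed simp
  have "(\<lambda>s. indicator {0<..} s * h s) \<in> borel_measurable lebesgue"
  proof (rule borel_measurable_LIMSEQ_real)
    show "(\<lambda>n. indicator {0<..<real n} s * h s) \<longlonglongrightarrow> indicator {0<..} s * h s" for s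
    proof -
      have "eventually (\<lambda>n. s < real n) sequentially" by real_asymp
      then have "eventually (\<lambda>n. indicator {0<..} s * h s = indicator {0<..<real n} s * h s) sequentially"
        by eventually_elim (auto simp: indicator_def)
      then show ?thesis by (rule Lim_transform_eventually[OF tendsto_const])
    qed
    show "(\<lambda>s. indicator {0<..<real n} s * h s) \<in> borel_measurable lebesgue" for n
      using hi[of n] by (rule borel_measurable_integrable)
  qed
  then obtain g0 where g0: "g0 \<in> borel_measurable borel" "AE s in lborel. indicator {0<..} s * h s = g0 s"
    by (rule lebesgue_borel_representative)
  define g where "g s = max 0 (g0 s)" for s
  have gm: "g \<in> borel_measurable borel" unfolding g_def using g0(1) by measurable
  have ae: "AE s in lborel. 0 < s \<longrightarrow> h s = g s"
    using g0(2)
  proof (eventually_elim, intro impI)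
    fix s assume "indicator {0<..} s * h s = g0 s" "0 < s"
    then show "h s = g s" using pos[of s] by (simp add: g_def)
  qed
  have "integrable lborel (\<lambda>s. indicator {0<..<b} s * g s)" for b
  proof -
    have m: "(\<lambda>s. indicator {0<..<b} s * g s) \<in> borel_measurable borel" using gm by measurable
    have "integrable lebesgue (\<lambda>s. indicator {0<..<b} s * g s)"
    proof (rule integrable_cong_AE_imp[OF hi[of b]])
      show "(\<lambda>s. indicator {0<..<b} s * g s) \<in> borel_measurable lebesgue" using m by (simp add: measurable_completion)
      show "AE s in lebesgue. indicator {0<..<b} s * h s = indicator {0<..<b} s * g s"
        unfolding AE_lebesgue_iff using ae by eventually_elim (auto simp: indicator_def)
    qed
    then show ?thesis using m by (subst (asm) integrable_completion) auto
  qed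
  then show ?thesis using gm ae by (intro exI[of _ g]) (auto simp: g_def)
qed

lemma Linf_borel_representative:
  assumes "in_Lp \<infinity> (f :: 'a::euclidean_space \<Rightarrow> real)"
  shows "\<exists>g R. g \<in> borel_measurable borel \<and> 0 < R \<and> (\<forall>x. \<bar>g x\<bar> \<le> R) \<and> (AE x in lborel. f x = g x) \<and>
    ((AE x in lborel. 0 \<le> f x) \<longrightarrow> (\<forall>x. 0 \<le> g x))"
proof -
  obtain M where M: "0 \<le> M" "AE x in lborel. \<bar>f x\<bar> \<le> M" using in_LinfD[OF assms] .
  obtain g0 where g0: "g0 \<in> borel_measurable borel" "AE x in lborel. f x = g0 x"
    using assms lebesgue_borel_representative by (auto simp: in_Lp_def)
  \<comment> \<open>Clipping from below at 0 for nonnegative data makes the representative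
    nonnegative everywhere; M + 1 in the other bounds keeps R positive even for M = 0.\<close>
  define l where "l = (if AE x in lborel. 0 \<le> f x then 0 else - (M + 1))"
  define g where "g x = max l (min (M + 1) (g0 x))" for x
  have "AE x in lborel. l \<le> f x"
    using M by (auto simp: l_def elim!: eventually_mono)
  with M(2) g0(2) have "AE x in lborel. f x = g x"
    by eventually_elim (auto simp: g_def)
  moreover have "g \<in> borel_measurable borel" unfolding g_def using g0(1) by measurable
  ultimately show ?thesis using M(1) by (intro exI[of _ g] exI[of _ "M + 1"]) (auto simp: g_def l_def)
qed

section \<open>Well-posedness\<close>

text \<open>Here \<open>h0\<close> and \<open>v0\<close> are the given data, and \<open>h\<close>
  and \<open>u0\<close> the Borel representatives for which the solution has been
  constructed.\<close>

locale heat_absorption = absorption_solution "heat_kernel \<alpha>" h "clock \<beta>" p R u0 u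
  for \<alpha> \<beta> :: real and h :: "real \<Rightarrow> real" and p R :: real
    and u0 :: "'a::euclidean_space \<Rightarrow> real" and u :: "real \<Rightarrow> 'a \<Rightarrow> real" +
  fixes h0 :: "real \<Rightarrow> real" and v0 :: "'a \<Rightarrow> real"
  assumes alpha_pos: "0 < \<alpha>"
    and h0_eq: "AE s in lborel. 0 < s \<longrightarrow> h0 s = h s"
    and v0_eq: "AE x in lborel. v0 x = u0 x"
begin

lemma mixed_heat_eq_heat:
  assumes t: "0 < \<tau>" and g: "g \<in> borel_measurable borel" and eq: "AE y in lborel. f y = g y"
  shows "mixed_heat \<alpha> \<tau> f x = heat \<tau> g x"
proof -
  have m: "(\<lambda>y. heat_kernel \<alpha> \<tau> (x - y) * g y) \<in> borel_measurable borel" using g by measurable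
  have "mixed_heat \<alpha> \<tau> f x = (\<integral>y. heat_kernel \<alpha> \<tau> (x - y) * f y \<partial>lebesgue)"
    using t by (simp add: mixed_heat_def Defs.convolution_def mixed_kernel_eq_heat_kernel[OF t alpha_pos])
  also have "\<dots> = (\<integral>y. heat_kernel \<alpha> \<tau> (x - y) * g y \<partial>lborel)"
    by (rule integral_lebesgue_AE_eq[OF m]) (use eq in \<open>auto elim!: eventually_mono\<close>)
  finally show ?thesis by (simp add: heat_def)
qed

lemma mixed_heat_initial:
  assumes "0 \<le> t"
  shows "AE x in lborel. mixed_heat \<alpha> (clock \<beta> t) v0 x = free u0 t x"
proof (cases "t = 0")
  case True
  then show ?thesis using v0_eq by (simp add: mixed_heat_def free_def c_zero)
next
  case False
  then have "0 < t" using assms by simp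
  then show ?thesis
    using mixed_heat_eq_heat[OF c_pos u0_measurable v0_eq] by (simp add: free_def)
qed

text \<open>At positive elapsed time the heat operator depends only on the class of its argument, so
  for almost every s the integrand can be computed from Borel representatives, at every point
  x.\<close>

lemma duhamel_eq:
  assumes V: "(\<lambda>(s, y). V s y) \<in> borel_measurable (borel \<Otimes>\<^sub>M borel)"
    and eq: "AE s in lborel. 0 < s \<longrightarrow> s < t \<longrightarrow> (AE y in lborel. v s y = V s y)"
  shows "(LINT s:{0<..<t}|lebesgue. h0 s * mixed_heat \<alpha> (clock \<beta> t - clock \<beta> s) (\<lambda>y. signed_power p (v s y)) x)
    = duhamel (\<lambda>s y. signed_power p (V s y)) t x"
proof -
  have N: "(\<lambda>(s, y). signed_power p (V s y)) \<in> borel_measurable (borel \<Otimes>\<^sub>M borel)" using V by measurable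
  note [measurable] = heat_shift_measurable[OF N]
  show ?thesis
    unfolding duhamel_def set_lebesgue_integral_def
  proof (rule integral_lebesgue_AE_eq)
    show "(\<lambda>s. indicator {0<..<t} s * (h s * heat (clock \<beta> t - clock \<beta> s) (\<lambda>y. signed_power p (V s y)) x)) \<in> borel_measurable borel"
      by measurable
    show "AE s in lborel. indicat_real {0<..<t} s *\<^sub>R (h0 s * mixed_heat \<alpha> (clock \<beta> t - clock \<beta> s) (\<lambda>y. signed_power p (v s y)) x) =
      indicator {0<..<t} s * (h s * heat (clock \<beta> t - clock \<beta> s) (\<lambda>y. signed_power p (V s y)) x)"
      using h0_eq eq
    proof eventually_elim
      case (elim s)
      show ?case
      proof (cases "s \<in> {0<..<t}")
        case True
        then have "AE y in lborel. v s y = V s y" using elim by auto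
        then have "AE y in lborel. signed_power p (v s y) = signed_power p (V s y)" by eventually_elim simp
        then have "mixed_heat \<alpha> (clock \<beta> t - clock \<beta> s) (\<lambda>y. signed_power p (v s y)) x = heat (clock \<beta> t - clock \<beta> s) (\<lambda>y. signed_power p (V s y)) x"
          using True c_strict_mono[of s t] by (intro mixed_heat_eq_heat pair_measurable_section[OF N]) auto
        then show ?thesis using True elim by simp
      qed simp
    qed
  qed
qed

lemma u_lebesgue_measurable: "u t \<in> borel_measurable lebesgue"
  by (simp add: measurable_completion)

lemma u_in_Linf: "in_Lp \<infinity> (u t)"
  by (rule in_LinfI[OF u_lebesgue_measurable, of _ R]) (simp add: u_bound)

lemma Linf_diff_le:
  assumes "\<And>x. \<bar>u s x - u t x\<bar> \<le> e"
  shows "Lp_norm \<infinity> (\<lambda>x. u s x - u t x) \<le> ennreal e"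
  by (rule Linf_norm_le) (use assms in \<open>auto intro!: borel_measurable_diff u_lebesgue_measurable\<close>)

lemma u_Linf_seq:
  assumes t0: "0 < t0" and X: "X \<longlonglongrightarrow> t0"
  shows "(\<lambda>n. Lp_norm \<infinity> (\<lambda>x. u (X n) x - u t0 x)) \<longlonglongrightarrow> 0"
proof (rule Linf_norm_tendsto_0)
  fix e :: real assume e: "0 < e"
  obtain \<eta> where \<eta>: "\<eta> \<longlonglongrightarrow> 0" "eventually (\<lambda>n. \<forall>x. \<bar>u (X n) x - u t0 x\<bar> \<le> \<eta> n) sequentially"
    using u_uniform_seq[OF t0 X] by blast
  have "eventually (\<lambda>n. \<eta> n < e) sequentially" by (rule order_tendstoD(2)[OF \<eta>(1) e])
  with \<eta>(2) show "eventually (\<lambda>n. Lp_norm \<infinity> (\<lambda>x. u (X n) x - u t0 x) \<le> ennreal e) sequentially"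
  proof eventually_elim
    case (elim n)
    show ?case by (rule Linf_diff_le) (use elim in \<open>auto intro: order_trans less_imp_le\<close>)
  qed
qed

lemma u_solution: "Linf_solution_on \<alpha> \<beta> p h0 v0 T u"
  unfolding Linf_solution_on_def Linf_Linf_def
proof (intro conjI ballI)
  show "Linf_strongly_measurable_on {0..T} u"
    by (rule strongly_measurable_of_continuous[OF u_in_Linf u_Linf_seq])
  show "\<exists>M. AE t in lebesgue. t \<in> {0..T} \<longrightarrow> Lp_norm \<infinity> (u t) \<le> ennreal M"
    using Linf_norm_le[OF u_lebesgue_measurable, of _ R] by (intro exI[of _ R]) (simp add: u_bound)
  fix t assume t: "t \<in> {0..T}"
  have "AE x in lborel. mixed_heat \<alpha> (clock \<beta> t) v0 x = free u0 t x"
    using t by (intro mixed_heat_initial) simp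
  then show "AE x in lebesgue. u t x = mixed_heat \<alpha> (clock \<beta> t) v0 x -
      (LINT s:{0<..<t}|lebesgue. h0 s * mixed_heat \<alpha> (clock \<beta> t - clock \<beta> s) (\<lambda>y. signed_power p (u s y)) x)"
    unfolding AE_lebesgue_iff
  proof eventually_elim
    case (elim x)
    have "(LINT s:{0<..<t}|lebesgue. h0 s * mixed_heat \<alpha> (clock \<beta> t - clock \<beta> s) (\<lambda>y. signed_power p (u s y)) x)
      = duhamel (\<lambda>s y. signed_power p (u s y)) t x"
      by (rule duhamel_eq[OF u_measurable]) simp
    then show ?case using elim u_mild[of t x] by simp
  qed
qed (rule u_in_Linf)

text \<open>The competitor is replaced by a Borel representative inside the time integral only; at
  each fixed t the equation still holds for the competitor itself, as
  \<open>mild_solution_unique\<close> requires.\<close>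

lemma u_unique:
  assumes v: "Linf_solution_on \<alpha> \<beta> p h0 v0 T v"
  shows "agree_on {0..T} v u"
  unfolding agree_on_def AE_lebesgue_iff
proof
  fix t assume t: "t \<in> {0..T}"
  have "Linf_Linf T v" using v by (simp add: Linf_solution_on_def)
  then obtain V M where V: "(\<lambda>(s, y). V s y) \<in> borel_measurable (borel \<Otimes>\<^sub>M borel)" "\<And>s y. \<bar>V s y\<bar> \<le> M"
    and vV: "AE s in lborel. 0 \<le> s \<longrightarrow> s \<le> T \<longrightarrow> (AE x in lborel. v s x = V s x)"
    using Linf_Linf_borel_representative[of T v] by auto
  have eqn: "AE x in lborel. v t x = free u0 t x - duhamel (\<lambda>s y. signed_power p (V s y)) t x" if t: "0 \<le> t" "t \<le> T" for t
  proof -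
    have "AE x in lborel. v t x = mixed_heat \<alpha> (clock \<beta> t) v0 x -
      (LINT s:{0<..<t}|lebesgue. h0 s * mixed_heat \<alpha> (clock \<beta> t - clock \<beta> s) (\<lambda>y. signed_power p (v s y)) x)"
      using v t by (simp add: Linf_solution_on_def AE_lebesgue_iff)
    then show ?thesis
      using mixed_heat_initial[OF t(1)]
    proof eventually_elim
      case (elim x)
      have "AE s in lborel. 0 < s \<longrightarrow> s < t \<longrightarrow> (AE y in lborel. v s y = V s y)"
        using vV by eventually_elim (use t in auto)
      then show ?case using elim duhamel_eq[OF V(1), of t v x] by simp
    qed
  qed
  show "AE x in lborel. v t x = u t x"
  proof (rule mild_solution_unique[where u = u and v = V and V = v and T = T and M = "max R M"])
    show "\<bar>u s y\<bar> \<le> max R M" for s y using u_bound[of s y] by simp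
    show "\<bar>V s y\<bar> \<le> max R M" for s y using V(2)[of s y] by simp
    show "u s y = free u0 s y - duhamel (\<lambda>s y. signed_power p (u s y)) s y" for s y by (rule u_mild)
  qed (use t in \<open>auto intro: u_measurable V(1) eqn vV\<close>)
qed

lemma u_Linf_limit:
  assumes "0 < t"
  shows "((\<lambda>s. Lp_norm \<infinity> (\<lambda>x. u s x - u t x)) \<longlongrightarrow> 0) (at t)"
proof (rule Linf_norm_tendsto_0)
  fix e :: real assume "0 < e"
  from u_uniform_limit[OF assms this]
  show "eventually (\<lambda>s. Lp_norm \<infinity> (\<lambda>x. u s x - u t x) \<le> ennreal e) (at t)"
  proof eventually_elim
    case (elim s)
    show ?case by (rule Linf_diff_le) (use elim in auto)
  qed
qed

lemma u_Linf_limit_0: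
  assumes w: "uniformly_continuous_on UNIV w" and v0w: "AE x in lebesgue. v0 x = w x"
  shows "((\<lambda>s. Lp_norm \<infinity> (\<lambda>x. u s x - u 0 x)) \<longlongrightarrow> 0) (at_right 0)"
proof (rule Linf_norm_tendsto_0)
  fix e :: real assume e: "0 < e"
  have uw: "AE x in lborel. u0 x = w x"
    using v0w[unfolded AE_lebesgue_iff] v0_eq by eventually_elim simp
  from u_uniform_limit_0[OF w uw e]
  show "eventually (\<lambda>s. Lp_norm \<infinity> (\<lambda>x. u s x - u 0 x) \<le> ennreal e) (at_right 0)"
  proof eventually_elim
    case (elim s)
    show ?case
    proof (rule Linf_norm_le)
      show "(\<lambda>x. u s x - u 0 x) \<in> borel_measurable lebesgue"
        by (intro borel_measurable_diff u_lebesgue_measurable)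
      show "AE x in lborel. \<bar>u s x - u 0 x\<bar> \<le> e"
        using uw
      proof eventually_elim
        case (elim x)
        then show ?case using \<open>\<forall>x. \<bar>u s x - w x\<bar> \<le> e\<close>[rule_format, of x] by (simp add: u_initial)
      qed
    qed
  qed
qed

lemma u0_Lq:
  assumes r: "r \<noteq> \<infinity>" and v0: "in_Lp r v0"
  shows "integrable lborel (\<lambda>x. \<bar>u0 x\<bar> powr enn2real r)"
proof -
  have "(\<integral>\<^sup>+x. ennreal (\<bar>v0 x\<bar> powr enn2real r) \<partial>lebesgue) = (\<integral>\<^sup>+x. ennreal (\<bar>u0 x\<bar> powr enn2real r) \<partial>lebesgue)"
    by (rule nn_integral_cong_AE) (use v0_eq in \<open>auto simp: AE_lebesgue_iff elim!: eventually_mono\<close>)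
  then have "in_Lp r u0"
    using v0 r by (simp add: in_Lp_def Lp_norm_def Let_def measurable_completion)
  then show ?thesis by (simp add: in_Lp_finite_iff[OF r u0_measurable])
qed

lemma u_Lr_limits:
  assumes r: "r \<noteq> \<infinity>" "1 \<le> r" and v0: "in_Lp r v0"
  shows "0 \<le> t \<Longrightarrow> in_Lp r (u t)"
    and "0 < t \<Longrightarrow> ((\<lambda>s. Lp_norm r (\<lambda>x. u s x - u t x)) \<longlongrightarrow> 0) (at t)"
    and "((\<lambda>s. Lp_norm r (\<lambda>x. u s x - u 0 x)) \<longlongrightarrow> 0) (at_right 0)"
proof -
  have q: "1 \<le> enn2real r" using r enn2real_mono[of 1 r] by (simp add: less_top)
  note ui = u0_Lq[OF r(1) v0]
  note int = u_Lq_integrable[OF q ui]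
  have idiff: "integrable lborel (\<lambda>x. \<bar>u s x - u t x\<bar> powr enn2real r)" if "0 \<le> s" "0 \<le> t" for s t
    by (rule integrable_powr_diff[OF _ _ _ int[OF that(1)] int[OF that(2)]]) (use q in auto)
  show "in_Lp r (u t)" if "0 \<le> t"
    using int[OF that] by (simp add: in_Lp_finite_iff[OF r(1)])
  show "((\<lambda>s. Lp_norm r (\<lambda>x. u s x - u t x)) \<longlongrightarrow> 0) (at t)" if t: "0 < t"
  proof (rule Lp_norm_finite_tendsto_0[OF r _ _ u_Lq_limit[OF q ui t]])
    have "eventually (\<lambda>s. 0 < s) (at t)" using t by (intro order_tendstoD(1)[OF tendsto_ident_at])
    then show "eventually (\<lambda>s. integrable lborel (\<lambda>x. \<bar>u s x - u t x\<bar> powr enn2real r)) (at t)"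
      by eventually_elim (use t idiff in auto)
  qed measurable
  show "((\<lambda>s. Lp_norm r (\<lambda>x. u s x - u 0 x)) \<longlongrightarrow> 0) (at_right 0)"
  proof (rule Lp_norm_finite_tendsto_0[OF r])
    show "((\<lambda>s. \<integral>x. \<bar>u s x - u 0 x\<bar> powr enn2real r \<partial>lborel) \<longlongrightarrow> 0) (at_right 0)"
      using u_Lq_limit_0[OF q ui] by (simp add: u_initial)
    show "eventually (\<lambda>s. integrable lborel (\<lambda>x. \<bar>u s x - u 0 x\<bar> powr enn2real r)) (at_right 0)"
      using eventually_at_right_less[of 0] by eventually_elim (auto intro: idiff)
  qed measurable
qed

lemma tendsto_at_halfline:
  fixes f :: "real \<Rightarrow> 'c::topological_space"
  assumes "0 \<le> t" "0 < t \<Longrightarrow> (f \<longlongrightarrow> l) (at t)" "t = 0 \<Longrightarrow> (f \<longlongrightarrow> l) (at_right 0)"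
  shows "(f \<longlongrightarrow> l) (at t within {0..})"
proof (cases "t = 0")
  case True
  then show ?thesis using assms(3) by (simp add: at_within_Ici_at_right)
next
  case False
  then have "(f \<longlongrightarrow> l) (at t)" using assms(1,2) by simp
  then show ?thesis by (rule tendsto_within_subset) simp
qed

text \<open>At positive times uniform convergence suffices; at time 0 only the weak limit is
  available, through the symmetry of the heat operator.\<close>

lemma u_weak_continuous: "Linf_weak_star_continuous_on {0..} u"
  unfolding Linf_weak_star_continuous_on_def
proof (intro conjI ballI allI impI)
  fix g :: "'a \<Rightarrow> real" assume g: "in_Lp 1 g"
  then have gl: "g \<in> borel_measurable lebesgue" by (simp add: in_Lp_def)
  then obtain G where G[measurable]: "G \<in> borel_measurable borel" and gG: "AE x in lborel. g x = G x"
    by (rule lebesgue_borel_representative)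
  have "(\<integral>\<^sup>+x. ennreal (\<bar>g x\<bar> powr 1) \<partial>lebesgue) = (\<integral>\<^sup>+x. ennreal (\<bar>G x\<bar> powr 1) \<partial>lebesgue)"
    by (rule nn_integral_cong_AE) (use gG in \<open>auto simp: AE_lebesgue_iff elim!: eventually_mono\<close>)
  then have "in_Lp 1 G" using g by (simp add: in_Lp_def Lp_norm_def Let_def measurable_completion)
  then have Gi: "integrable lborel G" by (simp add: in_Lp_finite_iff integrable_abs_iff)
  have eq: "(LINT x|lebesgue. u t x * g x) = (\<integral>x. u t x * G x \<partial>lborel)" for t
    by (rule integral_lebesgue_AE_eq) (use gG in \<open>auto elim!: eventually_mono\<close>)
  have int: "integrable lborel (\<lambda>x. u t x * G x)" for t
  proof (rule Bochner_Integration.integrable_bound)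
    show "integrable lborel (\<lambda>x. R * G x)" using Gi by simp
    show "AE x in lborel. norm (u t x * G x) \<le> norm (R * G x)"
      using u_bound R_pos by (auto simp: abs_mult intro!: AE_I2 mult_right_mono)
  qed measurable
  have diff: "(\<integral>x. u s x * G x \<partial>lborel) - (\<integral>x. u t x * G x \<partial>lborel) = (\<integral>x. (u s x - u t x) * G x \<partial>lborel)" for s t
    using int by (simp add: left_diff_distrib)
  have "((\<lambda>s. \<integral>x. u s x * G x \<partial>lborel) \<longlongrightarrow> (\<integral>x. u t x * G x \<partial>lborel)) (at t within {0..})" if t0: "0 \<le> t" for t
  proof (rule LIM_zero_cancel, unfold diff, rule tendsto_at_halfline[OF t0])
    assume "t = 0"
    then show "((\<lambda>s. \<integral>x. (u s x - u t x) * G x \<partial>lborel) \<longlongrightarrow> 0) (at_right 0)"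
      using u_weak_limit_0[OF G Gi] by (simp add: u_initial)
  next
    assume t: "0 < t"
    let ?I = "\<integral>x. \<bar>G x\<bar> \<partial>lborel"
    have I0: "0 \<le> ?I" by simp
    show "((\<lambda>s. \<integral>x. (u s x - u t x) * G x \<partial>lborel) \<longlongrightarrow> 0) (at t)"
      unfolding tendsto_iff
    proof safe
      fix e :: real assume e: "0 < e"
      \<comment> \<open>Adding 1 covers a vanishing G and makes the final inequality strict.\<close>
      define d where "d = e / (?I + 1)"
      have I1: "0 < ?I + 1" using I0 by linarith
      have d: "0 < d" unfolding d_def by (rule divide_pos_pos[OF e I1])
      from u_uniform_limit[OF t d]
      show "eventually (\<lambda>s. dist (\<integral>x. (u s x - u t x) * G x \<partial>lborel) 0 < e) (at t)"
      proof eventually_elim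
        case (elim s)
        have i: "integrable lborel (\<lambda>x. (u s x - u t x) * G x)" using int by (simp add: left_diff_distrib)
        have "\<bar>\<integral>x. (u s x - u t x) * G x \<partial>lborel\<bar> \<le> (\<integral>x. \<bar>(u s x - u t x) * G x\<bar> \<partial>lborel)"
          by (rule integral_abs_bound)
        also have "\<dots> \<le> (\<integral>x. d * \<bar>G x\<bar> \<partial>lborel)"
          using Gi elim by (intro integral_mono[OF integrable_abs[OF i]]) (auto simp: abs_mult intro!: mult_right_mono)
        also have "\<dots> < d * (?I + 1)" using d by simp
        also have "\<dots> = e" using I1 by (simp add: d_def)
        finally show ?case by (simp add: dist_real_def)
      qed
    qed
  qed
  then show "continuous_on {0..} (\<lambda>t. LINT x|lebesgue. u t x * g x)"
    unfolding continuous_on eq by auto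
qed (rule u_in_Linf)

lemma u_continuous:
  assumes r: "1 \<le> r" and v0: "in_Lp r v0"
  shows "Linf_Lr_continuous_before \<infinity> r v0 u"
proof -
  have tb: "times_before \<infinity> = {0..}" by (auto simp: times_before_def)
  have sub: "(f \<longlongrightarrow> l) (at t) \<Longrightarrow> (f \<longlongrightarrow> l) (at t within S)" for f :: "real \<Rightarrow> ennreal" and l t S
    by (rule tendsto_within_subset) auto
  have inf: "Lp_continuous_on ({0..} - {0}) \<infinity> u"
    unfolding Lp_continuous_on_def
  proof (intro conjI ballI u_in_Linf)
    show "((\<lambda>s. Lp_norm \<infinity> (\<lambda>x. u s x - u t x)) \<longlongrightarrow> 0) (at t within {0..} - {0})" if "t \<in> {0..} - {0}" for t
      by (rule sub, rule u_Linf_limit) (use that in auto)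
  qed
  have fin: "Lp_continuous_on {0..} r u" if "r \<noteq> \<infinity>"
    unfolding Lp_continuous_on_def
    using u_Lr_limits[OF that r v0] by (auto intro!: tendsto_at_halfline)
  have fin': "Lp_continuous_on ({0..} - {0}) r u" if "r \<noteq> \<infinity>"
    unfolding Lp_continuous_on_def
  proof (intro conjI ballI)
    fix t :: real assume t: "t \<in> {0..} - {0}"
    show "in_Lp r (u t)" using u_Lr_limits(1)[OF that r v0, of t] t by simp
    show "((\<lambda>s. Lp_norm r (\<lambda>x. u s x - u t x)) \<longlongrightarrow> 0) (at t within {0..} - {0})"
      by (rule sub, rule u_Lr_limits(2)[OF that r v0]) (use t in auto)
  qed
  have uc: "Lp_continuous_on {0..} \<infinity> u" if "uniformly_continuous_on UNIV w" "AE x in lebesgue. v0 x = w x" for w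
    unfolding Lp_continuous_on_def
    using u_in_Linf u_Linf_limit u_Linf_limit_0[OF that] by (auto intro!: tendsto_at_halfline)
  show ?thesis
    unfolding Linf_Lr_continuous_before_def tb
    using inf fin fin' uc u_weak_continuous by (cases "r = \<infinity>") auto
qed

lemma well_posed:
  assumes nn: "(AE x in lebesgue. 0 \<le> v0 x) \<Longrightarrow> (\<And>x. 0 \<le> u0 x)"
  shows "\<exists>T>0. \<exists>u :: real \<Rightarrow> 'a \<Rightarrow> real.
    Linf_solution_on \<alpha> \<beta> p h0 v0 T u \<and>
    (\<forall>v. Linf_solution_on \<alpha> \<beta> p h0 v0 T v \<longrightarrow> agree_on {0..T} v u) \<and>
    (\<exists>Tm. Tm = maximal_time \<alpha> \<beta> p h0 v0 \<and> ereal T < Tm \<and>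
      (\<exists>U. agree_on {0..T} U u \<and>
        Linf_solution_until \<alpha> \<beta> p h0 v0 Tm U \<and>
        (\<forall>V. agree_on {0..T} V u \<longrightarrow> Linf_solution_until \<alpha> \<beta> p h0 v0 Tm V \<longrightarrow>
           agree_on (times_before Tm) V U) \<and>
        (Tm = \<infinity> \<longrightarrow> global_Linf_solution \<alpha> \<beta> p h0 v0 U) \<and>
        (Tm < \<infinity> \<longrightarrow> ((\<lambda>t. Lp_norm \<infinity> (U t)) \<longlongrightarrow> \<infinity>) (at_left (real_of_ereal Tm))) \<and>
        ((AE x in lebesgue. 0 \<le> v0 x) \<longrightarrow>
           (\<forall>t\<in>times_before Tm. AE x in lebesgue. 0 \<le> U t x)) \<and>
        (\<forall>r. 1 \<le> r \<longrightarrow> in_Lp r v0 \<longrightarrow> Linf_Lr_continuous_before Tm r v0 U)))"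
proof -
  have Tm: "maximal_time \<alpha> \<beta> p h0 v0 = \<infinity>"
    unfolding maximal_time_def
  proof (rule Sup_eqI)
    fix y :: ereal
    assume "\<And>x. x \<in> {ereal T' | T'. 0 < T' \<and> (\<exists>v. Linf_solution_on \<alpha> \<beta> p h0 v0 T' v)} \<Longrightarrow> x \<le> y"
    then have y: "ereal T' \<le> y" if "0 < T'" for T' using u_solution[of T'] that by blast
    show "\<infinity> \<le> y"
    proof (cases y)
      case (real b)
      have "0 < \<bar>b\<bar> + 1" by linarith
      from y[OF this] real show ?thesis by simp
    qed (use y[of 1] in auto)
  qed simp
  have until: "Linf_solution_until \<alpha> \<beta> p h0 v0 \<infinity> u"
    by (simp add: Linf_solution_until_def u_solution)
  have unique: "agree_on (times_before \<infinity>) V u" if V: "Linf_solution_until \<alpha> \<beta> p h0 v0 \<infinity> V" for V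
    unfolding agree_on_def
  proof
    fix t assume "t \<in> times_before \<infinity>"
    then have t: "0 \<le> t" by (simp add: times_before_def)
    \<comment> \<open>The interval ends at t + 1 because solutions are given on intervals of
      positive length only, and t may be 0.\<close>
    have "agree_on {0..t + 1} V u"
      using V t by (intro u_unique) (simp add: Linf_solution_until_def)
    then show "AE x in lebesgue. V t x = u t x" using t by (simp add: agree_on_def)
  qed
  have nonneg: "AE x in lebesgue. 0 \<le> u t x" if "AE x in lebesgue. 0 \<le> v0 x" for t
    using u_nonneg[OF nn[OF that]] by simp
  \<comment> \<open>As u solves the equation on every interval, any positive T serves; 1 is chosen,
    and u is its own continuation.\<close>
  show ?thesis
    unfolding Tm
    by (intro exI[of _ "1 :: real"] exI[of _ u] exI[of _ "\<infinity> :: ereal"] conjI allI impI ballI;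
      (rule nonneg u_unique unique u_continuous, assumption+
        | simp add: global_Linf_solution_def agree_on_def u_solution until))
qed

end

lemma heat_absorption_exists:
  fixes v0 :: "'a::euclidean_space \<Rightarrow> real"
  assumes \<alpha>: "0 < \<alpha>" "\<alpha> < 2" and \<beta>: "0 \<le> \<beta>" and p: "1 < p"
    and h: "\<And>t. 0 < t \<Longrightarrow> 0 < h0 t" "locally_integrable_halfline h0"
    and v0: "in_Lp \<infinity> v0"
  shows "\<exists>h R u0 u. heat_absorption \<alpha> \<beta> h p R u0 u h0 v0 \<and> ((AE x in lebesgue. 0 \<le> v0 x) \<longrightarrow> (\<forall>x. 0 \<le> u0 x))"
proof -
  obtain g where g: "g \<in> borel_measurable borel" "\<And>s. 0 \<le> g s" "AE s in lborel. 0 < s \<longrightarrow> h0 s = g s"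
    "\<And>b. integrable lborel (\<lambda>s. indicator {0<..<b} s * g s)"
    using locally_integrable_borel_representative[OF h(2,1)] by blast
  obtain u0 R where u0: "u0 \<in> borel_measurable borel" "0 < R" "\<And>x. \<bar>u0 x\<bar> \<le> R" "AE x in lborel. v0 x = u0 x"
    "(AE x in lborel. 0 \<le> v0 x) \<longrightarrow> (\<forall>x. 0 \<le> u0 x)"
    using Linf_borel_representative[OF v0] by blast
  interpret convolution_semigroup "heat_kernel \<alpha> :: real \<Rightarrow> 'a \<Rightarrow> real"
    by (rule heat_kernel_convolution_semigroup[OF \<alpha>])
  interpret absorption "heat_kernel \<alpha> :: real \<Rightarrow> 'a \<Rightarrow> real" g "clock \<beta>" p R u0
  proof
    show "clock \<beta> \<in> borel_measurable borel" unfolding clock_def[abs_def] by measurable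
  qed (use g u0 p \<beta> clock_mono clock_continuous in \<open>auto simp: clock_zero\<close>)
  obtain u where "absorption_solution (heat_kernel \<alpha>) g (clock \<beta>) p R u0 u"
    using solution_exists by blast
  then have "heat_absorption \<alpha> \<beta> g p R u0 u h0 v0"
    using \<alpha> g(3) u0(4) by (simp add: heat_absorption_def heat_absorption_axioms_def)
  then show ?thesis using u0(5) unfolding AE_lebesgue_iff by blast
qed

theorem theorem2:
  fixes \<alpha> \<beta> p :: real and h :: "real \<Rightarrow> real" and u0 :: "real ^ 'n \<Rightarrow> real"
  assumes "0 < \<alpha>" and "\<alpha> < 2" and "0 \<le> \<beta>" and "1 < p"
    and "\<And>t. 0 < t \<Longrightarrow> 0 < h t"
    and "locally_integrable_halfline h"
    and "in_Lp \<infinity> u0"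
  shows "\<exists>T>0. \<exists>u :: real \<Rightarrow> real ^ 'n \<Rightarrow> real.
    Linf_solution_on \<alpha> \<beta> p h u0 T u \<and>
    (\<forall>v. Linf_solution_on \<alpha> \<beta> p h u0 T v \<longrightarrow> agree_on {0..T} v u) \<and>
    (\<exists>Tm. Tm = maximal_time \<alpha> \<beta> p h u0 \<and> ereal T < Tm \<and>
      (\<exists>U. agree_on {0..T} U u \<and>
        Linf_solution_until \<alpha> \<beta> p h u0 Tm U \<and>
        (\<forall>V. agree_on {0..T} V u \<longrightarrow> Linf_solution_until \<alpha> \<beta> p h u0 Tm V \<longrightarrow>
           agree_on (times_before Tm) V U) \<and>
        (Tm = \<infinity> \<longrightarrow> global_Linf_solution \<alpha> \<beta> p h u0 U) \<and>
        (Tm < \<infinity> \<longrightarrow> ((\<lambda>t. Lp_norm \<infinity> (U t)) \<longlongrightarrow> \<infinity>) (at_left (real_of_ereal Tm))) \<and>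
        ((AE x in lebesgue. 0 \<le> u0 x) \<longrightarrow>
           (\<forall>t\<in>times_before Tm. AE x in lebesgue. 0 \<le> U t x)) \<and>
        (\<forall>r. 1 \<le> r \<longrightarrow> in_Lp r u0 \<longrightarrow> Linf_Lr_continuous_before Tm r u0 U)))"
proof -
  obtain g R w u where "heat_absorption \<alpha> \<beta> g p R w u h u0"
    and "(AE x in lebesgue. 0 \<le> u0 x) \<longrightarrow> (\<forall>x. 0 \<le> w x)"
    using heat_absorption_exists[OF assms] by blast
  then show ?thesis by (intro heat_absorption.well_posed) auto
qed

end
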